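(* For every $n\in\{107,108,\ldots,193\}$ we have $\sigma(n)\le 30$, i.e., there exists a conflict collection consisting of at most $30$ planar graphs on $n$ vertices. In particular, there exists a conflict collection consisting of $30$ planar graphs.
   Context: A straight-line embedding of a planar graph $G$ on a point set $P\subseteq\mathbb{R}^2$ is an injective map from $V(G)$ to $P$ such that drawing each edge $uv$ as the straight segment between the images of $u$ and $v$ yields a crossing-free drawing. A set $\mathcal{G}$ of planar graphs, all on $n$ vertices, is simultaneously embeddable if there is a set $P$ of $n$ points in the plane such that every $G\in\mathcal{G}$ has a straight-line embedding on $P$. A conflict collection is a set of planar graphs, all with the same number of vertices, that is not simultaneously embeddable. $\sigma(n)$ is the minimum size of a conflict collection consisting of $n$-vertex planar graphs. *)

theory Defs
  imports
    "HOL-Analysis.Analysis"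
    "HOL-Library.Extended_Nat"
    "Graph_Theory.Pair_Digraph"
begin

text \<open>
  A finite simple graph is a \<^locale>\<open>pair_graph\<close>: a finite, loop-free, symmetric digraph
  without parallel arcs. An undirected edge is thus represented by the two arcs
  \<open>(u,v)\<close> and \<open>(v,u)\<close>, which a drawing must send to the same point set.
\<close>

definition crossing_free_drawing ::
    "'a pair_pre_digraph \<Rightarrow> ('a \<Rightarrow> real^2) \<Rightarrow> ('a \<Rightarrow> 'a \<Rightarrow> (real^2) set) \<Rightarrow> bool" where
  "crossing_free_drawing G f D \<longleftrightarrow>
     inj_on f (pverts G) \<and>
     (\<forall>(u,v) \<in> parcs G. D u v = D v u \<and> D u v \<inter> f ` pverts G = {f u, f v}) \<and>
     (\<forall>(u,v) \<in> parcs G. \<forall>(x,y) \<in> parcs G. {u,v} \<noteq> {x,y} \<longrightarrow>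
        D u v \<inter> D x y = f ` ({u,v} \<inter> {x,y}))"

definition planar_graph :: "'a pair_pre_digraph \<Rightarrow> bool" where
  "planar_graph G \<longleftrightarrow> pair_graph G \<and>
     (\<exists>(f :: 'a \<Rightarrow> real^2) (\<gamma> :: 'a \<Rightarrow> 'a \<Rightarrow> real \<Rightarrow> real^2).
        (\<forall>(u,v) \<in> parcs G. arc (\<gamma> u v) \<and> pathstart (\<gamma> u v) = f u \<and> pathfinish (\<gamma> u v) = f v) \<and>
        crossing_free_drawing G f (\<lambda>u v. path_image (\<gamma> u v)))"

definition straight_line_embedding ::
    "'a pair_pre_digraph \<Rightarrow> (real^2) set \<Rightarrow> ('a \<Rightarrow> real^2) \<Rightarrow> bool" where
  "straight_line_embedding G P f \<longleftrightarrow>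
     f ` pverts G \<subseteq> P \<and> crossing_free_drawing G f (\<lambda>u v. closed_segment (f u) (f v))"

definition simultaneously_embeddable :: "nat \<Rightarrow> 'a pair_pre_digraph set \<Rightarrow> bool" where
  "simultaneously_embeddable n \<G> \<longleftrightarrow>
     (\<exists>P :: (real^2) set. finite P \<and> card P = n \<and> (\<forall>G \<in> \<G>. \<exists>f. straight_line_embedding G P f))"

definition conflict_collection :: "nat \<Rightarrow> 'a pair_pre_digraph set \<Rightarrow> bool" where
  "conflict_collection n \<G> \<longleftrightarrow>
     (\<forall>G \<in> \<G>. planar_graph G \<and> card (pverts G) = n) \<and> \<not> simultaneously_embeddable n \<G>"

text \<open>
  The minimum is taken in \<^typ>\<open>enat\<close>, so that it is \<open>\<infinity>\<close> (and not \<open>0\<close>) if there is no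
  finite conflict collection. Vertices are natural numbers; every finite graph has an
  isomorphic copy of this kind.
\<close>

definition \<sigma> :: "nat \<Rightarrow> enat" where
  "\<sigma> n = Inf {enat (card \<G>) |\<G> :: nat pair_pre_digraph set. finite \<G> \<and> conflict_collection n \<G>}"

end

theory Submission
  imports Defs "HOL-Combinatorics.Permutations"
begin

text \<open>
  Build plane triangulations by repeatedly stacking a new vertex into a face, starting from
  \<open>K\<^sub>4\<close>; there are \<open>2\<^sup>n\<^sup>-\<^sup>4 (n - 3)!\<close> such histories on \<open>n\<close> vertices. For a labelled point set in
  general position at most one history is drawn without crossings: by a winding number identity
  every new point that misses the outer face lies in exactly one inner face, and any
  other choice of face would force a crossing. Crossings depend only on orientations of triples,
  so a simultaneously embeddable tuple of \<open>30\<close> histories is determined by the order type of a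
  generic perturbation of the point set, labelled by the first drawing, and by \<open>29\<close> permutations.

  The number of order types is bounded by the number of sign patterns of quadratic polynomials in
  \<open>l = 2 n - 2\<close> variables. For each pattern \<open>\<sigma>\<close> a critical point of a penalized function
  \<open>\<tau> Q + (\<Sum>i\<in>S. (f\<^sub>i - c\<^sub>i)\<^sup>2)\<close> lies near the minimizer of \<open>Q\<close> on the cell of \<open>\<sigma>\<close>, where \<open>S\<close>, of size at
  most \<open>l\<close>, is the set of active constraints, and \<open>Q\<close> has leading part \<open>\<Sum>j. x\<^sub>j\<^sup>5 / 5\<close>. For fixed
  \<open>S\<close> and fixed signs on \<open>S\<close> these critical points solve a system \<open>x\<^sub>j\<^sup>4 = p\<^sub>j x\<close> with cubic
  \<open>p\<^sub>j\<close>, which has at most \<open>4\<^sup>l\<close> solutions.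
\<close>

section \<open>Zeros of polynomial systems\<close>

text \<open>The window for \<open>n\<close> comes from near cancellation of factorials. Of the 30
  factors \<open>fact (n - 3)\<close>, 29 meet the 29 factors \<open>fact n\<close>, at a cost of
  about n^87; the last one meets a bound on order types of size n^(4 n) up to exponential factors.
  So 2^(30 n) has to beat n^(3 n), n^87 and an explicit exponential. This fails for large
  \<open>n\<close> because of n^(3 n) and for small \<open>n\<close> because of n^87, and in between
  the margin is small enough that all constants in the order type bound must be explicit.

  The penalty is a sum of squares of quadratics, so its partial derivatives are cubic; degree 5 in
  \<open>Q\<close> makes the pure powers of degree 4 dominate the gradient. Any finite set of
  solutions of such a system is bounded by a dimension count, whatever \<tau> is and without regard
  to multiplicities or complex solutions. The levels are moved away from 0 generically, so that at
  most \<open>l\<close> constraints are active at any point.\<close>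

inductive polyf :: "nat \<Rightarrow> nat \<Rightarrow> ((nat \<Rightarrow> real) \<Rightarrow> real) \<Rightarrow> bool" for l where
  polyf_const: "polyf l d (\<lambda>_. c)"
| polyf_var: "j < l \<Longrightarrow> polyf l d p \<Longrightarrow> polyf l (Suc d) (\<lambda>x. x j * p x)"
| polyf_add: "polyf l d p \<Longrightarrow> polyf l d q \<Longrightarrow> polyf l d (\<lambda>x. p x + q x)"

lemma polyf_mono: "polyf l d p \<Longrightarrow> d \<le> e \<Longrightarrow> polyf l e p"
proof (induction arbitrary: e rule: polyf.induct)
  case (polyf_var j d p)
  then obtain e' where "e = Suc e'" "d \<le> e'" by (cases e) auto
  with polyf_var show ?case by (auto intro: polyf.polyf_var)
qed (auto intro: polyf.intros)

lemma polyf_cmult: "polyf l d p \<Longrightarrow> polyf l d (\<lambda>x. c * p x)"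
proof (induction rule: polyf.induct)
  case (polyf_var j d p)
  then show ?case using polyf.polyf_var[of j l d "\<lambda>x. c * p x"] by (simp add: mult.left_commute)
next
  case (polyf_add d p q)
  then show ?case using polyf.polyf_add[of l d "\<lambda>x. c * p x"] by (simp add: distrib_left)
qed (auto intro: polyf.intros)

lemma polyf_mult: "polyf l d p \<Longrightarrow> polyf l e q \<Longrightarrow> polyf l (d + e) (\<lambda>x. p x * q x)"
proof (induction rule: polyf.induct)
  case (polyf_const d c)
  then show ?case using polyf_mono[OF polyf_cmult] by simp
next
  case (polyf_var j d p)
  then show ?case using polyf.polyf_var[of j l "d + e" "\<lambda>x. p x * q x"] by (simp add: mult.assoc)
next
  case (polyf_add d p r)
  then show ?case using polyf.polyf_add[of l "d + e" "\<lambda>x. p x * q x"] by (simp add: distrib_right)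
qed

lemma polyf_coord: "j < l \<Longrightarrow> polyf l (Suc d) (\<lambda>x. x j)"
  using polyf_var[OF _ polyf_const[of l d 1]] by simp

lemma polyf_sum: "finite A \<Longrightarrow> (\<And>i. i \<in> A \<Longrightarrow> polyf l d (p i)) \<Longrightarrow> polyf l d (\<lambda>x. \<Sum>i\<in>A. p i x)"
  by (induction A rule: finite_induct) (auto intro: polyf_const polyf_add)

lemma polyf_diff: "polyf l d p \<Longrightarrow> polyf l d q \<Longrightarrow> polyf l d (\<lambda>x. p x - q x)"
  using polyf_add[of l d p "\<lambda>x. (-1) * q x"] polyf_cmult[of l d q "-1"] by simp

lemma polyf_deriv:
  assumes "polyf l d p" "j < l"
  shows "\<exists>p'. polyf l (d - 1) p' \<and>
    (\<forall>x. ((\<lambda>t. p (x(j := t))) has_real_derivative p' x) (at (x j)))"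
proof -
  \<comment> \<open>The clause for \<open>d = 0\<close> compensates for the truncated
    \<open>d - 1\<close>: in the product rule, \<open>x i * p' x\<close> would otherwise get degree
    bound 1 instead of the required 0.\<close>
  have "\<exists>p'. polyf l (d - 1) p' \<and> (d = 0 \<longrightarrow> p' = (\<lambda>_. 0)) \<and>
    (\<forall>x. ((\<lambda>t. p (x(j := t))) has_real_derivative p' x) (at (x j)))"
    using assms
  proof (induction rule: polyf.induct)
    case (polyf_const d c)
    show ?case by (rule exI[of _ "\<lambda>_. 0"]) (auto intro: polyf.polyf_const)
  next
    case (polyf_var i d p)
    then obtain p' where p': "polyf l (d - 1) p'" "d = 0 \<longrightarrow> p' = (\<lambda>_. 0)"
      "\<And>x. ((\<lambda>t. p (x(j := t))) has_real_derivative p' x) (at (x j))" by blast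
    have xp: "polyf l d (\<lambda>x. x i * p' x)"
    proof (cases d)
      case 0
      then show ?thesis using p' by (simp add: polyf.polyf_const)
    next
      case (Suc d')
      then show ?thesis using p' polyf.polyf_var[OF \<open>i < l\<close>, of d' p'] by simp
    qed
    have D: "((\<lambda>t. (x(j := t)) i * p (x(j := t))) has_real_derivative
        (if i = j then p x else 0) + x i * p' x) (at (x j))" for x
    proof (cases "i = j")
      case True
      then show ?thesis using DERIV_mult[OF DERIV_ident p'(3)[of x]] by (simp add: algebra_simps)
    next
      case False
      then show ?thesis using DERIV_cmult[OF p'(3)[of x], of "x i"] by simp
    qed
    have "polyf l d (\<lambda>x. (if i = j then p x else 0) + x i * p' x)"
      using xp polyf_add[OF polyf_var(2) xp] by (cases "i = j") auto
    then have P: "polyf l (Suc d - 1) (\<lambda>x. (if i = j then p x else 0) + x i * p' x)" by simp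
    have D': "\<forall>x. ((\<lambda>t. (x(j := t)) i * p (x(j := t))) has_real_derivative
        (if i = j then p x else 0) + x i * p' x) (at (x j))" using D by blast
    show ?case
      by (rule exI[of _ "\<lambda>x. (if i = j then p x else 0) + x i * p' x"]) (intro conjI impI P D', simp)
  next
    case (polyf_add d p q)
    then obtain p' q' where p': "polyf l (d - 1) p'" "d = 0 \<longrightarrow> p' = (\<lambda>_. 0)"
      "\<And>x. ((\<lambda>t. p (x(j := t))) has_real_derivative p' x) (at (x j))"
      and q': "polyf l (d - 1) q'" "d = 0 \<longrightarrow> q' = (\<lambda>_. 0)"
      "\<And>x. ((\<lambda>t. q (x(j := t))) has_real_derivative q' x) (at (x j))" by blast
    have D: "\<forall>x. ((\<lambda>t. p (x(j := t)) + q (x(j := t))) has_real_derivative p' x + q' x) (at (x j))"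
      by (intro allI DERIV_add p'(3) q'(3))
    show ?case
      by (rule exI[of _ "\<lambda>x. p' x + q' x"], intro conjI impI polyf.polyf_add p'(1) q'(1) D)
        (use p'(2) q'(2) in simp)
  qed
  then show ?thesis by blast
qed

lemma polyf_continuous: "polyf l d p \<Longrightarrow> continuous_on UNIV p"
  by (induction rule: polyf.induct) (auto intro!: continuous_intros)

text \<open>The bound on the values is carried along because the product case rests on x_i p(x) -
  y_i p(y) = (x_i - y_i) p(x) + y_i (p(x) - p(y)). The number \<open>r\<close> stands for the
  maximum distance in the first \<open>l\<close> coordinates.\<close>

lemma polyf_lipschitz:
  assumes "polyf l d p"
  shows "\<exists>L\<ge>0. \<forall>r\<ge>0. \<forall>x y. (\<forall>j<l. \<bar>x j\<bar> \<le> R \<and> \<bar>y j\<bar> \<le> R \<and> \<bar>x j - y j\<bar> \<le> r) \<longrightarrow>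
    \<bar>p x\<bar> \<le> L \<and> \<bar>p x - p y\<bar> \<le> L * r"
  using assms
proof (induction rule: polyf.induct)
  case (polyf_const d c)
  show ?case by (rule exI[of _ "\<bar>c\<bar>"]) auto
next
  case (polyf_var i d p)
  then obtain L where L: "L \<ge> 0" "\<And>r x y. r \<ge> 0 \<Longrightarrow> (\<forall>j<l. \<bar>x j\<bar> \<le> R \<and> \<bar>y j\<bar> \<le> R \<and> \<bar>x j - y j\<bar> \<le> r) \<Longrightarrow>
    \<bar>p x\<bar> \<le> L \<and> \<bar>p x - p y\<bar> \<le> L * r" by metis
  have "\<bar>x i * p x\<bar> \<le> L * (\<bar>R\<bar> + 1) \<and> \<bar>x i * p x - y i * p y\<bar> \<le> L * (\<bar>R\<bar> + 1) * r"
    if r: "r \<ge> 0" and xy: "\<forall>j<l. \<bar>x j\<bar> \<le> R \<and> \<bar>y j\<bar> \<le> R \<and> \<bar>x j - y j\<bar> \<le> r" for r x y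
  proof -
    have px: "\<bar>p x\<bar> \<le> L" and pxy: "\<bar>p x - p y\<bar> \<le> L * r" using L(2)[OF r xy] by auto
    have i: "\<bar>x i\<bar> \<le> \<bar>R\<bar>" "\<bar>y i\<bar> \<le> \<bar>R\<bar>" "\<bar>x i - y i\<bar> \<le> r" using xy polyf_var(1) by force+
    have 1: "\<bar>x i * p x\<bar> \<le> \<bar>R\<bar> * L"
      unfolding abs_mult using i px by (intro mult_mono) auto
    have "x i * p x - y i * p y = (x i - y i) * p x + y i * (p x - p y)" by (simp add: algebra_simps)
    then have "\<bar>x i * p x - y i * p y\<bar> \<le> \<bar>x i - y i\<bar> * \<bar>p x\<bar> + \<bar>y i\<bar> * \<bar>p x - p y\<bar>"
      by (metis abs_mult abs_triangle_ineq)
    also have "\<dots> \<le> r * L + \<bar>R\<bar> * (L * r)"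
      using i px pxy r L(1) by (intro add_mono mult_mono) auto
    finally show ?thesis using 1 L(1) by (simp add: algebra_simps)
  qed
  then show ?case using L(1) by (intro exI[of _ "L * (\<bar>R\<bar> + 1)"]) auto
next
  case (polyf_add d p q)
  then obtain L where L: "L \<ge> 0" "\<And>r x y. r \<ge> 0 \<Longrightarrow> (\<forall>j<l. \<bar>x j\<bar> \<le> R \<and> \<bar>y j\<bar> \<le> R \<and> \<bar>x j - y j\<bar> \<le> r) \<Longrightarrow>
    \<bar>p x\<bar> \<le> L \<and> \<bar>p x - p y\<bar> \<le> L * r" by metis
  from polyf_add obtain K where K: "K \<ge> 0" "\<And>r x y. r \<ge> 0 \<Longrightarrow> (\<forall>j<l. \<bar>x j\<bar> \<le> R \<and> \<bar>y j\<bar> \<le> R \<and> \<bar>x j - y j\<bar> \<le> r) \<Longrightarrow>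
    \<bar>q x\<bar> \<le> K \<and> \<bar>q x - q y\<bar> \<le> K * r" by metis
  have "\<bar>p x + q x\<bar> \<le> L + K \<and> \<bar>p x + q x - (p y + q y)\<bar> \<le> (L + K) * r"
    if r: "r \<ge> 0" and xy: "\<forall>j<l. \<bar>x j\<bar> \<le> R \<and> \<bar>y j\<bar> \<le> R \<and> \<bar>x j - y j\<bar> \<le> r" for r x y
    using L(2)[OF r xy] K(2)[OF r xy] by (auto simp: algebra_simps)
  then show ?case using L(1) K(1) by (intro exI[of _ "L + K"]) auto
qed

text \<open>Real polynomials only serve as some vector space of infinite dimension, in which vectors
  indexed by a finite set can be encoded.\<close>

interpretation poly_vs: vector_space "smult :: real \<Rightarrow> real poly \<Rightarrow> real poly"
  by standard (simp_all add: smult_add_left smult_add_right)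

text \<open>A rank argument: the indicators of points are a basis of the functions on
  \<open>Z\<close>, and they lie in the span of the functions \<open>M b\<close>. A function on
  \<open>Z\<close> is encoded as the polynomial with its values as coefficients.\<close>

lemma card_le_if_indicators_spanned:
  fixes M :: "'b \<Rightarrow> 'z \<Rightarrow> real"
  assumes Z: "finite Z" and B: "finite B"
    and ex: "\<And>z. z \<in> Z \<Longrightarrow> \<exists>c. \<forall>w\<in>Z. (\<Sum>b\<in>B. c b * M b w) = (if w = z then 1 else 0)"
  shows "card Z \<le> card B"
proof -
  obtain idx :: "'z \<Rightarrow> nat" where idx: "inj_on idx Z"
    using finite_imp_inj_to_nat_seg[OF Z] by blast
  define v where "v b = (\<Sum>w\<in>Z. monom (M b w) (idx w))" for b
  define e :: "'z \<Rightarrow> real poly" where "e z = monom 1 (idx z)" for z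
  have inj: "inj_on e Z"
    using idx by (auto simp: inj_on_def e_def monom_eq_iff' )
  have span: "e z \<in> poly_vs.span (v ` B)" if z: "z \<in> Z" for z
  proof -
    obtain c where c: "\<And>w. w \<in> Z \<Longrightarrow> (\<Sum>b\<in>B. c b * M b w) = (if w = z then 1 else 0)"
      using ex[OF z] by blast
    have "(\<Sum>b\<in>B. smult (c b) (v b)) = (\<Sum>w\<in>Z. \<Sum>b\<in>B. monom (c b * M b w) (idx w))"
      by (subst sum.swap) (simp add: v_def poly_vs.scale_sum_right smult_monom)
    also have "\<dots> = (\<Sum>w\<in>Z. monom (\<Sum>b\<in>B. c b * M b w) (idx w))"
      by (simp add: monom_sum)
    also have "\<dots> = (\<Sum>w\<in>Z. if w = z then e z else 0)"
      using c by (intro sum.cong) (auto simp: e_def)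
    also have "\<dots> = e z" using Z z by simp
    finally show ?thesis
      by (metis (no_types, lifting) poly_vs.span_sum poly_vs.span_scale poly_vs.span_base imageI)
  qed
  have indep: "poly_vs.independent (e ` Z)"
  proof
    assume "poly_vs.dependent (e ` Z)"
    then obtain f x where s: "(\<Sum>x\<in>e ` Z. smult (f x) x) = 0" and x: "x \<in> e ` Z" "f x \<noteq> 0"
      using poly_vs.dependent_finite[OF finite_imageI[OF Z]] by blast
    then obtain z where z: "z \<in> Z" "x = e z" by auto
    have "0 = coeff (\<Sum>x\<in>e ` Z. smult (f x) x) (idx z)" using s by simp
    also have "\<dots> = (\<Sum>w\<in>Z. f (e w) * coeff (e w) (idx z))"
      by (simp add: sum.reindex[OF inj] coeff_sum)
    also have "\<dots> = (\<Sum>w\<in>Z. if w = z then f x else 0)"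
      using z idx by (intro sum.cong) (auto simp: e_def inj_on_def)
    also have "\<dots> = f x" using Z z by simp
    finally show False using x(2) by simp
  qed
  have "e ` Z \<subseteq> poly_vs.span (v ` B)" using span by blast
  then have "card (e ` Z) \<le> card (v ` B)"
    by (rule poly_vs.independent_span_bound[OF finite_imageI[OF B] indep, THEN conjunct2])
  also have "\<dots> \<le> card B" by (rule card_image_le[OF B])
  finally show ?thesis by (simp add: card_image[OF inj])
qed

text \<open>Modulo the equations every polynomial function on \<open>Z\<close> is a combination of the \<open>4\<^sup>l\<close> monomials
  with all exponents below \<open>4\<close>.\<close>

lemma polyf_zeros_bound:
  fixes Z :: "(nat \<Rightarrow> real) set"
  assumes fin: "finite Z" and supp: "\<And>z j. z \<in> Z \<Longrightarrow> l \<le> j \<Longrightarrow> z j = 0"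
    and p: "\<And>j. j < l \<Longrightarrow> polyf l 3 (p j)"
    and eq: "\<And>z j. z \<in> Z \<Longrightarrow> j < l \<Longrightarrow> z j ^ 4 = p j z"
  shows "card Z \<le> 4 ^ l"
proof -
  define Box :: "(nat \<Rightarrow> nat) set" where "Box = PiE {..<l} (\<lambda>_. {..<4})"
  define mon :: "(nat \<Rightarrow> nat) \<Rightarrow> (nat \<Rightarrow> real) \<Rightarrow> real" where "mon \<alpha> x = (\<Prod>j<l. x j ^ \<alpha> j)" for \<alpha> x
  define Bd where "Bd d = {\<alpha> \<in> Box. sum \<alpha> {..<l} \<le> d}" for d
  \<comment> \<open>Only the box matters in the end. The degree is kept so that substituting the
    equations can be justified by induction on it.\<close>
  define Rep where "Rep d f \<longleftrightarrow> (\<exists>c. \<forall>z\<in>Z. f z = (\<Sum>\<alpha>\<in>Bd d. c \<alpha> * mon \<alpha> z))" for d and f :: "(nat \<Rightarrow> real) \<Rightarrow> real"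
  have finBox: "finite Box" by (auto simp: Box_def intro: finite_PiE)
  have finBd: "finite (Bd d)" for d using finBox by (simp add: Bd_def)
  have cardBox: "card Box = 4 ^ l" by (simp add: Box_def card_PiE)
  have Rep_mon: "Rep d (mon \<alpha>)" if "\<alpha> \<in> Bd d" for d \<alpha>
    unfolding Rep_def
  proof (intro exI[of _ "\<lambda>\<beta>. if \<beta> = \<alpha> then 1 else 0"] ballI)
    fix z
    have "(\<Sum>\<beta>\<in>Bd d. (if \<beta> = \<alpha> then 1 else 0) * mon \<beta> z) = (\<Sum>\<beta>\<in>Bd d. if \<beta> = \<alpha> then mon \<alpha> z else 0)"
      by (intro sum.cong) auto
    then show "mon \<alpha> z = (\<Sum>\<beta>\<in>Bd d. (if \<beta> = \<alpha> then 1 else 0) * mon \<beta> z)"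
      using that finBd by simp
  qed
  have Rep_cmult: "Rep d (\<lambda>x. c * f x)" if R: "Rep d f" for d f c
  proof -
    obtain a where "\<forall>z\<in>Z. f z = (\<Sum>\<alpha>\<in>Bd d. a \<alpha> * mon \<alpha> z)" using R by (auto simp: Rep_def)
    then show ?thesis unfolding Rep_def
      by (intro exI[of _ "\<lambda>\<alpha>. c * a \<alpha>"]) (simp add: sum_distrib_left mult.assoc)
  qed
  have Rep_add: "Rep d (\<lambda>x. f x + g x)" if R: "Rep d f" "Rep d g" for d f g
  proof -
    obtain a b where "\<forall>z\<in>Z. f z = (\<Sum>\<alpha>\<in>Bd d. a \<alpha> * mon \<alpha> z)" "\<forall>z\<in>Z. g z = (\<Sum>\<alpha>\<in>Bd d. b \<alpha> * mon \<alpha> z)"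
      using R by (auto simp: Rep_def)
    then show ?thesis unfolding Rep_def
      by (intro exI[of _ "\<lambda>\<alpha>. a \<alpha> + b \<alpha>"]) (simp add: sum.distrib distrib_right)
  qed
  have Rep_cong: "Rep d f" if "Rep d g" "\<And>z. z \<in> Z \<Longrightarrow> f z = g z" for d f g
    using that by (simp add: Rep_def)
  have Rep_zero: "Rep d (\<lambda>_. 0)" for d
    unfolding Rep_def by (intro exI[of _ "\<lambda>_. 0"]) simp
  have Rep_sum: "Rep d (\<lambda>x. \<Sum>i\<in>A. c i * f i x)" if "finite A" "\<And>i. i \<in> A \<Longrightarrow> Rep d (f i)"
    for d and A :: "(nat \<Rightarrow> nat) set" and f c
    using that by (induction A rule: finite_induct) (simp_all add: Rep_zero Rep_add Rep_cmult)
  have Rep_mono: "Rep e f" if R: "Rep d f" and de: "d \<le> e" for d e f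
  proof -
    obtain a where a: "\<And>z. z \<in> Z \<Longrightarrow> f z = (\<Sum>\<alpha>\<in>Bd d. a \<alpha> * mon \<alpha> z)" using R by (auto simp: Rep_def)
    have "Rep e (\<lambda>x. \<Sum>\<alpha>\<in>Bd d. a \<alpha> * mon \<alpha> x)"
      using de by (intro Rep_sum finBd Rep_mon) (auto simp: Bd_def)
    then show ?thesis using a by (rule Rep_cong)
  qed
  have monpoly: "polyf l (sum \<alpha> A) (\<lambda>x. \<Prod>j\<in>A. x j ^ \<alpha> j)" if "A \<subseteq> {..<l}" for \<alpha> and A :: "nat set"
  proof -
    have "finite A" using that finite_subset by blast
    then show ?thesis using that
    proof (induction A rule: finite_induct)
      case empty then show ?case by (simp add: polyf_const)
    next
      case (insert j A)
      have "polyf l k (\<lambda>x. x j ^ k)" for k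
        using insert.prems by (induction k) (auto intro: polyf_const polyf_var)
      from polyf_mult[OF this insert.IH] insert show ?case by simp
    qed
  qed
  have key: "polyf l d f \<Longrightarrow> Rep d f" for d f
  proof (induction d arbitrary: f)
    case 0
    then show ?case
    proof (induction "0::nat" f rule: polyf.induct)
      case (polyf_const c)
      have "(\<lambda>j\<in>{..<l}. 0) \<in> Bd 0" by (auto simp: Bd_def Box_def sum.neutral)
      from Rep_cmult[OF Rep_mon[OF this], of c] show ?case by (simp add: mon_def)
    qed (simp add: Rep_add)
  next
    case (Suc d)
    have step: "Rep (Suc d) (\<lambda>x. x j * mon \<alpha> x)" if j: "j < l" and \<alpha>: "\<alpha> \<in> Bd d" for j \<alpha>
    proof -
      have \<alpha>B: "\<alpha> \<in> Box" "sum \<alpha> {..<l} \<le> d" using \<alpha> by (auto simp: Bd_def)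
      have split: "mon \<beta> x = x j ^ \<beta> j * (\<Prod>i\<in>{..<l} - {j}. x i ^ \<beta> i)" for \<beta> x
        using j unfolding mon_def by (subst prod.remove[of _ j]) auto
      have splits: "sum \<beta> {..<l} = \<beta> j + sum \<beta> ({..<l} - {j})" for \<beta> :: "nat \<Rightarrow> nat"
        using j by (subst sum.remove[of _ j]) auto
      show ?thesis
      proof (cases "\<alpha> j < 3")
        case True
        define \<beta> where "\<beta> = \<alpha>(j := Suc (\<alpha> j))"
        have "\<beta> \<in> Box" using \<alpha>B(1) True j unfolding Box_def \<beta>_def
          by (auto simp: PiE_iff extensional_def)
        moreover have "sum \<beta> ({..<l} - {j}) = sum \<alpha> ({..<l} - {j})"
          by (intro sum.cong) (auto simp: \<beta>_def)
        ultimately have "\<beta> \<in> Bd (Suc d)"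
          using \<alpha>B(2) splits[of \<alpha>] splits[of \<beta>] by (simp add: Bd_def \<beta>_def)
        moreover have "x j * mon \<alpha> x = mon \<beta> x" for x
        proof -
          have "(\<Prod>i\<in>{..<l} - {j}. x i ^ \<beta> i) = (\<Prod>i\<in>{..<l} - {j}. x i ^ \<alpha> i)"
            by (intro prod.cong) (auto simp: \<beta>_def)
          then show ?thesis unfolding split[of \<alpha>] split[of \<beta>] by (simp add: \<beta>_def)
        qed
        ultimately show ?thesis using Rep_mon by simp
      next
        case False
        have a3: "\<alpha> j = 3" using False \<alpha>B(1) j by (force simp: Box_def PiE_iff)
        \<comment> \<open>Here \<open>x j * mon \<alpha> x\<close> contains the fourth power of
          \<open>x j\<close>, which equals \<open>p j x\<close> on \<open>Z\<close>. Since
          \<open>p j\<close> has degree 3, the result has degree at most \<open>d\<close> and falls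
          under the induction hypothesis.\<close>
        have "polyf l (3 + sum \<alpha> ({..<l} - {j})) (\<lambda>x. p j x * (\<Prod>i\<in>{..<l} - {j}. x i ^ \<alpha> i))"
          using j by (intro polyf_mult p monpoly) auto
        then have "polyf l d (\<lambda>x. p j x * (\<Prod>i\<in>{..<l} - {j}. x i ^ \<alpha> i))"
          by (rule polyf_mono) (use \<alpha>B(2) splits[of \<alpha>] a3 in simp)
        from Rep_mono[OF Suc.IH[OF this]]
        have "Rep (Suc d) (\<lambda>x. p j x * (\<Prod>i\<in>{..<l} - {j}. x i ^ \<alpha> i))" by simp
        then show ?thesis
          by (rule Rep_cong)
            (use eq j in \<open>auto simp: split[of \<alpha>] a3 power4_eq_xxxx power3_eq_cube mult.assoc\<close>)
      qed
    qed
    show ?case using Suc.prems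
    proof (induction "Suc d" f rule: polyf.induct)
      case (polyf_const c)
      have "Rep d (\<lambda>_. c)" by (rule Suc.IH) (rule polyf.polyf_const)
      then show ?case by (rule Rep_mono) simp
    next
      case (polyf_var j p)
      obtain a where a: "\<And>z. z \<in> Z \<Longrightarrow> p z = (\<Sum>\<alpha>\<in>Bd d. a \<alpha> * mon \<alpha> z)"
        using Suc.IH[OF polyf_var(2)] by (auto simp: Rep_def)
      have "Rep (Suc d) (\<lambda>x. \<Sum>\<alpha>\<in>Bd d. a \<alpha> * (x j * mon \<alpha> x))"
        by (intro Rep_sum finBd step polyf_var(1))
      then show ?case
        by (rule Rep_cong) (simp add: a sum_distrib_left algebra_simps)
    qed (simp add: Rep_add)
  qed
  have "card Z \<le> card Box"
  proof (rule card_le_if_indicators_spanned[OF fin finBox, of mon])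
    fix z assume z: "z \<in> Z"
    have ex: "\<exists>j<l. w j \<noteq> z j" if "w \<in> Z" "w \<noteq> z" for w
    proof (rule ccontr)
      assume "\<not> ?thesis"
      then have "w j = z j" for j using supp[OF that(1), of j] supp[OF z, of j] by (cases "j < l") auto
      then show False using that(2) by blast
    qed
    \<comment> \<open>Lagrange interpolation: for each \<open>w\<close> a linear factor in a
      coordinate that separates \<open>w\<close> from \<open>z\<close>. The degree may be large,
      since \<open>key\<close> reduces every polynomial.\<close>
    have "\<exists>d f. polyf l d f \<and> f z = 1 \<and> (\<forall>w\<in>W. f w = 0)" if "finite W" "W \<subseteq> Z - {z}" for W
      using that
    proof (induction W rule: finite_induct)
      case empty
      then show ?case using polyf_const[of l 0 1] by (intro exI[of _ 0] exI[of _ "\<lambda>_. 1"]) auto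
    next
      case (insert w W)
      then obtain d f where f: "polyf l d f" "f z = 1" "\<forall>w\<in>W. f w = 0" by auto
      obtain j where j: "j < l" "w j \<noteq> z j" using ex insert.prems by blast
      let ?g = "\<lambda>x. inverse (z j - w j) * (x j - w j)"
      have "polyf l 1 ?g" using j polyf_coord[of j l 0]
        by (intro polyf_cmult polyf_diff polyf_const) auto
      from polyf_mult[OF this f(1)] f j
      show ?case by (intro exI[of _ "1 + d"] exI[of _ "\<lambda>x. ?g x * f x"]) auto
    qed
    from this[of "Z - {z}"] fin obtain d f where f: "polyf l d f" "f z = 1" "\<forall>w\<in>Z - {z}. f w = 0"
      by auto
    obtain c where c: "\<forall>w\<in>Z. f w = (\<Sum>\<alpha>\<in>Bd d. c \<alpha> * mon \<alpha> w)"
      using key[OF f(1)] by (auto simp: Rep_def)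
    have "(\<Sum>\<alpha>\<in>Box. (if \<alpha> \<in> Bd d then c \<alpha> else 0) * mon \<alpha> w) = (if w = z then 1 else 0)" if "w \<in> Z" for w
    proof -
      have "(\<Sum>\<alpha>\<in>Box. (if \<alpha> \<in> Bd d then c \<alpha> else 0) * mon \<alpha> w) = (\<Sum>\<alpha>\<in>Bd d. c \<alpha> * mon \<alpha> w)"
        using finBox by (intro sum.mono_neutral_cong_right) (auto simp: Bd_def)
      then show ?thesis using c f that by auto
    qed
    then show "\<exists>c. \<forall>w\<in>Z. (\<Sum>\<alpha>\<in>Box. c \<alpha> * mon \<alpha> w) = (if w = z then 1 else 0)"
      by (intro exI[of _ "\<lambda>\<alpha>. if \<alpha> \<in> Bd d then c \<alpha> else 0"] ballI)
  qed
  then show ?thesis by (simp add: cardBox)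
qed

section \<open>Sign patterns of quadratic polynomials\<close>

text \<open>Tychonoff. Points are functions on all natural numbers, and boxes in the first
  \<open>l\<close> coordinates become compact by pinning the others to singletons.\<close>

lemma compact_product_set:
  fixes K :: "'i \<Rightarrow> 'a::topological_space set"
  assumes "\<And>i. compact (K i)"
  shows "compact {x. \<forall>i. x i \<in> K i}"
proof -
  have "compactin (product_topology (\<lambda>_. euclidean) UNIV) (PiE UNIV K)"
    using assms by (subst compactin_PiE) auto
  then show ?thesis by (simp add: euclidean_product_topology PiE_def Pi_def)
qed

text \<open>A pigeonhole argument replaces Sard's theorem. Let the levels be indexed by \<open>t\<close>, with \<open>T\<close> values
  each. If \<open>l + 1\<close> levels are attained at a common point \<open>x t\<close>, then the grid cell of \<open>x t\<close> determines
  the indices of these levels, and there are only \<open>O(T ^ l)\<close> cells.\<close>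

lemma generic_levels:
  fixes f :: "'i \<Rightarrow> (nat \<Rightarrow> real) \<Rightarrow> real"
  assumes fin: "finite I" and poly: "\<And>i. i \<in> I \<Longrightarrow> polyf l d (f i)" and \<delta>: "\<delta> > 0"
  shows "\<exists>\<epsilon>. (\<forall>i\<in>I. 0 < \<epsilon> i \<and> \<epsilon> i < \<delta>) \<and>
    (\<forall>x. (\<forall>j<l. \<bar>x j\<bar> \<le> R) \<longrightarrow> card {i \<in> I. \<bar>f i x\<bar> = \<epsilon> i} \<le> l)"
proof -
  have "\<forall>i\<in>I. \<exists>L\<ge>0. \<forall>r\<ge>0. \<forall>x y. (\<forall>j<l. \<bar>x j\<bar> \<le> R \<and> \<bar>y j\<bar> \<le> R \<and> \<bar>x j - y j\<bar> \<le> r) \<longrightarrow>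
      \<bar>f i x - f i y\<bar> \<le> L * r"
    using polyf_lipschitz[OF poly, where R = R] by meson
  then obtain L' where L': "\<And>i. i \<in> I \<Longrightarrow> L' i \<ge> 0"
    "\<And>i r x y. i \<in> I \<Longrightarrow> r \<ge> 0 \<Longrightarrow> (\<forall>j<l. \<bar>x j\<bar> \<le> R \<and> \<bar>y j\<bar> \<le> R \<and> \<bar>x j - y j\<bar> \<le> r) \<Longrightarrow>
      \<bar>f i x - f i y\<bar> \<le> L' i * r" by metis
  define L where "L = 1 + (\<Sum>i\<in>I. L' i)"
  have LL: "L' i \<le> L" if "i \<in> I" for i
    using member_le_sum[OF that, of L'] L'(1) fin by (force simp: L_def)
  have L1: "L \<ge> 1" using L'(1) by (simp add: L_def sum_nonneg)
  define m where "m = card I"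
  \<comment> \<open>The number of grid intervals per axis will be at most \<open>a * T\<close>, with
    \<open>a\<close> independent of \<open>T\<close>. So \<open>T\<close> can then be chosen above
    the constant \<open>2 ^ m * a ^ l\<close> of the final count.\<close>
  define a where "a = nat \<lceil>8 * \<bar>R\<bar> * L / \<delta> + 5\<rceil>"
  define T where "T = Suc (2 ^ m * a ^ l)"
  \<comment> \<open>The mesh is \<open>1 / K\<close>: inside a grid cell each \<open>f i\<close>
    varies by at most \<open>L / K = u / 2\<close>, half the distance \<open>u\<close> of
    neighbouring levels.\<close>
  define K where "K = 2 * L * (real T + 1) / \<delta>"
  have K0: "K > 0" using L1 \<delta> by (simp add: K_def)
  define N where "N = nat (\<lceil>\<bar>R\<bar> * K\<rceil> + 1)"
  have N: "2 * N + 1 \<le> a * T"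
  proof -
    have T1: "real T \<ge> 1" by (simp add: T_def)
    define c where "c = \<bar>R\<bar> * (4 * L * T / \<delta>)"
    have "0 \<le> \<bar>R\<bar> * K" using K0 by simp
    then have "real N = of_int (\<lceil>\<bar>R\<bar> * K\<rceil> + 1)" unfolding N_def by (intro of_nat_nat) linarith
    then have "real N \<le> \<bar>R\<bar> * K + 2" by linarith
    also have "\<dots> \<le> \<bar>R\<bar> * (4 * L * T / \<delta>) + 2 * real T"
    proof -
      have "K \<le> 4 * L * T / \<delta>"
        unfolding K_def using L1 \<delta> T1 by (intro divide_right_mono) (auto simp: algebra_simps)
      then show ?thesis using T1 by (intro add_mono mult_left_mono) auto
    qed
    finally have "real N \<le> c + 2 * real T" unfolding c_def .
    then have "2 * real N + 1 \<le> 2 * (c + 2 * real T) + real T" using T1 by simp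
    also have "\<dots> = (8 * \<bar>R\<bar> * L / \<delta> + 5) * T" by (simp add: c_def algebra_simps)
    also have "\<dots> \<le> real a * T" unfolding a_def by (intro mult_right_mono) linarith+
    finally have "real (2 * N + 1) \<le> real (a * T)" by simp
    then show ?thesis by linarith
  qed
  define G where "G = PiE I (\<lambda>_. {1..T})"
  define u where "u = \<delta> / (real T + 1)"
  have u0: "u > 0" using \<delta> by (simp add: u_def)
  define \<epsilon> where "\<epsilon> t i = u * real (t i)" for t :: "'i \<Rightarrow> nat" and i
  show ?thesis
  proof (rule ccontr)
    assume neg: "\<not> ?thesis"
    have "\<exists>x S. (\<forall>j<l. \<bar>x j\<bar> \<le> R) \<and> S \<subseteq> I \<and> card S = Suc l \<and> (\<forall>i\<in>S. \<bar>f i x\<bar> = \<epsilon> t i)" if t: "t \<in> G" for t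
    proof -
      have "0 < \<epsilon> t i \<and> \<epsilon> t i < \<delta>" if "i \<in> I" for i
      proof -
        have "1 \<le> t i" "t i \<le> T" using t that by (auto simp: G_def)
        moreover from this have "u * real (t i) < u * (real T + 1)"
          using u0 by (intro mult_strict_left_mono) auto
        moreover have "u * (real T + 1) = \<delta>" by (simp add: u_def add_pos_nonneg)
        ultimately show ?thesis using u0 by (simp add: \<epsilon>_def)
      qed
      with neg obtain x where x: "\<forall>j<l. \<bar>x j\<bar> \<le> R" "card {i \<in> I. \<bar>f i x\<bar> = \<epsilon> t i} > l"
        by (meson not_le)
      then obtain S where "S \<subseteq> {i \<in> I. \<bar>f i x\<bar> = \<epsilon> t i}" "card S = Suc l"
        by (meson Suc_leI obtain_subset_with_card_n)
      with x(1) show ?thesis by blast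
    qed
    then obtain x S where x: "\<And>t j. t \<in> G \<Longrightarrow> j < l \<Longrightarrow> \<bar>x t j\<bar> \<le> R"
      and S: "\<And>t. t \<in> G \<Longrightarrow> S t \<subseteq> I" "\<And>t. t \<in> G \<Longrightarrow> card (S t) = Suc l"
      and fx: "\<And>t i. t \<in> G \<Longrightarrow> i \<in> S t \<Longrightarrow> \<bar>f i (x t)\<bar> = \<epsilon> t i" by metis
    define c where "c t = (\<lambda>j\<in>{..<l}. \<lfloor>x t j * K\<rfloor>)" for t
    define Cells where "Cells = PiE {..<l} (\<lambda>_. {- int N..int N})"
    have cells: "c t \<in> Cells" if "t \<in> G" for t
    proof -
      have "- int N \<le> \<lfloor>x t j * K\<rfloor> \<and> \<lfloor>x t j * K\<rfloor> \<le> int N" if "j < l" for j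
      proof -
        have "\<bar>x t j * K\<bar> \<le> \<bar>R\<bar> * K"
          unfolding abs_mult using x[OF \<open>t \<in> G\<close> that] K0 by (intro mult_mono) auto
        moreover have "0 \<le> \<bar>R\<bar> * K" using K0 by simp
        then have "int N = \<lceil>\<bar>R\<bar> * K\<rceil> + 1" unfolding N_def by linarith
        ultimately show ?thesis by linarith
      qed
      then show ?thesis by (auto simp: c_def Cells_def)
    qed
    have "card {- int N..int N} = 2 * N + 1" by simp
    then have cardCells: "card Cells = (2 * N + 1) ^ l" by (simp only: Cells_def card_PiE finite_lessThan prod_constant card_lessThan)
    let ?D = "SIGMA S:{S. S \<subseteq> I \<and> card S = Suc l}. Cells \<times> PiE (I - S) (\<lambda>_. {1..T})"
    have inj: "inj_on (\<lambda>t. (S t, c t, restrict t (I - S t))) G"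
    proof (rule inj_onI)
      fix t t' assume t: "t \<in> G" and t': "t' \<in> G"
        and "(S t, c t, restrict t (I - S t)) = (S t', c t', restrict t' (I - S t'))"
      then have e: "S t = S t'" "c t = c t'" "restrict t (I - S t) = restrict t' (I - S t)" by auto
      have "t i = t' i" if i: "i \<in> I" for i
      proof (cases "i \<in> S t")
        case True
        have "\<bar>x t j - x t' j\<bar> \<le> 1 / K" if "j < l" for j
        proof -
          have "\<lfloor>x t j * K\<rfloor> = \<lfloor>x t' j * K\<rfloor>" using fun_cong[OF e(2), of j] that by (simp add: c_def)
          then have "\<bar>x t j * K - x t' j * K\<bar> \<le> 1" by linarith
          moreover have "\<bar>x t j * K - x t' j * K\<bar> = \<bar>x t j - x t' j\<bar> * K"
            using K0 by (simp add: abs_mult flip: left_diff_distrib)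
          ultimately show ?thesis using K0 by (simp add: field_simps)
        qed
        then have "\<bar>f i (x t) - f i (x t')\<bar> \<le> L' i * (1 / K)"
          using i t t' x K0 by (intro L'(2)) auto
        also have "\<dots> \<le> L * (1 / K)" using LL[OF i] K0 by (intro mult_right_mono) auto
        also have "\<dots> = u / 2" using L1 by (simp add: K_def u_def)
        finally have "\<bar>f i (x t) - f i (x t')\<bar> \<le> u / 2" .
        moreover have "\<bar>f i (x t)\<bar> = \<epsilon> t i" "\<bar>f i (x t')\<bar> = \<epsilon> t' i"
          using fx t t' True e(1) by auto
        ultimately have "\<bar>u * real (t i) - u * real (t' i)\<bar> \<le> u / 2" unfolding \<epsilon>_def by linarith
        moreover have "\<bar>u * real (t i) - u * real (t' i)\<bar> = u * \<bar>real (t i) - real (t' i)\<bar>"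
          using u0 by (simp add: abs_mult flip: right_diff_distrib)
        ultimately have "u * \<bar>real (t i) - real (t' i)\<bar> \<le> u * (1/2)" by simp
        then have "\<bar>real (t i) - real (t' i)\<bar> \<le> 1/2" using u0 by (simp only: mult_le_cancel_left_pos)
        then show ?thesis by linarith
      next
        case False
        then show ?thesis using fun_cong[OF e(3), of i] i by simp
      qed
      then show "t = t'" using t t' unfolding G_def by (metis PiE_ext)
    qed
    have finSub: "finite {S. S \<subseteq> I \<and> card S = Suc l}" using fin by simp
    have finCells: "finite Cells" by (auto simp: Cells_def intro: finite_PiE)
    have finS: "finite ?D"
      using fin finSub finCells by (intro finite_SigmaI finite_cartesian_product finite_PiE) auto
    \<comment> \<open>The exponent \<open>m - Suc l\<close> below is a truncated difference. The set
      \<open>S\<close> attached to the constant grid point 1 shows that \<open>I\<close> has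
      \<open>l + 1\<close> elements.\<close>
    have ne: "m \<ge> Suc l"
    proof -
      have "(\<lambda>i\<in>I. 1) \<in> G" by (auto simp: G_def T_def)
      then show ?thesis using S fin unfolding m_def by (metis card_mono)
    qed
    have "T ^ m = card G" using fin by (simp add: G_def card_PiE m_def)
    also have "\<dots> \<le> card ?D"
    proof (rule card_inj_on_le[OF inj _ finS])
      show "(\<lambda>t. (S t, c t, restrict t (I - S t))) ` G \<subseteq> ?D"
        using S cells by (auto simp: G_def)
    qed
    also have "\<dots> = (\<Sum>S | S \<subseteq> I \<and> card S = Suc l. (2 * N + 1) ^ l * T ^ (m - Suc l))"
    proof -
      have "card (Cells \<times> PiE (I - S) (\<lambda>_. {1..T})) = (2 * N + 1) ^ l * T ^ (m - Suc l)"
        if "S \<subseteq> I" "card S = Suc l" for S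
        using that fin finite_subset[OF that(1) fin]
        by (simp add: card_cartesian_product cardCells card_PiE card_Diff_subset m_def)
      then show ?thesis using finSub finCells fin
        by (subst card_SigmaI) (auto intro!: finite_PiE)
    qed
    also have "\<dots> = (m choose Suc l) * ((2 * N + 1) ^ l * T ^ (m - Suc l))"
      using n_subsets[OF fin, of "Suc l"] by (simp add: m_def)
    also have "\<dots> \<le> 2 ^ m * ((a * T) ^ l * T ^ (m - Suc l))"
      using N by (intro mult_mono power_mono binomial_le_pow2) auto
    also have "\<dots> = 2 ^ m * a ^ l * T ^ (m - 1)"
      using ne by (simp add: power_mult_distrib flip: power_add)
    also have "\<dots> < T * T ^ (m - 1)" by (intro mult_strict_right_mono) (auto simp: T_def)
    also have "\<dots> = T ^ m" using ne by (simp flip: power_Suc)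
    finally show False by simp
  qed
qed

text \<open>The proof chooses all points jointly, minimizing \<open>(\<Sum>i. Q (X i)) - \<bar>\<Sum>i. X i\<bar>\<^sup>2 / 2\<close>. Moving a
  single \<open>X i\<close> to \<open>y\<close> changes the concave part by a linear term and \<open>- \<bar>y - X i\<bar>\<^sup>2 / 2\<close>, whence
  strictness.\<close>

lemma strict_minimizers:
  fixes K :: "'i \<Rightarrow> (nat \<Rightarrow> real) set" and Q :: "(nat \<Rightarrow> real) \<Rightarrow> real"
  assumes fin: "finite A" and K: "\<And>i. i \<in> A \<Longrightarrow> compact (K i)" "\<And>i. i \<in> A \<Longrightarrow> K i \<noteq> {}"
    and Q: "continuous_on UNIV Q"
  shows "\<exists>X a. \<forall>i\<in>A. X i \<in> K i \<and> (\<forall>y\<in>K i. (\<exists>j<l. y j \<noteq> X i j) \<longrightarrow>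
    Q (X i) + (\<Sum>j<l. a j * X i j) < Q y + (\<Sum>j<l. a j * y j))"
proof -
  \<comment> \<open>Indices outside \<open>A\<close> get a singleton, so that the product over the
    whole index type is compact and nonempty.\<close>
  define K' where "K' i = (if i \<in> A then K i else {\<lambda>_. 0})" for i
  define J where "J X = (\<Sum>i\<in>A. Q (X i)) - (\<Sum>j<l. (\<Sum>i\<in>A. X i j)\<^sup>2) / 2" for X :: "'i \<Rightarrow> nat \<Rightarrow> real"
  have 1: "compact {X. \<forall>i. X i \<in> K' i}" by (rule compact_product_set) (auto simp: K'_def K)
  have 2: "{X. \<forall>i. X i \<in> K' i} \<noteq> {}"
  proof -
    have "\<forall>i. \<exists>x. x \<in> K' i" using K(2) by (auto simp: K'_def)
    then show ?thesis by (auto dest: choice)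
  qed
  have c1: "continuous_on UNIV (\<lambda>X::'i \<Rightarrow> nat \<Rightarrow> real. Q (X i))" for i
    by (rule continuous_on_compose2[OF Q continuous_on_product_coordinates]) simp
  have c2: "continuous_on UNIV (\<lambda>X::'i \<Rightarrow> nat \<Rightarrow> real. X i j)" for i j
    by (rule continuous_on_product_then_coordinatewise) (rule continuous_on_product_coordinates)
  have "continuous_on UNIV J" unfolding J_def by (intro continuous_intros c1 c2) simp
  then have "\<exists>X\<in>{X. \<forall>i. X i \<in> K' i}. \<forall>Y\<in>{X. \<forall>i. X i \<in> K' i}. J X \<le> J Y"
    by (intro continuous_attains_inf 1 2) (erule continuous_on_subset, rule subset_UNIV)
  then obtain X where X: "\<forall>i. X i \<in> K' i" and min: "\<And>Y. \<forall>i. Y i \<in> K' i \<Longrightarrow> J X \<le> J Y"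
    unfolding mem_Collect_eq Bex_def Ball_def by (elim exE conjE) (rule that, assumption, simp)
  \<comment> \<open>The gradient of the concave part of \<open>J\<close> at the minimizer. It does
    not depend on \<open>i\<close>, so a single linear tilt makes the minimizers on all the sets
    strict at once.\<close>
  define a where "a j = - (\<Sum>i\<in>A. X i j)" for j
  have "Q (X i) + (\<Sum>j<l. a j * X i j) < Q y + (\<Sum>j<l. a j * y j)"
    if i: "i \<in> A" and y: "y \<in> K i" and ne: "\<exists>j<l. y j \<noteq> X i j" for i y
  proof -
    let ?Y = "X(i := y)"
    have "y \<in> K' i" using y i by (simp add: K'_def)
    then have "J X \<le> J ?Y" using X by (intro min) simp
    moreover have "J ?Y = (\<Sum>k\<in>A. Q (X k)) - Q (X i) + Q y - ((\<Sum>j<l. (a j)\<^sup>2)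
      - 2 * ((\<Sum>j<l. a j * y j) - (\<Sum>j<l. a j * X i j)) + (\<Sum>j<l. (y j - X i j)\<^sup>2)) / 2"
    proof -
      have 1: "(\<Sum>k\<in>A. Q (?Y k)) = (\<Sum>k\<in>A. Q (X k)) - Q (X i) + Q y"
        using fin i by (simp add: sum.remove[of _ i])
      have 2: "(\<Sum>k\<in>A. ?Y k j) = - a j + (y j - X i j)" for j
        using fin i by (simp add: sum.remove[of _ i] a_def)
      have 3: "(\<Sum>j<l. (- a j + (y j - X i j))\<^sup>2) = (\<Sum>j<l. (a j)\<^sup>2)
          - 2 * ((\<Sum>j<l. a j * y j) - (\<Sum>j<l. a j * X i j)) + (\<Sum>j<l. (y j - X i j)\<^sup>2)"
        by (simp add: sum_distrib_left power2_eq_square algebra_simps flip: sum.distrib sum_subtractf)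
      show ?thesis unfolding J_def 1 2 3 ..
    qed
    moreover have "J X = (\<Sum>k\<in>A. Q (X k)) - (\<Sum>j<l. (a j)\<^sup>2) / 2" by (simp add: J_def a_def)
    moreover have "(\<Sum>j<l. (y j - X i j)\<^sup>2) > 0"
    proof -
      obtain j where "j < l" "y j \<noteq> X i j" using ne by blast
      then show ?thesis by (intro sum_pos2[of _ j]) auto
    qed
    ultimately show ?thesis by (simp add: field_simps)
  qed
  moreover have "X i \<in> K i" if "i \<in> A" for i using spec[OF X, of i] that by (simp add: K'_def)
  ultimately show ?thesis by (intro exI[of _ X] exI[of _ a] ballI conjI impI) simp_all
qed

text \<open>The boundary points of the box with \<open>Q y \<le> Q x\<close> form a compact set, on
  which strictness gives \<open>h\<close> a positive lower bound \<eta>. A minimizer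
  \<open>z\<close> of the penalized function satisfies
  \<open>\<tau> * Q z + h z \<le> \<tau> * Q x\<close>; hence \<open>Q z \<le> Q x\<close>, and
  \<open>h z\<close> is below \<eta> when \<tau> is small. So \<open>z\<close> avoids the boundary
  and the partial derivatives vanish there if they exist.\<close>

lemma penalty_minimizer:
  fixes Q h :: "(nat \<Rightarrow> real) \<Rightarrow> real" and l :: nat
  defines "B \<equiv> \<lambda>x r. {y. (\<forall>j<l. \<bar>y j - x j\<bar> \<le> r) \<and> (\<forall>j\<ge>l. y j = x j)}"
  assumes Q: "continuous_on UNIV Q" and h: "continuous_on UNIV h" "\<And>y. h y \<ge> 0" "h x = 0"
    and r: "r > 0" and strict: "\<And>y. y \<in> B x r \<Longrightarrow> h y = 0 \<Longrightarrow> y \<noteq> x \<Longrightarrow> Q x < Q y"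
  shows "\<exists>\<tau>0>0. \<forall>\<tau>. 0 < \<tau> \<and> \<tau> \<le> \<tau>0 \<longrightarrow> (\<exists>z\<in>B x r. (\<forall>j<l. \<bar>z j - x j\<bar> < r) \<and>
    (\<forall>y\<in>B x r. \<tau> * Q z + h z \<le> \<tau> * Q y + h y))"
proof -
  have Beq: "B x r = {y. \<forall>j. y j \<in> (if j < l then {x j - r..x j + r} else {x j})}"
  proof -
    have "(y j \<in> (if j < l then {x j - r..x j + r} else {x j})) \<longleftrightarrow>
        (j < l \<longrightarrow> \<bar>y j - x j\<bar> \<le> r) \<and> (j \<ge> l \<longrightarrow> y j = x j)" for y j
      by (auto simp: abs_le_iff)
    then show ?thesis unfolding B_def by auto
  qed
  have cB: "compact (B x r)" unfolding Beq by (rule compact_product_set) auto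
  have xB: "x \<in> B x r" using r by (auto simp: B_def)
  have Qs: "continuous_on S Q" and hs: "continuous_on S h" for S
    using Q h(1) continuous_on_subset by blast+
  obtain y0 where y0: "y0 \<in> B x r" "\<And>y. y \<in> B x r \<Longrightarrow> Q y0 \<le> Q y"
    using continuous_attains_inf[OF cB _ Qs] xB by (metis empty_iff)
  define C where "C = B x r \<inter> ((\<Union>j<l. {y. \<bar>y j - x j\<bar> = r}) \<inter> {y. Q y \<le> Q x})"
  have "closed {y :: nat \<Rightarrow> real. \<bar>y j - x j\<bar> = r}" for j
    by (intro closed_Collect_eq continuous_intros continuous_on_product_coordinates)
  moreover have "closed {y. Q y \<le> Q x}" by (intro closed_Collect_le Qs continuous_on_const)
  ultimately have "compact C" unfolding C_def
    by (intro compact_Int_closed[OF cB] closed_Int closed_UN ballI) auto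
  then have "\<exists>\<eta>>0. \<forall>y\<in>C. \<eta> \<le> h y"
  proof (cases "C = {}")
    case False
    then obtain y1 where y1: "y1 \<in> C" "\<And>y. y \<in> C \<Longrightarrow> h y1 \<le> h y"
      using continuous_attains_inf[OF \<open>compact C\<close> _ hs] by metis
    have "h y1 \<noteq> 0"
    proof
      assume "h y1 = 0"
      moreover have "y1 \<noteq> x" using y1(1) r by (auto simp: C_def)
      ultimately show False using strict[of y1] y1(1) by (auto simp: C_def)
    qed
    then have "h y1 > 0" using h(2)[of y1] by simp
    then show ?thesis using y1 by blast
  qed (auto intro: exI[of _ 1])
  then obtain \<eta> where \<eta>: "\<eta> > 0" "\<And>y. y \<in> C \<Longrightarrow> \<eta> \<le> h y" by blast
  \<comment> \<open>The summand 1 keeps the denominator positive and makes the comparison of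
    \<open>h z\<close> with \<eta> strict.\<close>
  define \<tau>0 where "\<tau>0 = \<eta> / (Q x - Q y0 + 1)"
  have den: "Q x - Q y0 + 1 > 0" using y0(2)[OF xB] by simp
  have "\<exists>z\<in>B x r. (\<forall>j<l. \<bar>z j - x j\<bar> < r) \<and> (\<forall>y\<in>B x r. \<tau> * Q z + h z \<le> \<tau> * Q y + h y)"
    if \<tau>: "0 < \<tau>" "\<tau> \<le> \<tau>0" for \<tau>
  proof -
    have "continuous_on (B x r) (\<lambda>y. \<tau> * Q y + h y)" by (intro continuous_intros Qs hs)
    then obtain z where z: "z \<in> B x r" "\<And>y. y \<in> B x r \<Longrightarrow> \<tau> * Q z + h z \<le> \<tau> * Q y + h y"
      using continuous_attains_inf[OF cB] xB by (metis (no_types, lifting) empty_iff)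
    have zx: "\<tau> * Q z + h z \<le> \<tau> * Q x" using z(2)[OF xB] h(3) by simp
    have "z \<notin> C"
    proof
      assume "z \<in> C"
      then have "\<eta> \<le> h z" by (rule \<eta>)
      moreover have "\<tau> * (Q x - Q y0 + 1) \<le> \<eta>" using \<tau> den by (simp add: \<tau>0_def field_simps)
      moreover have "\<tau> * Q y0 \<le> \<tau> * Q z" using y0(2)[OF z(1)] \<tau> by simp
      ultimately show False using zx \<tau>(1) by (simp add: algebra_simps)
    qed
    moreover have "Q z \<le> Q x"
      using zx h(2)[of z] \<tau>(1) by (meson add_increasing2 le_add_same_cancel1 mult_le_cancel_left_pos order_trans)
    ultimately have "\<forall>j<l. \<bar>z j - x j\<bar> \<noteq> r" using z(1) by (auto simp: C_def)
    then show ?thesis using z by (intro bexI[of _ z]) (auto simp: B_def order_less_le)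
  qed
  moreover have "\<tau>0 > 0" using \<eta> den by (simp add: \<tau>0_def)
  ultimately show ?thesis by blast
qed

text \<open>Counts the data recorded for a cell: the set of active constraints and, as a subset of
  it, those taken with positive sign.\<close>

lemma card_marked_subsets:
  assumes fin: "finite I"
  shows "card (SIGMA S:{S. S \<subseteq> I \<and> card S \<le> l}. Pow S) = (\<Sum>s\<le>l. (card I choose s) * 2 ^ s)"
proof -
  let ?F = "{S. S \<subseteq> I \<and> card S \<le> l}"
  have finF: "finite ?F" using fin by simp
  have "card (SIGMA S:?F. Pow S) = (\<Sum>S\<in>?F. card (Pow S))"
    using fin finF by (intro card_SigmaI ballI) (auto intro: finite_subset)
  also have "\<dots> = (\<Sum>S\<in>?F. 2 ^ card S)"
    using fin by (intro sum.cong) (auto intro!: card_Pow intro: finite_subset)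
  also have "\<dots> = (\<Sum>s\<le>l. \<Sum>S\<in>{S \<in> ?F. card S = s}. 2 ^ card S)"
    using finF by (intro sum.group[symmetric]) auto
  also have "\<dots> = (\<Sum>s\<le>l. (card I choose s) * 2 ^ s)"
  proof (rule sum.cong[OF refl])
    fix s assume "s \<in> {..l}"
    then have "{S \<in> ?F. card S = s} = {S. S \<subseteq> I \<and> card S = s}" by auto
    then show "(\<Sum>S\<in>{S \<in> ?F. card S = s}. 2 ^ card S) = (card I choose s) * 2 ^ s"
      by (simp add: n_subsets[OF fin])
  qed
  finally show ?thesis .
qed

text \<open>The constraint \<open>f i0\<close>, positive in all patterns considered, keeps the cells in a bounded
  region.\<close>

lemma sign_patterns_bound_bounded:
  fixes f :: "'i \<Rightarrow> (nat \<Rightarrow> real) \<Rightarrow> real"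
  assumes fin: "finite I" and poly: "\<And>i. i \<in> I \<Longrightarrow> polyf l 2 (f i)"
    and A: "A \<subseteq> Pow I" and w: "\<And>\<sigma> j. \<sigma> \<in> A \<Longrightarrow> l \<le> j \<Longrightarrow> w \<sigma> j = 0"
    and w2: "\<And>\<sigma> i. \<sigma> \<in> A \<Longrightarrow> i \<in> I \<Longrightarrow> (if i \<in> \<sigma> then 1 else -1) * f i (w \<sigma>) > 0"
    and i0: "i0 \<in> I" "\<And>\<sigma>. \<sigma> \<in> A \<Longrightarrow> i0 \<in> \<sigma>"
    and bounded: "\<And>x j. f i0 x \<ge> 0 \<Longrightarrow> j < l \<Longrightarrow> \<bar>x j\<bar> \<le> R"
  shows "card A \<le> (\<Sum>s\<le>l. (card I choose s) * 2 ^ s) * 4 ^ l"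
proof -
  have finA: "finite A" using A fin by (meson finite_Pow_iff finite_subset)
  define g where "g \<sigma> i x = (if i \<in> \<sigma> then 1 else -1) * f i x" for \<sigma> i x
  have gw: "g \<sigma> i (w \<sigma>) > 0" if "\<sigma> \<in> A" "i \<in> I" for \<sigma> i
    using w2[OF that] by (simp only: g_def)
  \<comment> \<open>Levels below \<delta> leave every witness \<open>w \<sigma>\<close> inside the
    shrunken cell \<open>K \<sigma>\<close>, which is therefore nonempty.\<close>
  define \<delta> where "\<delta> = Min (insert 1 ((\<lambda>(\<sigma>, i). g \<sigma> i (w \<sigma>)) ` (A \<times> I)))"
  have \<delta>: "\<delta> > 0" unfolding \<delta>_def using finA fin gw by (subst Min_gr_iff) auto
  have \<delta>le: "\<delta> \<le> g \<sigma> i (w \<sigma>)" if "\<sigma> \<in> A" "i \<in> I" for \<sigma> i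
    unfolding \<delta>_def using finA fin that by (intro Min_le) auto
  have "\<exists>\<epsilon>. (\<forall>i\<in>I. 0 < \<epsilon> i \<and> \<epsilon> i < \<delta>) \<and>
      (\<forall>x. (\<forall>j<l. \<bar>x j\<bar> \<le> R) \<longrightarrow> card {i \<in> I. \<bar>f i x\<bar> = \<epsilon> i} \<le> l)"
    by (rule generic_levels[OF fin poly \<delta>])
  then obtain \<epsilon> where eps: "\<forall>i\<in>I. 0 < \<epsilon> i \<and> \<epsilon> i < \<delta>"
    and gen': "\<forall>x. (\<forall>j<l. \<bar>x j\<bar> \<le> R) \<longrightarrow> card {i \<in> I. \<bar>f i x\<bar> = \<epsilon> i} \<le> l" by (elim exE conjE)
  have \<epsilon>: "0 < \<epsilon> i" "\<epsilon> i < \<delta>" if "i \<in> I" for i using eps that by auto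
  have gen: "card {i \<in> I. \<bar>f i x\<bar> = \<epsilon> i} \<le> l" if "\<forall>j<l. \<bar>x j\<bar> \<le> R" for x
    by (rule mp[OF spec[OF gen', of x] that])
  define K where "K \<sigma> = {x. (\<forall>j\<ge>l. x j = 0) \<and> (\<forall>i\<in>I. \<epsilon> i \<le> g \<sigma> i x)}" for \<sigma>
  have wK: "w \<sigma> \<in> K \<sigma>" if "\<sigma> \<in> A" for \<sigma>
    using w \<delta>le \<epsilon>(2) that unfolding K_def by (force intro: less_imp_le)
  have KR: "\<bar>x j\<bar> \<le> R" if "\<sigma> \<in> A" "x \<in> K \<sigma>" "j < l" for \<sigma> x j
  proof (rule bounded[OF _ that(3)])
    have "\<epsilon> i0 \<le> g \<sigma> i0 x" using that i0 by (simp add: K_def)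
    then show "f i0 x \<ge> 0" using \<epsilon>(1)[OF i0(1)] i0(2)[OF that(1)] by (simp add: g_def)
  qed
  have fcont: "continuous_on UNIV (f i)" if "i \<in> I" for i using polyf_continuous[OF poly[OF that]] .
  have Kcomp: "compact (K \<sigma>)" if \<sigma>: "\<sigma> \<in> A" for \<sigma>
  proof -
    let ?Box = "{x :: nat \<Rightarrow> real. \<forall>j. x j \<in> (if j < l then {-R..R} else {0})}"
    have "K \<sigma> = ?Box \<inter> (\<Inter>i\<in>I. {x. \<epsilon> i \<le> g \<sigma> i x})" (is "_ = ?B")
    proof (rule set_eqI)
      fix x
      have "x \<in> ?Box \<longleftrightarrow> (\<forall>j<l. \<bar>x j\<bar> \<le> R) \<and> (\<forall>j\<ge>l. x j = 0)"
        by (auto simp: abs_le_iff not_less split: if_splits)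
      then show "x \<in> K \<sigma> \<longleftrightarrow> x \<in> ?B" using KR[OF \<sigma>, of x] by (auto simp: K_def)
    qed
    moreover have "compact ?Box" by (rule compact_product_set) auto
    moreover have "closed {x. \<epsilon> i \<le> g \<sigma> i x}" if "i \<in> I" for i
      unfolding g_def by (intro closed_Collect_le continuous_intros fcont that)
    ultimately show ?thesis by (metis (no_types, lifting) closed_INT compact_Int_closed)
  qed
  define Q0 where "Q0 x = (\<Sum>j<l. x j ^ 5 / 5)" for x :: "nat \<Rightarrow> real"
  have "continuous_on UNIV Q0" unfolding Q0_def by (intro continuous_intros continuous_on_product_coordinates) auto
  moreover have "K \<sigma> \<noteq> {}" if "\<sigma> \<in> A" for \<sigma> using wK[OF that] by blast
  ultimately have "\<exists>X a. \<forall>\<sigma>\<in>A. X \<sigma> \<in> K \<sigma> \<and> (\<forall>y\<in>K \<sigma>. (\<exists>j<l. y j \<noteq> X \<sigma> j) \<longrightarrow>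
      Q0 (X \<sigma>) + (\<Sum>j<l. a j * X \<sigma> j) < Q0 y + (\<Sum>j<l. a j * y j))"
    by (intro strict_minimizers finA Kcomp)
  then obtain X a where Xa: "\<forall>\<sigma>\<in>A. X \<sigma> \<in> K \<sigma> \<and> (\<forall>y\<in>K \<sigma>. (\<exists>j<l. y j \<noteq> X \<sigma> j) \<longrightarrow>
      Q0 (X \<sigma>) + (\<Sum>j<l. a j * X \<sigma> j) < Q0 y + (\<Sum>j<l. a j * y j))" by (elim exE)
  have XK: "X \<sigma> \<in> K \<sigma>" if "\<sigma> \<in> A" for \<sigma> using Xa that by simp
  have Xmin: "Q0 (X \<sigma>) + (\<Sum>j<l. a j * X \<sigma> j) < Q0 y + (\<Sum>j<l. a j * y j)"
    if "\<sigma> \<in> A" "y \<in> K \<sigma>" "\<exists>j<l. y j \<noteq> X \<sigma> j" for \<sigma> y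
    using bspec[OF Xa that(1), THEN conjunct2, THEN bspec, OF that(2), THEN mp, OF that(3)] .
  define Q where "Q x = Q0 x + (\<Sum>j<l. a j * x j)" for x
  have Qcont: "continuous_on UNIV Q" unfolding Q_def Q0_def
    by (intro continuous_intros continuous_on_product_coordinates) auto
  have Qderiv: "((\<lambda>t. Q (x(j := t))) has_real_derivative (x j ^ 4 + a j)) (at (x j))" if j: "j < l" for x j
  proof -
    define c where "c = (\<Sum>i\<in>{..<l} - {j}. x i ^ 5 / 5) + (\<Sum>i\<in>{..<l} - {j}. a i * x i)"
    have "Q (x(j := t)) = t ^ 5 / 5 + a j * t + c" for t
      using j by (simp add: Q_def Q0_def c_def sum.remove[of "{..<l}" j])
    then show ?thesis by (auto intro!: derivative_eq_intros)
  qed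
  define S where "S \<sigma> = {i \<in> I. g \<sigma> i (X \<sigma>) = \<epsilon> i}" for \<sigma>
  have Scard: "card (S \<sigma>) \<le> l" if "\<sigma> \<in> A" for \<sigma>
  proof -
    have "S \<sigma> \<subseteq> {i \<in> I. \<bar>f i (X \<sigma>)\<bar> = \<epsilon> i}"
    proof
      fix i assume "i \<in> S \<sigma>"
      then have "i \<in> I" "g \<sigma> i (X \<sigma>) = \<epsilon> i" by (auto simp: S_def)
      then show "i \<in> {i \<in> I. \<bar>f i (X \<sigma>)\<bar> = \<epsilon> i}"
        using \<epsilon>(1)[of i] by (cases "i \<in> \<sigma>") (auto simp: g_def)
    qed
    then have "card (S \<sigma>) \<le> card {i \<in> I. \<bar>f i (X \<sigma>)\<bar> = \<epsilon> i}" using fin by (intro card_mono) auto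
    also have "\<dots> \<le> l" using KR[OF that XK[OF that]] by (intro gen) auto
    finally show ?thesis .
  qed
  let ?C = "SIGMA S:{S. S \<subseteq> I \<and> card S \<le> l}. Pow S"
  have finC: "finite ?C" using fin by (intro finite_SigmaI) (auto intro: finite_subset)
  \<comment> \<open>Patterns with the same active set and the same signs on it share the levels
    \<open>cc\<close>, hence the penalty \<open>h\<close> and its derivatives. Their critical points
    will be distinct solutions of one system.\<close>
  have fiber: "card {\<sigma> \<in> A. (S \<sigma>, S \<sigma> \<inter> \<sigma>) = c} \<le> 4 ^ l" if c: "c \<in> ?C" for c
  proof -
    obtain S0 T where cST: "c = (S0, T)" by force
    define F where "F = {\<sigma> \<in> A. (S \<sigma>, S \<sigma> \<inter> \<sigma>) = c}"
    have finS0: "finite S0" using c cST fin finite_subset by auto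
    have S0I: "S0 \<subseteq> I" using c cST by auto
    define cc where "cc i = (if i \<in> T then \<epsilon> i else - \<epsilon> i)" for i
    define h where "h x = (\<Sum>i\<in>S0. (f i x - cc i)\<^sup>2)" for x
    have "polyf l (2 + 2) (\<lambda>x. (f i x - cc i) * (f i x - cc i))" if "i \<in> S0" for i
      using that S0I by (intro polyf_mult polyf_diff poly polyf_const) auto
    then have hpoly: "polyf l 4 h"
      unfolding h_def power2_eq_square using finS0 by (intro polyf_sum) auto
    have "\<exists>h'. polyf l 3 h' \<and> (\<forall>x. ((\<lambda>t. h (x(j := t))) has_real_derivative h' x) (at (x j)))"
      if "j < l" for j using polyf_deriv[OF hpoly that] by simp
    then obtain dh where dh: "\<And>j. j < l \<Longrightarrow> polyf l 3 (dh j)"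
      "\<And>j x. j < l \<Longrightarrow> ((\<lambda>t. h (x(j := t))) has_real_derivative dh j x) (at (x j))"
      by metis
    define crit_in where "crit_in \<sigma> \<tau> z \<longleftrightarrow> (\<forall>j\<ge>l. z j = 0) \<and>
        (\<forall>i\<in>I. g \<sigma> i z > 0) \<and> (\<forall>j<l. \<tau> * (z j ^ 4 + a j) + dh j z = 0)" for \<sigma> \<tau> z
    have crit: "\<exists>\<tau>0>0. \<forall>\<tau>. 0 < \<tau> \<and> \<tau> \<le> \<tau>0 \<longrightarrow> (\<exists>z. crit_in \<sigma> \<tau> z)" if \<sigma>F: "\<sigma> \<in> F" for \<sigma>
    proof -
      have \<sigma>: "\<sigma> \<in> A" and S\<sigma>: "S \<sigma> = S0" and T\<sigma>: "T = S0 \<inter> \<sigma>" using \<sigma>F cST by (auto simp: F_def)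
      define x where "x = X \<sigma>"
      have xK: "x \<in> K \<sigma>" using XK[OF \<sigma>] by (simp add: x_def)
      have gS: "g \<sigma> i x = \<epsilon> i" if "i \<in> S0" for i using that S\<sigma> by (auto simp: S_def x_def)
      have gN: "g \<sigma> i x > \<epsilon> i" if "i \<in> I" "i \<notin> S0" for i
        using that S\<sigma> xK by (force simp: S_def x_def K_def)
      have fcc: "f i y = cc i \<longleftrightarrow> g \<sigma> i y = \<epsilon> i" if "i \<in> S0" for i y
        using that by (auto simp: cc_def g_def T\<sigma>)
      \<comment> \<open>Within the radius \<open>r\<close> chosen below each constraint moves by
        less than its gap: active ones stay positive, inactive ones stay above their level. The
        latter turns every zero of \<open>h\<close> in the box into a point of
        \<open>K \<sigma>\<close>, where strict minimality applies.\<close>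
      define gap where "gap i = (if i \<in> S0 then \<epsilon> i else g \<sigma> i x - \<epsilon> i)" for i
      have gap: "gap i > 0" if "i \<in> I" for i using gN[OF that] \<epsilon>(1)[OF that] by (simp add: gap_def)
      have "\<forall>i\<in>I. \<exists>L\<ge>0. \<forall>r\<ge>0. \<forall>x y. (\<forall>j<l. \<bar>x j\<bar> \<le> R + 1 \<and> \<bar>y j\<bar> \<le> R + 1 \<and> \<bar>x j - y j\<bar> \<le> r) \<longrightarrow>
          \<bar>f i x - f i y\<bar> \<le> L * r"
        using polyf_lipschitz[OF poly, where R = "R + 1"] by meson
      then obtain L where L: "\<And>i. i \<in> I \<Longrightarrow> L i \<ge> 0"
        "\<And>i r x y. i \<in> I \<Longrightarrow> r \<ge> 0 \<Longrightarrow> (\<forall>j<l. \<bar>x j\<bar> \<le> R + 1 \<and> \<bar>y j\<bar> \<le> R + 1 \<and> \<bar>x j - y j\<bar> \<le> r) \<Longrightarrow>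
          \<bar>f i x - f i y\<bar> \<le> L i * r" by metis
      define r where "r = Min (insert 1 ((\<lambda>i. gap i / (2 * (L i + 1))) ` I))"
      have r0: "r > 0" unfolding r_def using fin gap L(1) by (subst Min_gr_iff) (auto intro!: divide_pos_pos add_nonneg_pos)
      have r1: "r \<le> 1" unfolding r_def using fin by (intro Min_le) auto
      have rL: "L i * r < gap i" if i: "i \<in> I" for i
      proof -
        have "r \<le> gap i / (2 * (L i + 1))" unfolding r_def using fin i by (intro Min_le) auto
        then have "(2 * (L i + 1)) * r \<le> gap i" using L(1)[OF i] by (simp add: pos_le_divide_eq mult.commute)
        moreover have "L i * r < (2 * (L i + 1)) * r" using L(1)[OF i] r0 by (intro mult_strict_right_mono) auto
        ultimately show ?thesis by linarith
      qed
      let ?B = "{y. (\<forall>j<l. \<bar>y j - x j\<bar> \<le> r) \<and> (\<forall>j\<ge>l. y j = x j)}"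
      have near: "\<bar>g \<sigma> i y - g \<sigma> i x\<bar> < gap i" if y: "y \<in> ?B" and i: "i \<in> I" for y i
      proof -
        have "\<bar>f i y - f i x\<bar> \<le> L i * r"
        proof (rule L(2)[OF i], use r0 in simp, intro allI impI)
          fix j assume j: "j < l"
          have "\<bar>x j\<bar> \<le> R" using KR[OF \<sigma> xK j] .
          moreover have "\<bar>y j - x j\<bar> \<le> r" using y j by auto
          ultimately show "\<bar>y j\<bar> \<le> R + 1 \<and> \<bar>x j\<bar> \<le> R + 1 \<and> \<bar>y j - x j\<bar> \<le> r" using r1 by linarith
        qed
        moreover have "\<bar>g \<sigma> i y - g \<sigma> i x\<bar> = \<bar>f i y - f i x\<bar>"
          by (simp add: g_def abs_minus_commute)
        ultimately show ?thesis using rL[OF i] by linarith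
      qed
      have pos: "g \<sigma> i y > 0" if "y \<in> ?B" "i \<in> I" for y i
        using near[OF that] gS[of i] gN[of i] that(2) \<epsilon>(1)[of i] by (cases "i \<in> S0") (auto simp: gap_def)
      have above: "g \<sigma> i y > \<epsilon> i" if "y \<in> ?B" "i \<in> I" "i \<notin> S0" for y i
        using near[OF that(1,2)] that(3) by (simp add: gap_def)
      have hx: "h x = 0" unfolding h_def using fcc gS by (intro sum.neutral) auto
      have h0: "h y \<ge> 0" for y by (simp add: h_def sum_nonneg)
      have strict: "Q x < Q y" if y: "y \<in> ?B" "h y = 0" "y \<noteq> x" for y
      proof -
        have "g \<sigma> i y = \<epsilon> i" if "i \<in> S0" for i
        proof -
          have "(f i y - cc i)\<^sup>2 = 0"
            using y(2) finS0 that unfolding h_def by (subst (asm) sum_nonneg_eq_0_iff) auto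
          then show ?thesis using fcc[OF that] by simp
        qed
        moreover have "\<forall>j\<ge>l. y j = 0" using y(1) xK by (auto simp: K_def)
        ultimately have "y \<in> K \<sigma>" using above[OF y(1)] unfolding K_def by (force intro: less_imp_le)
        moreover have "\<exists>j<l. y j \<noteq> x j"
        proof (rule ccontr)
          assume "\<not> ?thesis"
          then have "y j = x j" for j using y(1) by (cases "j < l") auto
          then show False using y(3) by blast
        qed
        ultimately show ?thesis using Xmin[OF \<sigma>] by (simp add: Q_def x_def)
      qed
      define min_at where "min_at \<tau> z \<longleftrightarrow> z \<in> ?B \<and> (\<forall>j<l. \<bar>z j - x j\<bar> < r) \<and>
          (\<forall>y\<in>?B. \<tau> * Q z + h z \<le> \<tau> * Q y + h y)" for \<tau> z
      have "\<exists>\<tau>0>0. \<forall>\<tau>. 0 < \<tau> \<and> \<tau> \<le> \<tau>0 \<longrightarrow> (\<exists>z. min_at \<tau> z)"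
        using penalty_minimizer[OF Qcont polyf_continuous[OF hpoly] h0 hx r0, of l, OF strict]
        unfolding min_at_def Bex_def .
      then obtain \<tau>0 where \<tau>0: "\<tau>0 > 0" and ex: "\<And>\<tau>. 0 < \<tau> \<and> \<tau> \<le> \<tau>0 \<Longrightarrow> \<exists>z. min_at \<tau> z"
        by metis
      show ?thesis
      proof (intro exI[of _ \<tau>0] conjI \<tau>0 allI impI)
        fix \<tau> assume \<tau>: "0 < \<tau> \<and> \<tau> \<le> \<tau>0"
        obtain z where "min_at \<tau> z" using ex[OF \<tau>] by metis
        then have z: "z \<in> ?B" "\<And>j. j < l \<Longrightarrow> \<bar>z j - x j\<bar> < r"
          "\<And>y. y \<in> ?B \<Longrightarrow> \<tau> * Q z + h z \<le> \<tau> * Q y + h y" by (simp_all add: min_at_def)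
        have "\<tau> * (z j ^ 4 + a j) + dh j z = 0" if j: "j < l" for j
        proof -
          have D: "((\<lambda>t. \<tau> * Q (z(j := t)) + h (z(j := t))) has_real_derivative
              (\<tau> * (z j ^ 4 + a j) + dh j z)) (at (z j))"
            by (intro DERIV_add DERIV_cmult Qderiv dh(2) j)
          show ?thesis
          proof (rule DERIV_local_min[OF D])
            show "0 < r - \<bar>z j - x j\<bar>" using z(2)[OF j] by simp
            show "\<forall>y. \<bar>z j - y\<bar> < r - \<bar>z j - x j\<bar> \<longrightarrow>
                \<tau> * Q (z(j := z j)) + h (z(j := z j)) \<le> \<tau> * Q (z(j := y)) + h (z(j := y))"
            proof (intro allI impI)
              fix y assume "\<bar>z j - y\<bar> < r - \<bar>z j - x j\<bar>"
              then have "\<bar>y - x j\<bar> \<le> r" by linarith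
              then have "z(j := y) \<in> ?B" using z(1) j by auto
              then show "\<tau> * Q (z(j := z j)) + h (z(j := z j)) \<le> \<tau> * Q (z(j := y)) + h (z(j := y))"
                using z(3) by simp
            qed
          qed
        qed
        moreover have "\<forall>j\<ge>l. z j = 0" using z(1) xK by (auto simp: K_def)
        moreover have "\<forall>i\<in>I. g \<sigma> i z > 0" using pos[OF z(1)] by blast
        ultimately show "\<exists>z. crit_in \<sigma> \<tau> z" unfolding crit_in_def by (intro exI[of _ z]) simp
      qed
    qed
    have finF: "finite F" using finA by (simp add: F_def)
    from crit obtain \<tau>0 where \<tau>0: "\<And>\<sigma>. \<sigma> \<in> F \<Longrightarrow> \<tau>0 \<sigma> > 0"
        "\<And>\<sigma> \<tau>. \<sigma> \<in> F \<Longrightarrow> 0 < \<tau> \<and> \<tau> \<le> \<tau>0 \<sigma> \<Longrightarrow> \<exists>z. crit_in \<sigma> \<tau> z" by metis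
    \<comment> \<open>One \<tau> for the whole fibre, because the system contains \<tau> and the
      solutions for all \<sigma> are counted together.\<close>
    define \<tau> where "\<tau> = Min (insert 1 (\<tau>0 ` F))"
    have \<tau>: "\<tau> > 0" unfolding \<tau>_def using finF \<tau>0(1) by (subst Min_gr_iff) auto
    have "\<tau> \<le> \<tau>0 \<sigma>" if "\<sigma> \<in> F" for \<sigma> unfolding \<tau>_def using finF that by (intro Min_le) auto
    then have "\<forall>\<sigma>\<in>F. \<exists>z. crit_in \<sigma> \<tau> z" using \<tau> \<tau>0(2) by simp
    then obtain z where "\<forall>\<sigma>\<in>F. crit_in \<sigma> \<tau> (z \<sigma>)" by (rule exE[OF bchoice])
    then have zc: "crit_in \<sigma> \<tau> (z \<sigma>)" if "\<sigma> \<in> F" for \<sigma> using that by simp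
    have z: "\<And>\<sigma> j. \<sigma> \<in> F \<Longrightarrow> l \<le> j \<Longrightarrow> z \<sigma> j = 0"
      "\<And>\<sigma> i. \<sigma> \<in> F \<Longrightarrow> i \<in> I \<Longrightarrow> g \<sigma> i (z \<sigma>) > 0"
      "\<And>\<sigma> j. \<sigma> \<in> F \<Longrightarrow> j < l \<Longrightarrow> \<tau> * (z \<sigma> j ^ 4 + a j) + dh j (z \<sigma>) = 0"
      using zc unfolding crit_in_def by simp_all
    \<comment> \<open>The critical point \<open>z \<sigma>\<close> still lies in the open cell of
      \<sigma>, so the signs of the \<open>f i\<close> at it recover the pattern.\<close>
    have "inj_on z F"
    proof (rule inj_onI)
      fix \<sigma> \<sigma>' assume *: "\<sigma> \<in> F" "\<sigma>' \<in> F" "z \<sigma> = z \<sigma>'"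
      have "\<rho> = {i \<in> I. f i (z \<rho>) > 0}" if "\<rho> \<in> F" for \<rho>
      proof -
        have "\<rho> \<subseteq> I" using that A by (auto simp: F_def)
        then show ?thesis using z(2)[OF that] by (force simp: g_def split: if_splits)
      qed
      then show "\<sigma> = \<sigma>'" using * by metis
    qed
    then have "card F = card (z ` F)" by (simp add: card_image)
    also have "\<dots> \<le> 4 ^ l"
    proof (rule polyf_zeros_bound[where p = "\<lambda>j x. (- a j) + (- 1 / \<tau>) * dh j x"])
      show "finite (z ` F)" using finF by simp
      fix j assume j: "j < l"
      show "polyf l 3 (\<lambda>x. (- a j) + (- 1 / \<tau>) * dh j x)"
        using j by (intro polyf_add polyf_const polyf_cmult dh(1))
      fix y assume "y \<in> z ` F"
      then have "\<tau> * (y j ^ 4 + a j) + dh j y = 0" using z(3)[OF _ j] by auto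
      then have "dh j y = - (\<tau> * (y j ^ 4 + a j))" by linarith
      then show "y j ^ 4 = (- a j) + (- 1 / \<tau>) * dh j y" using \<tau> by simp
    next
      fix y j assume "y \<in> z ` F" "l \<le> j"
      then show "y j = 0" using z(1) by auto
    qed
    finally show ?thesis by (simp add: F_def)
  qed
  have "A \<subseteq> (\<Union>c\<in>?C. {\<sigma> \<in> A. (S \<sigma>, S \<sigma> \<inter> \<sigma>) = c})" using Scard by (auto simp: S_def)
  then have "card A \<le> card (\<Union>c\<in>?C. {\<sigma> \<in> A. (S \<sigma>, S \<sigma> \<inter> \<sigma>) = c})"
    using finC finA by (intro card_mono) auto
  also have "\<dots> \<le> (\<Sum>c\<in>?C. card {\<sigma> \<in> A. (S \<sigma>, S \<sigma> \<inter> \<sigma>) = c})" by (rule card_UN_le[OF finC])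
  also have "\<dots> \<le> of_nat (card ?C) * 4 ^ l" by (rule sum_bounded_above) (rule fiber)
  finally show ?thesis by (simp add: card_marked_subsets[OF fin])
qed

text \<open>Boundedness is obtained by adding the constraint that the squared norm stays below
  \<open>R\<close>, where \<open>R\<close> exceeds the squared norms of one witness per pattern.
  This polynomial has index \<open>None\<close> and accounts for the \<open>Suc\<close> in the
  bound.\<close>

lemma sign_patterns_bound:
  fixes f :: "'i \<Rightarrow> (nat \<Rightarrow> real) \<Rightarrow> real"
  assumes fin: "finite I" and poly: "\<And>i. i \<in> I \<Longrightarrow> polyf l 2 (f i)"
  shows "card ((\<lambda>x. {i \<in> I. f i x > 0}) ` {x. (\<forall>j\<ge>l. x j = 0) \<and> (\<forall>i\<in>I. f i x \<noteq> 0)})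
    \<le> (\<Sum>s\<le>l. (Suc (card I) choose s) * 2 ^ s) * 4 ^ l"
proof -
  define A where "A = (\<lambda>x. {i \<in> I. f i x > 0}) ` {x. (\<forall>j\<ge>l. x j = 0) \<and> (\<forall>i\<in>I. f i x \<noteq> 0)}"
  have "A \<subseteq> Pow I" by (auto simp: A_def)
  then have finA: "finite A" using fin by (meson finite_Pow_iff finite_subset)
  define witness where "witness \<sigma> x \<longleftrightarrow> (\<forall>j\<ge>l. x j = 0) \<and> (\<forall>i\<in>I. f i x \<noteq> 0) \<and> \<sigma> = {i \<in> I. f i x > 0}" for \<sigma> x
  have "\<forall>\<sigma>\<in>A. \<exists>x. witness \<sigma> x" unfolding A_def witness_def by blast
  then obtain w where "\<forall>\<sigma>\<in>A. witness \<sigma> (w \<sigma>)" by (rule exE[OF bchoice])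
  then have w: "\<And>\<sigma> j. \<sigma> \<in> A \<Longrightarrow> j \<ge> l \<Longrightarrow> w \<sigma> j = 0"
    "\<And>\<sigma> i. \<sigma> \<in> A \<Longrightarrow> i \<in> I \<Longrightarrow> f i (w \<sigma>) \<noteq> 0"
    "\<And>\<sigma>. \<sigma> \<in> A \<Longrightarrow> \<sigma> = {i \<in> I. f i (w \<sigma>) > 0}"
    unfolding witness_def by blast+
  define R where "R = 1 + (\<Sum>\<sigma>\<in>A. \<Sum>j<l. (w \<sigma> j)\<^sup>2)"
  have R: "(\<Sum>j<l. (w \<sigma> j)\<^sup>2) < R" "R \<ge> 1" if "\<sigma> \<in> A" for \<sigma>
    using member_le_sum[OF that, of "\<lambda>\<sigma>. \<Sum>j<l. (w \<sigma> j)\<^sup>2"] finA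
    by (auto simp: R_def sum_nonneg)
  have R1: "R \<ge> 1" by (simp add: R_def sum_nonneg)
  define F where "F i = (case i of None \<Rightarrow> (\<lambda>x. R - (\<Sum>j<l. x j * x j)) | Some i \<Rightarrow> f i)" for i
  define I' where "I' = insert None (Some ` I)"
  define E where "E \<sigma> = insert None (Some ` \<sigma>)" for \<sigma> :: "'i set"
  define w' where "w' \<rho> = w (the ` (\<rho> - {None}))" for \<rho>
  have injE: "inj_on E A"
  proof (rule inj_onI)
    fix \<sigma> \<sigma>' assume "E \<sigma> = E \<sigma>'"
    then have "Some -` E \<sigma> = Some -` E \<sigma>'" by simp
    then show "\<sigma> = \<sigma>'" by (simp add: E_def vimage_def image_iff)
  qed
  have w'E: "w' (E \<sigma>) = w \<sigma>" for \<sigma>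
  proof -
    have "the ` (E \<sigma> - {None}) = \<sigma>" by (force simp: E_def image_iff)
    then show ?thesis by (simp add: w'_def)
  qed
  have "card (E ` A) \<le> (\<Sum>s\<le>l. (card I' choose s) * 2 ^ s) * 4 ^ l"
  proof (rule sign_patterns_bound_bounded[where f = F and w = w' and ?i0.0 = None and R = R])
    show "finite I'" using fin by (simp add: I'_def)
    show "polyf l 2 (F i)" if i: "i \<in> I'" for i
    proof (cases i)
      case None
      have "polyf l (1 + 1) (\<lambda>x. x j * x j)" if "j < l" for j
        using polyf_mult[OF polyf_coord[OF that, of 0] polyf_coord[OF that, of 0]] by simp
      then have "polyf l 2 (\<lambda>x. R - (\<Sum>j<l. x j * x j))"
        by (intro polyf_diff polyf_const polyf_sum) (auto simp: numeral_2_eq_2)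
      then show ?thesis by (simp add: F_def None)
    next
      case (Some k)
      then show ?thesis using i poly by (auto simp: F_def I'_def)
    qed
    show "E ` A \<subseteq> Pow I'" using \<open>A \<subseteq> Pow I\<close> by (auto simp: E_def I'_def)
    show "w' \<rho> j = 0" if "\<rho> \<in> E ` A" "l \<le> j" for \<rho> j using that w(1) by (auto simp: w'E)
    show "(if i \<in> \<rho> then 1 else -1) * F i (w' \<rho>) > 0" if "\<rho> \<in> E ` A" "i \<in> I'" for \<rho> i
    proof -
      obtain \<sigma> where \<sigma>: "\<sigma> \<in> A" "\<rho> = E \<sigma>" using \<open>\<rho> \<in> E ` A\<close> by blast
      show ?thesis
      proof (cases i)
        case None
        have "None \<in> E \<sigma>" by (simp add: E_def)
        then show ?thesis using R(1)[OF \<sigma>(1)] by (simp add: None F_def \<sigma>(2) w'E power2_eq_square)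
      next
        case (Some k)
        have k: "k \<in> I" using \<open>i \<in> I'\<close> Some by (auto simp: I'_def)
        have "i \<in> \<rho> \<longleftrightarrow> f k (w \<sigma>) > 0" using w(3)[OF \<sigma>(1)] k by (auto simp: \<sigma>(2) E_def Some)
        then show ?thesis using w(2)[OF \<sigma>(1) k] by (auto simp: F_def Some \<sigma>(2) w'E)
      qed
    qed
    show "None \<in> I'" "\<And>\<sigma>. \<sigma> \<in> E ` A \<Longrightarrow> None \<in> \<sigma>" by (auto simp: I'_def E_def)
    show "\<bar>x j\<bar> \<le> R" if "F None x \<ge> 0" "j < l" for x j
    proof -
      have "(x j)\<^sup>2 \<le> (\<Sum>j<l. (x j)\<^sup>2)" using that(2) by (intro member_le_sum) auto
      also have "\<dots> \<le> R" using that(1) by (simp add: F_def power2_eq_square)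
      also have "R \<le> R\<^sup>2" using R1 by (simp add: power2_eq_square)
      finally show ?thesis using R1 by (simp add: abs_le_square_iff[symmetric])
    qed
  qed
  moreover have "card I' = Suc (card I)" using fin by (simp add: I'_def card_image)
  ultimately show ?thesis by (simp add: card_image[OF injE] flip: A_def)
qed

section \<open>Orientations and winding numbers\<close>

text \<open>Twice the signed area of the triangle, positive when it is traversed
  counterclockwise.\<close>

definition orient :: "real^2 \<Rightarrow> real^2 \<Rightarrow> real^2 \<Rightarrow> real" where
  "orient a b c = (b$1 - a$1) * (c$2 - a$2) - (b$2 - a$2) * (c$1 - a$1)"

text \<open>Crossing in the relative interiors, expressed by orientation signs alone.\<close>

definition cross :: "real^2 \<Rightarrow> real^2 \<Rightarrow> real^2 \<Rightarrow> real^2 \<Rightarrow> bool" where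
  "cross a b c d \<longleftrightarrow> orient a b c * orient a b d < 0 \<and> orient c d a * orient c d b < 0"

text \<open>Strict interior; the factor \<open>orient a b c\<close> makes the condition independent
  of the direction of traversal.\<close>

definition in_triangle :: "real^2 \<Rightarrow> real^2 \<Rightarrow> real^2 \<Rightarrow> real^2 \<Rightarrow> bool" where
  "in_triangle a b c x \<longleftrightarrow> orient a b x * orient a b c > 0 \<and> orient b c x * orient a b c > 0 \<and>
     orient c a x * orient a b c > 0"

definition winding :: "real^2 \<Rightarrow> real^2 \<Rightarrow> real^2 \<Rightarrow> real^2 \<Rightarrow> real" where
  "winding a b c x = (if in_triangle a b c x then sgn (orient a b c) else 0)"

lemma orient_rotate: "orient c a b = orient a b c"
  by (simp add: orient_def algebra_simps)

lemma orient_flip: "orient b a c = - orient a b c"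
  by (simp add: orient_def algebra_simps)

lemma orient_flip': "orient a c b = - orient a b c"
  by (simp add: orient_def algebra_simps)

lemma orient_degenerate [simp]: "orient a a b = 0" "orient a b a = 0" "orient b a a = 0"
  by (simp_all add: orient_def)

lemma orient_split: "orient a b c = orient a b v + orient b c v + orient c a v"
  by (simp add: orient_def algebra_simps)

text \<open>The three-term Grassmann-Pluecker relation for the vectors from \<open>x\<close> to the
  other four points.\<close>

lemma orient_plucker:
  "orient a b x * orient c v x + orient c a x * orient b v x + orient b c x * orient a v x = 0"
  by (simp add: orient_def algebra_simps)

text \<open>\<open>orient a b c\<close> is the sum of the three orientations with \<open>x\<close>,
  so it shares their sign if they agree. This form mentions only orientations ending in
  \<open>x\<close>, between which \<open>orient_plucker\<close> relates.\<close>

lemma winding_signs: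
  "winding a b c x = (if orient a b x > 0 \<and> orient b c x > 0 \<and> orient c a x > 0 then 1
     else if orient a b x < 0 \<and> orient b c x < 0 \<and> orient c a x < 0 then -1 else 0)"
proof -
  define p q r t where "p = orient a b x" "q = orient b c x" "r = orient c a x" "t = orient a b c"
  note defs = this
  have t: "t = p + q + r" unfolding defs by (rule orient_split)
  consider "t > 0" | "t = 0" | "t < 0" by linarith
  then show ?thesis unfolding winding_def in_triangle_def defs[symmetric]
  proof cases
    case 1
    then have "\<not> (p < 0 \<and> q < 0 \<and> r < 0)" using t by linarith
    then show "(if p * t > 0 \<and> q * t > 0 \<and> r * t > 0 then sgn t else 0) =
        (if p > 0 \<and> q > 0 \<and> r > 0 then 1 else if p < 0 \<and> q < 0 \<and> r < 0 then -1 else 0)"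
      using 1 by (simp add: zero_less_mult_iff)
  next
    case 2
    then have "\<not> (p < 0 \<and> q < 0 \<and> r < 0)" "\<not> (p > 0 \<and> q > 0 \<and> r > 0)" using t by linarith+
    then show "(if p * t > 0 \<and> q * t > 0 \<and> r * t > 0 then sgn t else 0) =
        (if p > 0 \<and> q > 0 \<and> r > 0 then 1 else if p < 0 \<and> q < 0 \<and> r < 0 then -1 else 0)"
      using 2 by simp
  next
    case 3
    then have "\<not> (p > 0 \<and> q > 0 \<and> r > 0)" using t by linarith
    then show "(if p * t > 0 \<and> q * t > 0 \<and> r * t > 0 then sgn t else 0) =
        (if p > 0 \<and> q > 0 \<and> r > 0 then 1 else if p < 0 \<and> q < 0 \<and> r < 0 then -1 else 0)"
      using 3 by (simp add: zero_less_mult_iff)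
  qed
qed

text \<open>Additivity of winding numbers, wherever \<open>v\<close> lies: the boundaries of the
  three small triangles add up to that of the large one. The proof checks all 64 sign patterns;
  those in which the three products in \<open>orient_plucker\<close> agree in sign cannot occur, and
  the others satisfy the equation.\<close>

lemma winding_split:
  assumes "orient a b x \<noteq> 0" "orient b c x \<noteq> 0" "orient c a x \<noteq> 0"
    "orient a v x \<noteq> 0" "orient b v x \<noteq> 0" "orient c v x \<noteq> 0"
  shows "winding a b c x = winding a b v x + winding b c v x + winding c a v x"
proof -
  define p q r s t u where "p = orient a b x" "q = orient b c x" "r = orient c a x"
    "s = orient a v x" "t = orient b v x" "u = orient c v x"
  note defs = this
  have f: "orient v a x = - s" "orient v b x = - t" "orient v c x = - u"
    by (simp_all only: defs orient_flip[of _ v])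
  have nz: "p \<noteq> 0" "q \<noteq> 0" "r \<noteq> 0" "s \<noteq> 0" "t \<noteq> 0" "u \<noteq> 0" using assms by (simp_all add: defs)
  have "p * u + r * t + q * s = 0" using orient_plucker[of a b x c v] by (simp add: defs)
  then have n: "\<not> (p * u > 0 \<and> r * t > 0 \<and> q * s > 0)" "\<not> (p * u < 0 \<and> r * t < 0 \<and> q * s < 0)"
    by linarith+
  define P Q R S T U where "P \<longleftrightarrow> p > 0" "Q \<longleftrightarrow> q > 0" "R \<longleftrightarrow> r > 0" "S \<longleftrightarrow> s > 0" "T \<longleftrightarrow> t > 0" "U \<longleftrightarrow> u > 0"
  note bdefs = this
  have neg: "p < 0 \<longleftrightarrow> \<not> P" "q < 0 \<longleftrightarrow> \<not> Q" "r < 0 \<longleftrightarrow> \<not> R" "s < 0 \<longleftrightarrow> \<not> S" "t < 0 \<longleftrightarrow> \<not> T" "u < 0 \<longleftrightarrow> \<not> U"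
    using nz unfolding bdefs by linarith+
  have m: "x * y > 0 \<longleftrightarrow> (x > 0 \<longleftrightarrow> y > 0)" "x * y < 0 \<longleftrightarrow> \<not> (x > 0 \<longleftrightarrow> y > 0)"
    if "x \<noteq> 0" "y \<noteq> 0" for x y :: real
    using that by (auto simp: zero_less_mult_iff mult_less_0_iff)
  have n': "\<not> ((P \<longleftrightarrow> U) \<and> (R \<longleftrightarrow> T) \<and> (Q \<longleftrightarrow> S))" "(P \<longleftrightarrow> U) \<or> (R \<longleftrightarrow> T) \<or> (Q \<longleftrightarrow> S)"
    using n unfolding m[OF nz(1,6)] m[OF nz(3,5)] m[OF nz(2,4)] bdefs by blast+
  have pos: "- s > 0 \<longleftrightarrow> \<not> S" "- t > 0 \<longleftrightarrow> \<not> T" "- u > 0 \<longleftrightarrow> \<not> U"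
      "- s < 0 \<longleftrightarrow> S" "- t < 0 \<longleftrightarrow> T" "- u < 0 \<longleftrightarrow> U"
    using neg by (simp_all add: bdefs)
  show ?thesis
    unfolding winding_signs f defs[symmetric] pos neg bdefs[symmetric]
    using n' by (cases P; cases Q; cases R; cases S; cases T; cases U) simp_all
qed

lemma cross_swap: "cross b a c d \<longleftrightarrow> cross a b c d"
  unfolding cross_def by (simp add: orient_flip[of a b] mult.commute)

lemma inside_exit_cross:
  assumes v: "in_triangle x y z v" and a: "\<not> in_triangle x y z a"
    and nz: "orient x a v \<noteq> 0" "orient y a v \<noteq> 0" "orient z a v \<noteq> 0"
      "orient x y a \<noteq> 0" "orient y z a \<noteq> 0" "orient z x a \<noteq> 0"
  shows "cross v a x y \<or> cross v a y z \<or> cross v a z x"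
proof -
  \<comment> \<open>\<open>p\<close>, \<open>q\<close>, \<open>r\<close> place \<open>v\<close>
    relative to the sides of a positively oriented triangle, \<open>A\<close>, \<open>B\<close>,
    \<open>C\<close> place its vertices relative to the line through \<open>a\<close> and
    \<open>v\<close>. If \<open>A > 0 > B\<close>, the ray from \<open>v\<close> through
    \<open>a\<close> leaves through the side \<open>x y\<close>; so if \<open>a\<close> is not
    beyond that side, it is not beyond the other two.\<close>
  have cone: "q + C - B > 0 \<and> r + A - C > 0"
    if "p > 0" "q > 0" "r > 0" "q * A + r * B + p * C = 0" "A > 0" "B < 0" "p + B - A > 0"
    for p q r A B C :: real
  proof -
    have e: "p * C = - (q * A + r * B)" using that by linarith
    have "p * (q + C - B) = q * (p + B - A) - B * (p + q + r)"
      using e by (simp add: algebra_simps)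
    also have "\<dots> > 0" using that mult_pos_pos[of q "p + B - A"] mult_neg_pos[of B "p + q + r"] by linarith
    finally have 1: "q + C - B > 0" using that(1) by (simp add: zero_less_mult_iff)
    have "p * (r + A - C) = r * (p + B - A) + A * (p + q + r)"
      using e by (simp add: algebra_simps)
    also have "\<dots> > 0" using that mult_pos_pos[of r "p + B - A"] mult_pos_pos[of A "p + q + r"] by linarith
    finally show ?thesis using 1 that(1) by (simp add: zero_less_mult_iff)
  qed
  have key: "(A * B < 0 \<and> p + B - A < 0) \<or> (B * C < 0 \<and> q + C - B < 0) \<or> (C * A < 0 \<and> r + A - C < 0)
      \<or> (p + B - A > 0 \<and> q + C - B > 0 \<and> r + A - C > 0)"
    if h: "p > 0" "q > 0" "r > 0" "q * A + r * B + p * C = 0" "A \<noteq> 0" "B \<noteq> 0" "C \<noteq> 0"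
      "p + B - A \<noteq> 0" "q + C - B \<noteq> 0" "r + A - C \<noteq> 0"
    for p q r A B C :: real
  proof -
    have "\<not> (A > 0 \<and> B > 0 \<and> C > 0)" "\<not> (A < 0 \<and> B < 0 \<and> C < 0)"
      using h(1-4) mult_pos_pos[of q A] mult_pos_pos[of r B] mult_pos_pos[of p C]
        mult_pos_neg[of q A] mult_pos_neg[of r B] mult_pos_neg[of p C] by linarith+
    then consider "A > 0" "B < 0" | "B > 0" "C < 0" | "C > 0" "A < 0" using h by linarith
    then show ?thesis
    proof cases
      case 1
      then show ?thesis using cone[of p q r A B C] h by (cases "p + B - A > 0") (auto simp: mult_less_0_iff)
    next
      case 2
      then show ?thesis using cone[of q r p B C A] h
        by (cases "q + C - B > 0") (auto simp: mult_less_0_iff algebra_simps)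
    next
      case 3
      then show ?thesis using cone[of r p q C A B] h
        by (cases "r + A - C > 0") (auto simp: mult_less_0_iff algebra_simps)
    qed
  qed
  define p q r A B C where "p = orient x y v" "q = orient y z v" "r = orient z x v"
    "A = orient x a v" "B = orient y a v" "C = orient z a v"
  note defs = this
  have s: "orient x y z = p + q + r" using orient_split[of x y z v] by (simp add: defs)
  have o: "orient x y a = p + B - A" "orient y z a = q + C - B" "orient z x a = r + A - C"
    using orient_split[of x y a v] orient_split[of y z a v] orient_split[of z x a v]
    by (simp_all add: defs orient_flip[of _ a v])
  have ov: "orient v a x = - A" "orient v a y = - B" "orient v a z = - C"
    by (simp_all add: defs) (simp_all add: orient_def algebra_simps)
  have gp: "q * A + r * B + p * C = 0" using orient_plucker[of x y v z a] by (simp add: defs algebra_simps)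
  have nz': "A \<noteq> 0" "B \<noteq> 0" "C \<noteq> 0" using nz(1-3) by (simp_all add: defs)
  have nz'': "p + B - A \<noteq> 0" "q + C - B \<noteq> 0" "r + A - C \<noteq> 0" using nz(4-6) by (simp_all add: o)
  have sv: "p * (p + q + r) > 0" "q * (p + q + r) > 0" "r * (p + q + r) > 0"
    using v by (simp_all add: in_triangle_def s defs[symmetric])
  have sa: "\<not> ((p + B - A) * (p + q + r) > 0 \<and> (q + C - B) * (p + q + r) > 0 \<and> (r + A - C) * (p + q + r) > 0)"
    using a by (simp add: in_triangle_def s o)
  have goal: "?thesis \<longleftrightarrow> (A * B < 0 \<and> p * (p + B - A) < 0) \<or> (B * C < 0 \<and> q * (q + C - B) < 0)
      \<or> (C * A < 0 \<and> r * (r + A - C) < 0)"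
    by (simp add: cross_def ov o defs[symmetric])
  have t: "t > 0 \<or> t < 0" if "p * t > 0" for t using that by (cases "t > 0") (auto simp: zero_less_mult_iff)
  have mp: "x * y < 0 \<longleftrightarrow> y < 0" "y * x > 0 \<longleftrightarrow> y > 0" if "x > 0" for x y :: real
    using that by (auto simp: mult_less_0_iff zero_less_mult_iff)
  have mn: "x * y < 0 \<longleftrightarrow> y > 0" "y * x > 0 \<longleftrightarrow> y < 0" if "x < 0" for x y :: real
    using that by (auto simp: mult_less_0_iff zero_less_mult_iff)
  show ?thesis
  proof (cases "p + q + r > 0")
    case True
    then have "p > 0" "q > 0" "r > 0" using sv by (simp_all add: mp)
    then show ?thesis
      using key[OF _ _ _ gp nz' nz''] sa unfolding goal by (simp only: mp[OF True]) (auto simp: mp)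
  next
    case False
    then have neg: "p + q + r < 0" using t[OF sv(1)] by blast
    then have pqr: "p < 0" "q < 0" "r < 0" using sv by (simp_all add: mn)
    have "(- A * - B < 0 \<and> - p + - B - - A < 0) \<or> (- B * - C < 0 \<and> - q + - C - - B < 0) \<or>
        (- C * - A < 0 \<and> - r + - A - - C < 0) \<or>
        (- p + - B - - A > 0 \<and> - q + - C - - B > 0 \<and> - r + - A - - C > 0)"
      by (rule key) (use pqr gp nz' nz'' in simp_all)
    then have "(A * B < 0 \<and> p + B - A > 0) \<or> (B * C < 0 \<and> q + C - B > 0) \<or> (C * A < 0 \<and> r + A - C > 0)
      \<or> (p + B - A < 0 \<and> q + C - B < 0 \<and> r + A - C < 0)"
      by (simp add: algebra_simps)
    moreover have "\<not> (p + B - A < 0 \<and> q + C - B < 0 \<and> r + A - C < 0)" using sa by (simp only: mn[OF neg]) simp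
    ultimately show ?thesis unfolding goal mn(1)[OF pqr(1)] mn(1)[OF pqr(2)] mn(1)[OF pqr(3)] by blast
  qed
qed

text \<open>The side lines cut the outside of the triangle into six regions. In the three beyond a
  side, the segment from \<open>v\<close> to the opposite vertex crosses that side; there remain the
  three cones behind the vertices. In such a cone \<open>v\<close> and two vertices enclose the
  third, which is how the outer face changes.\<close>

lemma outside_visible_signs:
  assumes nz: "orient a b c \<noteq> 0" "orient a b v \<noteq> 0" "orient b c v \<noteq> 0" "orient c a v \<noteq> 0"
    and "\<not> in_triangle a b c v" "\<not> cross v a b c" "\<not> cross v b c a" "\<not> cross v c a b"
  defines "s \<equiv> sgn (orient a b c)"
  shows "(sgn (orient a b v), sgn (orient b c v), sgn (orient c a v)) \<in> {(s, -s, -s), (-s, s, -s), (-s, -s, s)}"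
proof -
  define \<alpha> \<beta> \<gamma> t where "\<alpha> = orient a b v" "\<beta> = orient b c v" "\<gamma> = orient c a v" "t = orient a b c"
  note defs = this
  have t: "t = \<alpha> + \<beta> + \<gamma>" unfolding defs by (rule orient_split)
  have p: "orient b c a = t" "orient c a b = t" "orient v a b = \<alpha>" "orient v a c = - \<gamma>"
    "orient v b c = \<beta>" "orient v b a = - \<alpha>" "orient v c a = \<gamma>" "orient v c b = - \<beta>"
    by (simp_all add: defs) (simp_all add: orient_def algebra_simps)
  have h: "\<not> (\<alpha> * t > 0 \<and> \<beta> * t > 0 \<and> \<gamma> * t > 0)" "\<not> (\<alpha> * - \<gamma> < 0 \<and> \<beta> * t < 0)"
    "\<not> (\<beta> * - \<alpha> < 0 \<and> \<gamma> * t < 0)" "\<not> (\<gamma> * - \<beta> < 0 \<and> \<alpha> * t < 0)"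
    using assms(5-8) by (simp_all add: in_triangle_def cross_def p defs[symmetric])
  have nz: "\<alpha> \<noteq> 0" "\<beta> \<noteq> 0" "\<gamma> \<noteq> 0" "t \<noteq> 0" using assms(1-4) by (simp_all add: defs)
  have n: "\<not> (\<alpha> > 0 \<and> \<beta> > 0 \<and> \<gamma> > 0 \<and> t < 0)" "\<not> (\<alpha> < 0 \<and> \<beta> < 0 \<and> \<gamma> < 0 \<and> t > 0)" using t by linarith+
  have "\<alpha> > 0 \<or> \<alpha> < 0" using nz by linarith
  moreover have "\<beta> > 0 \<or> \<beta> < 0" using nz by linarith
  moreover have "\<gamma> > 0 \<or> \<gamma> < 0" using nz by linarith
  moreover have "t > 0 \<or> t < 0" using nz by linarith
  ultimately show ?thesis
    unfolding s_def defs[symmetric] using h n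
    by (elim disjE) (simp_all add: zero_less_mult_iff mult_less_0_iff)
qed

section \<open>Stacked triangulations\<close>

type_synonym face = "nat \<times> nat \<times> nat"

fun fverts :: "face \<Rightarrow> nat set" where
  "fverts (a, b, c) = {a, b, c}"

fun new_faces :: "face \<Rightarrow> nat \<Rightarrow> face set" where
  "new_faces (a, b, c) v = {(a, b, v), (b, c, v), (c, a, v)}"

text \<open>A history lists the faces that received a new vertex, the most recent one first; the vertex
  inserted into \<open>F\<close> by \<open>F # h\<close> is \<open>length h + 3\<close>. Faces are oriented, which distinguishes the two
  sides of the initial triangle.\<close>

fun faces :: "face list \<Rightarrow> face set" where
  "faces [] = {(0, 1, 2), (0, 2, 1)}"
| "faces (F # h) = faces h - {F} \<union> new_faces F (length h + 3)"

fun arcs_of :: "face list \<Rightarrow> (nat \<times> nat) set" where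
  "arcs_of [] = {(u, v). u < 3 \<and> v < 3 \<and> u \<noteq> v}"
| "arcs_of (F # h) = arcs_of h \<union> {length h + 3} \<times> fverts F \<union> fverts F \<times> {length h + 3}"

inductive build :: "face list \<Rightarrow> bool" where
  build_Nil: "build []"
| build_Cons: "build h \<Longrightarrow> F \<in> faces h \<Longrightarrow> build (F # h)"

lemma build_face_verts:
  "build h \<Longrightarrow> (a, b, c) \<in> faces h \<Longrightarrow>
    a \<noteq> b \<and> b \<noteq> c \<and> c \<noteq> a \<and> a < length h + 3 \<and> b < length h + 3 \<and> c < length h + 3"
proof (induction arbitrary: a b c rule: build.induct)
  case (build_Cons h F)
  obtain x y z where F: "F = (x, y, z)" by (cases F) auto
  have "x \<noteq> y \<and> y \<noteq> z \<and> z \<noteq> x \<and> x < length h + 3 \<and> y < length h + 3 \<and> z < length h + 3"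
    using build_Cons.IH[of x y z] build_Cons.hyps F by simp
  then show ?case using build_Cons.prems build_Cons.IH[of a b c] F by auto
qed auto

lemma build_finite: "build h \<Longrightarrow> finite (faces h)"
  by (induction rule: build.induct) (auto elim: new_faces.elims split: prod.splits)

lemma new_face_fresh:
  assumes "build h" "F \<in> faces h" "G \<in> new_faces F (length h + 3)"
  shows "G \<notin> faces h"
proof
  assume "G \<in> faces h"
  obtain a b c x y z where "F = (a, b, c)" "G = (x, y, z)" by (cases F, cases G) auto
  with assms build_face_verts[OF assms(1), of x y z] \<open>G \<in> faces h\<close> show False by auto
qed

lemma card_new_faces:
  assumes "build h" "F \<in> faces h"
  shows "card (new_faces F (length h + 3)) = 3"
proof -
  obtain a b c where F: "F = (a, b, c)" by (cases F) auto
  show ?thesis using build_face_verts[OF assms(1), of a b c] assms(2) by (simp add: F)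
qed

lemma build_card_faces: "build h \<Longrightarrow> card (faces h) = 2 * length h + 2"
proof (induction rule: build.induct)
  case (build_Cons h F)
  have fin: "finite (faces h)" using build_finite[OF build_Cons.hyps(1)] .
  have "finite (new_faces F (length h + 3))" using build_finite[OF build.build_Cons[OF build_Cons.hyps]] by simp
  moreover have "(faces h - {F}) \<inter> new_faces F (length h + 3) = {}"
    using new_face_fresh[OF build_Cons.hyps] by blast
  ultimately have "card (faces (F # h)) = card (faces h - {F}) + 3"
    using fin card_new_faces[OF build_Cons.hyps] by (simp add: card_Un_disjoint)
  then show ?case using build_Cons.IH build_Cons.hyps(2) fin by simp
qed simp

text \<open>The two initial faces have the same vertices, so a face is identified by its vertex set
  only after the first stacking step. This serves to recover a face from the vertices that a new
  point sees.\<close>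

lemma build_fverts_inj:
  assumes "build h" "h \<noteq> []"
  shows "inj_on fverts (faces h)"
  using assms
proof (induction rule: build.induct)
  case (build_Cons h F)
  let ?v = "length h + 3"
  obtain a b c where F: "F = (a, b, c)" by (cases F) auto
  have abc: "a \<noteq> b" "b \<noteq> c" "c \<noteq> a" "a < ?v" "b < ?v" "c < ?v"
    using build_face_verts[OF build_Cons.hyps(1), of a b c] build_Cons.hyps(2) F by auto
  have old: "inj_on fverts (faces h - {F})"
  proof (cases "h = []")
    case True
    then show ?thesis using build_Cons.hyps(2) by (auto simp: inj_on_def)
  next
    case False
    then show ?thesis using build_Cons.IH inj_on_subset by blast
  qed
  have new: "inj_on fverts (new_faces F ?v)"
    using abc by (auto simp: F inj_on_def set_eq_iff)
  have mem: "?v \<in> fverts G" if "G \<in> new_faces F ?v" for G using that by (auto simp: F)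
  have nmem: "?v \<notin> fverts G" if "G \<in> faces h" for G
  proof -
    obtain x y z where G: "G = (x, y, z)" by (cases G) auto
    show ?thesis using build_face_verts[OF build_Cons.hyps(1), of x y z] that by (auto simp: G)
  qed
  have "fverts G \<noteq> fverts G'" if "G \<in> faces h" "G' \<in> new_faces F ?v" for G G'
    using mem[OF that(2)] nmem[OF that(1)] by blast
  then show ?case unfolding faces.simps inj_on_Un by (intro conjI old new) blast
qed simp

lemma build_face_arcs:
  "build h \<Longrightarrow> F \<in> faces h \<Longrightarrow> u \<in> fverts F \<Longrightarrow> w \<in> fverts F \<Longrightarrow> u \<noteq> w \<Longrightarrow> (u, w) \<in> arcs_of h"
proof (induction arbitrary: F u w rule: build.induct)
  case (build_Cons h F')
  obtain a b c where F': "F' = (a, b, c)" by (cases F') auto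
  have old: "(u, w) \<in> arcs_of h" if "u \<in> {a, b, c}" "w \<in> {a, b, c}"
    using build_Cons.IH[OF build_Cons.hyps(2), of u w] that build_Cons.prems(4) F' by auto
  show ?case
  proof (cases "F \<in> faces h")
    case True
    then show ?thesis using build_Cons.IH build_Cons.prems by auto
  next
    case False
    then have "F \<in> new_faces F' (length h + 3)" using build_Cons.prems(1) by simp
    then have "fverts F \<subseteq> insert (length h + 3) {a, b, c}" by (auto simp: F')
    then have uw: "u = length h + 3 \<or> u \<in> {a, b, c}" "w = length h + 3 \<or> w \<in> {a, b, c}"
      using build_Cons.prems(2,3) by blast+
    show ?thesis
    proof (cases "u = length h + 3 \<or> w = length h + 3")
      case True
      then show ?thesis using uw build_Cons.prems(4) by (simp only: arcs_of.simps F' fverts.simps) blast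
    next
      case False
      then show ?thesis using uw old by simp
    qed
  qed
qed auto

lemma build_arcs:
  "build h \<Longrightarrow> (u, w) \<in> arcs_of h \<Longrightarrow> u \<noteq> w \<and> u < length h + 3 \<and> w < length h + 3 \<and> (w, u) \<in> arcs_of h"
proof (induction arbitrary: u w rule: build.induct)
  case (build_Cons h F)
  obtain a b c where F: "F = (a, b, c)" by (cases F) auto
  have "a < length h + 3 \<and> b < length h + 3 \<and> c < length h + 3"
    using build_face_verts[OF build_Cons.hyps(1), of a b c] build_Cons.hyps(2) F by auto
  then show ?case using build_Cons.prems build_Cons.IH[of u w] by (auto simp: F)
qed auto

section \<open>Winding sums and the outer face of a drawing\<close>

definition generic :: "(nat \<Rightarrow> real^2) \<Rightarrow> nat \<Rightarrow> bool" where
  "generic q N \<longleftrightarrow> (\<forall>a<N. \<forall>b<N. \<forall>c<N. a \<noteq> b \<longrightarrow> b \<noteq> c \<longrightarrow> c \<noteq> a \<longrightarrow> orient (q a) (q b) (q c) \<noteq> 0)"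

fun face_orient :: "(nat \<Rightarrow> real^2) \<Rightarrow> face \<Rightarrow> real" where
  "face_orient q (a, b, c) = orient (q a) (q b) (q c)"

fun in_face :: "(nat \<Rightarrow> real^2) \<Rightarrow> face \<Rightarrow> nat \<Rightarrow> bool" where
  "in_face q (a, b, c) x \<longleftrightarrow> in_triangle (q a) (q b) (q c) (q x)"

definition face_winding :: "(nat \<Rightarrow> real^2) \<Rightarrow> face \<Rightarrow> nat \<Rightarrow> real" where
  "face_winding q F x = (if in_face q F x then sgn (face_orient q F) else 0)"

lemma genericD:
  "generic q N \<Longrightarrow> a < N \<Longrightarrow> b < N \<Longrightarrow> c < N \<Longrightarrow> a \<noteq> b \<Longrightarrow> b \<noteq> c \<Longrightarrow> c \<noteq> a \<Longrightarrow> orient (q a) (q b) (q c) \<noteq> 0"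
  by (simp add: generic_def)

lemma generic_mono: "generic q N \<Longrightarrow> M \<le> N \<Longrightarrow> generic q M"
  unfolding generic_def by (meson order_less_le_trans)

lemma not_in_face_vertex: "x \<in> fverts F \<Longrightarrow> \<not> in_face q F x"
  by (cases F) (auto simp: in_triangle_def)

lemma face_winding_triple: "face_winding q (a, b, c) x = winding (q a) (q b) (q c) (q x)"
  by (simp add: face_winding_def winding_def)

lemma face_winding_split:
  assumes "generic q N" "build h" "F \<in> faces h" "v < N" "x < N" "x \<noteq> v" "x \<notin> fverts F" "v = length h + 3"
  shows "(\<Sum>G\<in>new_faces F v. face_winding q G x) = face_winding q F x"
proof -
  obtain a b c where F: "F = (a, b, c)" by (cases F) auto
  have abc: "a \<noteq> b" "b \<noteq> c" "c \<noteq> a" "a < v" "b < v" "c < v"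
    using build_face_verts[OF assms(2), of a b c] assms(3,8) F by auto
  have x: "x \<noteq> a" "x \<noteq> b" "x \<noteq> c" using assms(7) by (auto simp: F)
  have "winding (q a) (q b) (q c) (q x) = winding (q a) (q b) (q v) (q x) + winding (q b) (q c) (q v) (q x)
      + winding (q c) (q a) (q v) (q x)"
    using abc x assms(4-6) by (intro winding_split genericD[OF assms(1)]) auto
  moreover have "(\<Sum>G\<in>new_faces F v. face_winding q G x) =
      face_winding q (a, b, v) x + (face_winding q (b, c, v) x + face_winding q (c, a, v) x)"
    using abc by (simp add: F)
  ultimately show ?thesis by (simp only: F face_winding_triple add.assoc)
qed

text \<open>The oriented faces form a closed surface: the two initial faces cancel, and stacking
  preserves the sum. The point \<open>x\<close> is one that is not yet a vertex.\<close>

lemma sum_winding_eq_0: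
  assumes "build h" "generic q N" "length h + 3 \<le> x" "x < N"
  shows "(\<Sum>F\<in>faces h. face_winding q F x) = 0"
  using assms(1,3)
proof (induction rule: build.induct)
  case build_Nil
  have "orient (q 0) (q 2) (q 1) = - orient (q 0) (q 1) (q 2)" "orient (q 0) (q 2) (q x) = - orient (q 2) (q 0) (q x)"
    "orient (q 2) (q 1) (q x) = - orient (q 1) (q 2) (q x)" "orient (q 1) (q 0) (q x) = - orient (q 0) (q 1) (q x)"
    by (simp_all add: orient_def algebra_simps)
  then show ?case by (auto simp: face_winding_def in_triangle_def sgn_minus)
next
  case (build_Cons h F)
  let ?v = "length h + 3"
  have fin: "finite (faces h)" "finite (new_faces F ?v)"
    using build_finite[OF build_Cons.hyps(1)] build_finite[OF build.build_Cons[OF build_Cons.hyps]] by simp_all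
  have dis: "(faces h - {F}) \<inter> new_faces F ?v = {}" using new_face_fresh[OF build_Cons.hyps] by blast
  obtain a b c where F: "F = (a, b, c)" by (cases F) auto
  have "x \<notin> fverts F"
    using build_face_verts[OF build_Cons.hyps(1), of a b c] build_Cons.hyps(2) build_Cons.prems by (auto simp: F)
  then have "(\<Sum>G\<in>new_faces F ?v. face_winding q G x) = face_winding q F x"
    using build_Cons.prems assms(4) by (intro face_winding_split[OF assms(2) build_Cons.hyps]) auto
  then show ?case
    using fin dis build_Cons.IH build_Cons.prems build_Cons.hyps(2)
    by (simp add: sum.union_disjoint sum_diff1)
qed

text \<open>\<open>Z\<close> is the outer face of the drawing: all other faces have the orientation \<open>c\<close>, and \<open>Z\<close> the
  opposite one.\<close>

definition good :: "(nat \<Rightarrow> real^2) \<Rightarrow> face list \<Rightarrow> real \<Rightarrow> face \<Rightarrow> bool" where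
  "good q h c Z \<longleftrightarrow> Z \<in> faces h \<and> (c = 1 \<or> c = -1) \<and> sgn (face_orient q Z) = - c \<and>
     (\<forall>F\<in>faces h - {Z}. sgn (face_orient q F) = c) \<and>
     (\<forall>u<length h + 3. u \<notin> fverts Z \<longrightarrow> in_face q Z u) \<and>
     (\<forall>F\<in>faces h - {Z}. \<forall>u<length h + 3. \<not> in_face q F u)"

text \<open>In the vanishing winding sum every inner face around \<open>x\<close> contributes
  \<open>c\<close>, and the outer face contributes \<open>- c\<close> if it contains
  \<open>x\<close>. Equal signs of the inner contributions turn the sum into a count.\<close>

lemma good_count:
  assumes "build h" "good q h c Z" "generic q N" "length h + 3 \<le> x" "x < N"
  shows "card {F \<in> faces h - {Z}. in_face q F x} = (if in_face q Z x then 1 else 0)"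
proof -
  have fin: "finite (faces h)" by (rule build_finite[OF assms(1)])
  have g: "Z \<in> faces h" "c = 1 \<or> c = -1" "sgn (face_orient q Z) = - c"
    "\<And>F. F \<in> faces h - {Z} \<Longrightarrow> sgn (face_orient q F) = c"
    using assms(2) by (auto simp: good_def)
  have "0 = (\<Sum>F\<in>faces h. face_winding q F x)" using sum_winding_eq_0[OF assms(1,3-5)] by simp
  also have "\<dots> = face_winding q Z x + (\<Sum>F\<in>faces h - {Z}. face_winding q F x)"
    using fin g(1) by (simp add: sum.remove)
  also have "(\<Sum>F\<in>faces h - {Z}. face_winding q F x) = (\<Sum>F\<in>faces h - {Z}. if in_face q F x then c else 0)"
    using g(4) by (intro sum.cong) (auto simp: face_winding_def)
  also have "\<dots> = (\<Sum>F\<in>{F \<in> faces h - {Z}. in_face q F x}. c)"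
    using fin by (simp only: sum.inter_filter finite_Diff)
  also have "\<dots> = real (card {F \<in> faces h - {Z}. in_face q F x}) * c" by simp
  finally have "real (card {F \<in> faces h - {Z}. in_face q F x}) * c = (if in_face q Z x then c else 0)"
    using g(3) by (simp add: face_winding_def split: if_splits)
  then have "real (card {F \<in> faces h - {Z}. in_face q F x}) = real (if in_face q Z x then 1 else 0)"
    using g(2) by (auto split: if_splits)
  then show ?thesis by (simp only: of_nat_eq_iff)
qed

lemma good_inside_iff:
  assumes "build h" "good q h c Z" "generic q N" "length h + 3 \<le> x" "x < N"
  shows "(\<exists>F\<in>faces h - {Z}. in_face q F x) \<longleftrightarrow> in_face q Z x"
    and "F \<in> faces h - {Z} \<Longrightarrow> in_face q F x \<Longrightarrow> G \<in> faces h - {Z} \<Longrightarrow> in_face q G x \<Longrightarrow> F = G"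
proof -
  let ?S = "{F \<in> faces h - {Z}. in_face q F x}"
  have fin: "finite ?S" using build_finite[OF assms(1)] by simp
  have c: "card ?S = (if in_face q Z x then 1 else 0)" by (rule good_count[OF assms])
  show "(\<exists>F\<in>faces h - {Z}. in_face q F x) \<longleftrightarrow> in_face q Z x"
  proof (cases "in_face q Z x")
    case True
    then have "?S \<noteq> {}" using c by (metis card.empty zero_neq_one)
    then show ?thesis using True by blast
  next
    case False
    then have "?S = {}" using c fin by (metis card_0_eq)
    then show ?thesis using False by blast
  qed
  assume "F \<in> faces h - {Z}" "in_face q F x" "G \<in> faces h - {Z}" "in_face q G x"
  then have FG: "F \<in> ?S" "G \<in> ?S" by auto
  have "card ?S \<le> 1" using c by simp
  then show "F = G" using FG fin by (simp only: card_le_Suc0_iff_eq One_nat_def)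
qed

lemma good_inner:
  assumes b: "build h" and g: "good q h c Z" and gen: "generic q N" and N: "length h + 3 < N"
    and F: "F \<in> faces h" "F \<noteq> Z" "in_face q F (length h + 3)"
  shows "good q (F # h) c Z"
proof -
  define v where "v = length h + 3"
  obtain x y z where Fxyz: "F = (x, y, z)" by (cases F) auto
  have xyz: "x \<noteq> y" "y \<noteq> z" "z \<noteq> x" "x < v" "y < v" "z < v"
    using build_face_verts[OF b, of x y z] F(1) Fxyz by (auto simp: v_def)
  have g': "Z \<in> faces h" "c = 1 \<or> c = -1" "sgn (face_orient q Z) = - c"
    "\<And>F. F \<in> faces h - {Z} \<Longrightarrow> sgn (face_orient q F) = c"
    "\<And>u. u < v \<Longrightarrow> u \<notin> fverts Z \<Longrightarrow> in_face q Z u"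
    "\<And>F u. F \<in> faces h - {Z} \<Longrightarrow> u < v \<Longrightarrow> \<not> in_face q F u"
    using g by (auto simp: good_def v_def)
  have FO: "F \<in> faces h - {Z}" using F by simp
  have Fv: "in_face q F v" using F(3) by (simp add: v_def)
  have vO: "in_face q Z v"
    using good_inside_iff(1)[OF b g gen, of v] N FO Fv by (auto simp: v_def)
  have sF: "sgn (orient (q x) (q y) (q z)) = c" using g'(4)[OF FO] by (simp add: Fxyz)
  have ins: "orient (q x) (q y) (q v) * orient (q x) (q y) (q z) > 0"
    "orient (q y) (q z) (q v) * orient (q x) (q y) (q z) > 0"
    "orient (q z) (q x) (q v) * orient (q x) (q y) (q z) > 0"
    using Fv by (simp_all add: Fxyz in_triangle_def)
  have same: "sgn s = sgn t" if "s * t > 0" for s t :: real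
    using that by (auto simp: zero_less_mult_iff)
  have sN: "sgn (face_orient q G) = c" if "G \<in> new_faces F v" for G
    using that same[OF ins(1)] same[OF ins(2)] same[OF ins(3)] sF by (auto simp: Fxyz)
  \<comment> \<open>For \<open>u\<close> off \<open>F\<close>: the three new faces carry the same
    sign \<open>c\<close>, so their contributions cannot cancel, and as \<open>F\<close> does not
    wind around \<open>u\<close>, none of them does.\<close>
  have out: "\<not> in_face q G u" if G: "G \<in> new_faces F v" and u: "u < v" for G u
  proof (cases "u \<in> fverts F")
    case False
    have fin: "finite (new_faces F v)" by (simp add: Fxyz)
    have "(\<Sum>G\<in>new_faces F v. face_winding q G u) = face_winding q F u"
      using u N False by (intro face_winding_split[OF gen b F(1)]) (auto simp: v_def)
    also have "\<dots> = 0" using g'(6)[OF FO u] by (simp add: face_winding_def)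
    finally have "(\<Sum>G\<in>new_faces F v. c * face_winding q G u) = 0" by (simp flip: sum_distrib_left)
    moreover have "c * face_winding q G u \<ge> 0" if "G \<in> new_faces F v" for G
      using sN[OF that] g'(2) by (auto simp: face_winding_def)
    ultimately have "c * face_winding q G u = 0" using fin G g'(2) by (auto simp: sum_nonneg_eq_0_iff)
    then show ?thesis using sN[OF G] g'(2) by (auto simp: face_winding_def split: if_splits)
  next
    case True
    show ?thesis
    proof (cases "u \<in> fverts G")
      case True
      then show ?thesis by (rule not_in_face_vertex)
    next
      case False
      \<comment> \<open>Here \<open>u\<close> is the vertex of \<open>F\<close> that
        \<open>G\<close> misses; the line through \<open>v\<close> and a vertex of \<open>G\<close>
        separates it from the interior of \<open>G\<close>.\<close>
      have n: "\<not> in_triangle (q a) (q b) (q v) (q w)"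
        if "orient (q b) (q w) (q v) * orient (q a) (q b) (q v) > 0" for a b w
      proof
        assume "in_triangle (q a) (q b) (q v) (q w)"
        then have "orient (q b) (q v) (q w) * orient (q a) (q b) (q v) > 0" by (simp add: in_triangle_def)
        then show False using that by (simp add: orient_flip'[of "q b" "q v" "q w"])
      qed
      have pp: "s * t > 0" if "s * r > 0" "t * r > 0" for s t r :: real
        using that by (auto simp: zero_less_mult_iff)
      from G True False consider "G = (x, y, v)" "u = z" | "G = (y, z, v)" "u = x" | "G = (z, x, v)" "u = y"
        using xyz by (auto simp: Fxyz)
      then show ?thesis
        by cases (use n[OF pp[OF ins(2,1)]] n[OF pp[OF ins(3,2)]] n[OF pp[OF ins(1,3)]] in auto)
    qed
  qed
  have old: "\<not> in_face q G v" if "G \<in> faces h - {Z} - {F}" for G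
    using good_inside_iff(2)[OF b g gen, of v F G] that FO Fv N by (auto simp: v_def)
  have self: "\<not> in_face q G v" if "G \<in> new_faces F v" for G
    using that by (intro not_in_face_vertex) (auto simp: Fxyz)
  have lt: "u < length (F # h) + 3 \<longleftrightarrow> u < v \<or> u = v" for u by (auto simp: v_def)
  show ?thesis unfolding good_def lt
  proof (intro conjI ballI allI impI)
    show "Z \<in> faces (F # h)" using g'(1) F(2) by simp
    show "sgn (face_orient q G) = c" if "G \<in> faces (F # h) - {Z}" for G
      using that g'(4)[of G] sN[of G] by (auto simp: v_def)
    show "in_face q Z u" if "u < v \<or> u = v" "u \<notin> fverts Z" for u using that g'(5) vO by blast
    show "\<not> in_face q G u" if "G \<in> faces (F # h) - {Z}" "u < v \<or> u = v" for G u
    proof (cases "G \<in> new_faces F v")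
      case True
      then show ?thesis using out self that(2) by blast
    next
      case False
      then have "G \<in> faces h - {Z} - {F}" using that(1) by (auto simp: v_def)
      then show ?thesis using old g'(6) that(2) by blast
    qed
  qed (use g' in auto)
qed

text \<open>\<open>v\<close> lies in the cone behind the vertex \<open>x\<close> of the outer
  triangle, so \<open>x\<close> becomes an inner vertex and \<open>(y, z, v)\<close> the outer face.
  \<open>Z\<close> is given up to rotation, so that each of its vertices can play the role of
  \<open>x\<close>.\<close>

lemma good_outer:
  assumes b: "build h" and g: "good q h c Z" and gen: "generic q N" and N: "length h + 3 < N"
    and v: "v = length h + 3" and Z: "Z \<in> {(x, y, z), (y, z, x), (z, x, y)}"
    and sgns: "sgn (orient (q x) (q y) (q v)) = c" "sgn (orient (q y) (q z) (q v)) = - c"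
      "sgn (orient (q z) (q x) (q v)) = c"
  shows "good q (Z # h) c (y, z, v)"
proof -
  have g': "Z \<in> faces h" "c = 1 \<or> c = -1" "sgn (face_orient q Z) = - c"
    "\<And>F. F \<in> faces h - {Z} \<Longrightarrow> sgn (face_orient q F) = c"
    "\<And>u. u < v \<Longrightarrow> u \<notin> fverts Z \<Longrightarrow> in_face q Z u"
    "\<And>F u. F \<in> faces h - {Z} \<Longrightarrow> u < v \<Longrightarrow> \<not> in_face q F u"
    using g by (auto simp: good_def v)
  have xyz: "x \<noteq> y" "y \<noteq> z" "z \<noteq> x" "x < v" "y < v" "z < v"
    using build_face_verts[OF b, of x y z] build_face_verts[OF b, of y z x]
      build_face_verts[OF b, of z x y] g'(1) Z by (auto simp: v)
  have rot: "orient (q y) (q z) (q x) = orient (q x) (q y) (q z)" "orient (q z) (q x) (q y) = orient (q x) (q y) (q z)"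
    by (simp_all add: orient_def algebra_simps)
  have sO: "sgn (orient (q x) (q y) (q z)) = - c" using g'(3) Z rot by auto
  have NF: "new_faces Z v = {(x, y, v), (y, z, v), (z, x, v)}" using Z by auto
  have fO: "fverts Z = {x, y, z}" using Z by auto
  have sgn_mult: "s * t > 0 \<longleftrightarrow> sgn s * sgn t > 0" "s * t < 0 \<longleftrightarrow> sgn s * sgn t < 0" for s t :: real
    by (simp_all add: sgn_mult[symmetric])
  have cc: "c * c > 0" using g'(2) by auto
  have vO: "\<not> in_face q Z v"
  proof
    assume "in_face q Z v"
    then have "orient (q x) (q y) (q v) * orient (q x) (q y) (q z) > 0"
      using Z rot by (auto simp: in_triangle_def)
    then show False using cc by (simp add: sgn_mult sgns sO)
  qed
  have flips: "orient (q a) (q w) (q b) = - orient (q a) (q b) (q w)" for a b w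
    by (simp add: orient_def algebra_simps)
  \<comment> \<open>The new faces have winding sum \<open>- c\<close>. Two of them can contribute
    only \<open>c\<close> or 0, and \<open>(y, z, v)\<close> only \<open>- c\<close> or 0; so
    \<open>(y, z, v)\<close> contains \<open>u\<close> and the other two do not.\<close>
  have w: "in_face q (y, z, v) u \<and> \<not> in_face q (x, y, v) u \<and> \<not> in_face q (z, x, v) u"
    if u: "u < v" "u \<notin> fverts Z" for u
  proof -
    have "face_winding q (x, y, v) u + (face_winding q (y, z, v) u + face_winding q (z, x, v) u) =
        (\<Sum>G\<in>new_faces Z v. face_winding q G u)" using xyz by (simp add: NF)
    also have "\<dots> = face_winding q Z u"
      using u N by (intro face_winding_split[OF gen b g'(1)]) (auto simp: v)
    also have "\<dots> = - c" using g'(5)[OF u] g'(3) by (simp add: face_winding_def)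
    finally show ?thesis using sgns g'(2)
      by (auto simp: face_winding_def split: if_splits)
  qed
  have outer: "in_face q (y, z, v) u" if u: "u < v" "u \<notin> {y, z, v}" for u
  proof (cases "u = x")
    case True
    have "orient (q z) (q v) (q x) = - orient (q z) (q x) (q v)" "orient (q v) (q y) (q x) = - orient (q x) (q y) (q v)"
      by (simp_all add: orient_def algebra_simps)
    then show ?thesis using sO sgns cc cc unfolding True
      by (simp add: in_triangle_def rot sgn_mult sgn_minus)
  next
    case False
    then show ?thesis using w u fO by auto
  qed
  have inner: "\<not> in_face q G u" if G: "G \<in> new_faces Z v - {(y, z, v)}" and u: "u \<le> v" for G u
  proof (cases "u \<in> fverts G")
    case True
    then show ?thesis by (rule not_in_face_vertex)
  next
    case False
    then have uv: "u < v" using u G NF by auto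
    show ?thesis
    proof (cases "u \<in> fverts Z")
      case False
      then show ?thesis using w[OF uv False] G NF by auto
    next
      case True
      with G \<open>u \<notin> fverts G\<close> consider "G = (x, y, v)" "u = z" | "G = (z, x, v)" "u = y"
        using xyz by (auto simp: NF fO)
      moreover have "\<not> orient (q x) (q y) (q z) * orient (q x) (q y) (q v) > 0"
        "\<not> orient (q z) (q x) (q y) * orient (q z) (q x) (q v) > 0"
        using cc by (simp_all add: sgn_mult(1) rot sO sgns)
      ultimately show ?thesis by cases (simp_all add: in_triangle_def)
    qed
  qed
  have old: "\<not> in_face q G u" if "G \<in> faces h - {Z}" "u \<le> v" for G u
    using good_inside_iff(1)[OF b g gen, of v] vO that g'(6)[OF that(1), of u] N v by (cases "u = v") auto
  have lt: "u < length (Z # h) + 3 \<longleftrightarrow> u \<le> v" for u by (auto simp: v)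
  have fresh: "(y, z, v) \<notin> faces h" using new_face_fresh[OF b g'(1), of "(y, z, v)"] NF by (simp add: v)
  have fs: "faces (Z # h) - {(y, z, v)} = (faces h - {Z}) \<union> (new_faces Z v - {(y, z, v)})"
    using fresh by (auto simp: v)
  show ?thesis unfolding good_def lt fs
  proof (intro conjI ballI allI impI)
    show "(y, z, v) \<in> faces (Z # h)" using NF by (simp add: v)
    show "sgn (face_orient q G) = c" if "G \<in> faces h - {Z} \<union> (new_faces Z v - {(y, z, v)})" for G
      using that g'(4)[of G] sgns NF by auto
    show "in_face q (y, z, v) u" if "u \<le> v" "u \<notin> fverts (y, z, v)" for u
      using that outer by (cases "u = v") auto
    show "\<not> in_face q G u" if "G \<in> faces h - {Z} \<union> (new_faces Z v - {(y, z, v)})" "u \<le> v" for G u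
      using that inner old by blast
  qed (use g' sgns in auto)
qed

section \<open>Uniqueness of histories\<close>

text \<open>Concerns disjoint edges only, and only through orientation signs; so it passes between
  labelled point sets of the same order type.\<close>

definition chirotope_free :: "(nat \<Rightarrow> real^2) \<Rightarrow> (nat \<times> nat) set \<Rightarrow> bool" where
  "chirotope_free q E \<longleftrightarrow> (\<forall>(u, w)\<in>E. \<forall>(x, y)\<in>E. distinct [u, w, x, y] \<longrightarrow> \<not> cross (q u) (q w) (q x) (q y))"

lemma chirotope_freeI:
  assumes "\<And>u w x y. (u, w) \<in> E \<Longrightarrow> (x, y) \<in> E \<Longrightarrow> distinct [u, w, x, y] \<Longrightarrow> \<not> cross (q u) (q w) (q x) (q y)"
  shows "chirotope_free q E"
  unfolding chirotope_free_def using assms by blast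

lemma chirotope_freeD:
  "chirotope_free q E \<Longrightarrow> (u, w) \<in> E \<Longrightarrow> (x, y) \<in> E \<Longrightarrow> distinct [u, w, x, y] \<Longrightarrow> \<not> cross (q u) (q w) (q x) (q y)"
  unfolding chirotope_free_def by blast

text \<open>If a face separates \<open>v\<close> from \<open>a\<close> and \<open>a\<close> is not
  one of its vertices, the segment between them crosses a side of the face, which is an edge already
  drawn.\<close>

lemma visible_face_vertices:
  assumes b: "build h" and gen: "generic q N" and N: "length h + 3 < N" and v: "v = length h + 3"
    and G: "G \<in> faces h" and a: "a < v" "in_face q G v \<noteq> in_face q G a"
    and free: "\<And>u w. (u, w) \<in> arcs_of h \<Longrightarrow> distinct [v, a, u, w] \<Longrightarrow> \<not> cross (q v) (q a) (q u) (q w)"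
  shows "a \<in> fverts G"
proof (rule ccontr)
  assume na: "a \<notin> fverts G"
  obtain x y z where Gx: "G = (x, y, z)" by (cases G) auto
  have xyz: "x \<noteq> y" "y \<noteq> z" "z \<noteq> x" "x < v" "y < v" "z < v"
    using build_face_verts[OF b, of x y z] G Gx by (auto simp: v)
  have ax: "a \<noteq> x" "a \<noteq> y" "a \<noteq> z" "a \<noteq> v" using na a(1) by (auto simp: Gx)
  have arcs: "(x, y) \<in> arcs_of h" "(y, z) \<in> arcs_of h" "(z, x) \<in> arcs_of h"
    using build_face_arcs[OF b G] xyz by (auto simp: Gx)
  have nc: "\<not> cross (q v) (q a) (q x) (q y)" "\<not> cross (q v) (q a) (q y) (q z)" "\<not> cross (q v) (q a) (q z) (q x)"
    by (rule free[OF arcs(1)], use xyz ax a(1) in force, rule free[OF arcs(2)], use xyz ax a(1) in force,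
        rule free[OF arcs(3)], use xyz ax a(1) in force)
  show False
  proof (cases "in_face q G v")
    case True
    then have "cross (q v) (q a) (q x) (q y) \<or> cross (q v) (q a) (q y) (q z) \<or> cross (q v) (q a) (q z) (q x)"
      using a(2) xyz ax a(1) N v by (intro inside_exit_cross genericD[OF gen]) (auto simp: Gx)
    then show False using nc by blast
  next
    case False
    then have "cross (q a) (q v) (q x) (q y) \<or> cross (q a) (q v) (q y) (q z) \<or> cross (q a) (q v) (q z) (q x)"
      using a(2) xyz ax a(1) N v by (intro inside_exit_cross genericD[OF gen]) (auto simp: Gx)
    then show False using nc by (simp add: cross_swap)
  qed
qed

text \<open>The inner face around \<open>v\<close> has no old vertex in its interior, so all
  vertices of \<open>F\<close>, being joined to \<open>v\<close>, belong to it. If \<open>v\<close>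
  is outside, the outer triangle takes this role, since it contains all old vertices except its own.
  Equal vertex sets then force equal faces.\<close>

lemma forced_face:
  assumes b: "build h" "h \<noteq> []" and g: "good q h c Z" and gen: "generic q N" and N: "length h + 3 < N"
    and F: "F \<in> faces h" and free: "chirotope_free q (arcs_of (F # h))"
  shows "if in_face q Z (length h + 3) then F \<noteq> Z \<and> in_face q F (length h + 3) else F = Z"
proof -
  define v where "v = length h + 3"
  have g': "Z \<in> faces h" "\<And>u. u < v \<Longrightarrow> u \<notin> fverts Z \<Longrightarrow> in_face q Z u"
    "\<And>F u. F \<in> faces h - {Z} \<Longrightarrow> u < v \<Longrightarrow> \<not> in_face q F u"
    using g by (auto simp: good_def v_def)
  have inj: "inj_on fverts (faces h)" by (rule build_fverts_inj[OF b])
  have sub: "fverts F = fverts G" if "G \<in> faces h" and "\<And>a. a \<in> fverts F \<Longrightarrow> a \<in> fverts G" for G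
  proof -
    have c3: "card (fverts G) = 3 \<and> finite (fverts G)" if "G \<in> faces h" for G
      using that build_face_verts[OF b(1), of "fst G" "fst (snd G)" "snd (snd G)"] by (cases G) simp
    show ?thesis using c3[OF F] c3[OF that(1)] that(2) by (intro card_subset_eq) auto
  qed
  have lt: "a < v" if "a \<in> fverts F" for a
    using that F build_face_verts[OF b(1), of "fst F" "fst (snd F)" "snd (snd F)"]
    by (cases F) (auto simp: v_def)
  have vis: "\<not> cross (q v) (q a) (q u) (q w)"
    if "a \<in> fverts F" "(u, w) \<in> arcs_of h" "distinct [v, a, u, w]" for a u w
    using that by (intro chirotope_freeD[OF free]) (auto simp: v_def)
  show ?thesis
  proof (cases "in_face q Z v")
    case True
    then obtain G where G: "G \<in> faces h - {Z}" "in_face q G v"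
      using good_inside_iff(1)[OF b(1) g gen, of v] N by (auto simp: v_def)
    have "a \<in> fverts G" if "a \<in> fverts F" for a
      using G g'(3)[OF G(1) lt[OF that]] vis[OF that] lt[OF that] N
      by (intro visible_face_vertices[OF b(1) gen N v_def]) auto
    then have "F = G" using sub[of G] G(1) F inj by (auto dest: inj_onD)
    then show ?thesis using G True by (simp add: v_def)
  next
    case False
    have "a \<in> fverts Z" if "a \<in> fverts F" for a
    proof (rule ccontr)
      assume "a \<notin> fverts Z"
      then have "in_face q Z a" using g'(2)[OF lt[OF that]] by blast
      then have "a \<in> fverts Z" using False vis[OF that] lt[OF that] g'(1)
        by (intro visible_face_vertices[OF b(1) gen N v_def]) auto
      then show False using \<open>a \<notin> fverts Z\<close> by blast
    qed
    then have "F = Z" using sub[of Z] g'(1) F inj by (auto dest: inj_onD)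
    then show ?thesis using False by (simp add: v_def)
  qed
qed

text \<open>The dichotomy is a hypothesis because \<open>forced_face\<close> does not cover the
  empty history, whose two faces share their vertices; there \<open>good_base\<close> provides
  it.\<close>

lemma good_step:
  assumes b: "build h" and g: "good q h c Z" and gen: "generic q N" and N: "length h + 3 < N"
    and F: "F \<in> faces h" and free: "chirotope_free q (arcs_of (F # h))"
    and dich: "if in_face q Z (length h + 3) then F \<noteq> Z \<and> in_face q F (length h + 3) else F = Z"
  shows "\<exists>Z'. good q (F # h) c Z'"
proof (cases "in_face q Z (length h + 3)")
  case True
  then have "F \<noteq> Z" "in_face q F (length h + 3)" using dich by simp_all
  then have "good q (F # h) c Z" by (rule good_inner[OF b g gen N F])
  then show ?thesis by blast
next
  case False
  define v where "v = length h + 3"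
  have FO: "F = Z" using dich False by simp
  obtain x y z where Oxyz: "Z = (x, y, z)" by (cases Z) auto
  have xyz: "x \<noteq> y" "y \<noteq> z" "z \<noteq> x" "x < v" "y < v" "z < v"
    using build_face_verts[OF b, of x y z] F FO Oxyz by (auto simp: v_def)
  have arcs: "(x, y) \<in> arcs_of h" "(y, z) \<in> arcs_of h" "(z, x) \<in> arcs_of h"
    using build_face_arcs[OF b F] xyz by (auto simp: FO Oxyz)
  have vis: "\<not> cross (q v) (q a) (q u) (q w)"
    if "a \<in> fverts Z" "(u, w) \<in> arcs_of h" "distinct [v, a, u, w]" for a u w
    using that by (intro chirotope_freeD[OF free]) (auto simp: v_def FO)
  have nc: "\<not> cross (q v) (q x) (q y) (q z)" "\<not> cross (q v) (q y) (q z) (q x)" "\<not> cross (q v) (q z) (q x) (q y)"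
    by (rule vis[OF _ arcs(2)], use xyz in \<open>force simp: Oxyz\<close>, use xyz in force,
        rule vis[OF _ arcs(3)], use xyz in \<open>force simp: Oxyz\<close>, use xyz in force,
        rule vis[OF _ arcs(1)], use xyz in \<open>force simp: Oxyz\<close>, use xyz in force)
  have nz: "orient (q x) (q y) (q z) \<noteq> 0" "orient (q x) (q y) (q v) \<noteq> 0" "orient (q y) (q z) (q v) \<noteq> 0"
      "orient (q z) (q x) (q v) \<noteq> 0"
    by (rule genericD[OF gen]; use xyz N in \<open>simp add: v_def\<close>)+
  have ni: "\<not> in_triangle (q x) (q y) (q z) (q v)" using False by (simp add: Oxyz v_def)
  have s: "sgn (orient (q x) (q y) (q z)) = - c" using g by (simp add: good_def Oxyz)
  have "(sgn (orient (q x) (q y) (q v)), sgn (orient (q y) (q z) (q v)), sgn (orient (q z) (q x) (q v)))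
      \<in> {(- c, c, c), (c, - c, c), (c, c, - c)}"
    using outside_visible_signs[OF nz ni nc] by (simp add: s)
  then consider
      "sgn (orient (q z) (q x) (q v)) = c" "sgn (orient (q x) (q y) (q v)) = - c" "sgn (orient (q y) (q z) (q v)) = c"
    | "sgn (orient (q x) (q y) (q v)) = c" "sgn (orient (q y) (q z) (q v)) = - c" "sgn (orient (q z) (q x) (q v)) = c"
    | "sgn (orient (q y) (q z) (q v)) = c" "sgn (orient (q z) (q x) (q v)) = - c" "sgn (orient (q x) (q y) (q v)) = c"
    by auto
  then show ?thesis
  proof cases
    case 1
    have "good q (Z # h) c (x, y, v)" by (rule good_outer[OF b g gen N v_def _ 1]) (simp add: Oxyz)
    then show ?thesis unfolding FO by blast
  next
    case 2
    have "good q (Z # h) c (y, z, v)" by (rule good_outer[OF b g gen N v_def _ 2]) (simp add: Oxyz)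
    then show ?thesis unfolding FO by blast
  next
    case 3
    have "good q (Z # h) c (z, x, v)" by (rule good_outer[OF b g gen N v_def _ 3]) (simp add: Oxyz)
    then show ?thesis unfolding FO by blast
  qed
qed

text \<open>The first stacking step is fixed, because on three vertices both faces lead to the same
  graph.\<close>

fun histories :: "nat \<Rightarrow> face list set" where
  "histories 0 = {[(0, 1, 2)]}"
| "histories (Suc m) = (\<lambda>(h, F). F # h) ` (SIGMA h:histories m. faces h)"

lemma histories_build: "h \<in> histories m \<Longrightarrow> build h \<and> length h = Suc m"
proof (induction m arbitrary: h)
  case 0
  then show ?case using build_Cons[OF build_Nil, of "(0, 1, 2)"] by simp
next
  case (Suc m)
  then show ?case by (auto intro: build_Cons)
qed

lemma card_histories: "finite (histories m) \<and> card (histories m) = (\<Prod>j<m. 2 * j + 4)"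
proof (induction m)
  case (Suc m)
  have fin: "finite (faces h)" "card (faces h) = 2 * m + 4" if "h \<in> histories m" for h
    using histories_build[OF that] build_finite[of h] build_card_faces[of h] by auto
  have "inj_on (\<lambda>(h, F). F # h) (SIGMA h:histories m. faces h)" by (auto simp: inj_on_def)
  then have "card (histories (Suc m)) = card (SIGMA h:histories m. faces h)" by (simp add: card_image)
  also have "\<dots> = (\<Sum>h\<in>histories m. card (faces h))"
    using Suc.IH fin(1) by (intro card_SigmaI) auto
  also have "\<dots> = card (histories m) * (2 * m + 4)" using fin(2) by simp
  finally show ?case using Suc.IH fin(1) by (auto intro!: finite_SigmaI)
qed simp

lemma inside_flip: "in_triangle a c b x \<longleftrightarrow> in_triangle a b c x"
proof -
  have "orient a c b = - orient a b c" "orient a c x = - orient c a x" "orient c b x = - orient b c x"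
    "orient b a x = - orient a b x"
    by (simp_all add: orient_def algebra_simps)
  then show ?thesis unfolding in_triangle_def by auto
qed

lemma good_Nil:
  assumes nz: "orient (q 0) (q 1) (q 2) \<noteq> 0"
  defines "s \<equiv> sgn (orient (q 0) (q 1) (q 2))"
  shows "good q [] s (0, 2, 1)" "good q [] (- s) (0, 1, 2)"
proof -
  have flip: "orient (q 0) (q 2) (q 1) = - orient (q 0) (q 1) (q 2)" by (simp add: orient_def algebra_simps)
  have s: "s = 1 \<or> s = -1" using nz by (auto simp: s_def sgn_if)
  have three: "u \<in> fverts Z" if "Z \<in> faces []" "u < 3" for Z u
  proof -
    have "u = 0 \<or> u = 1 \<or> u = 2" using that(2) by auto
    then show ?thesis using that(1) by auto
  qed
  have vs: "\<not> in_face q F u" if "F \<in> faces []" "u < 3" for F u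
    by (rule not_in_face_vertex[OF three[OF that]])
  show "good q [] s (0, 2, 1)" "good q [] (- s) (0, 1, 2)"
    unfolding good_def using s vs three by (auto simp: s_def flip flip[unfolded One_nat_def] sgn_minus)
qed

text \<open>Either side of the initial triangle may serve as outer face. As every history starts by
  stacking into \<open>(0, 1, 2)\<close>, the choice is made to fit: this face is inner if point 3
  lies inside the triangle and outer otherwise.\<close>

lemma good_base:
  assumes gen: "generic q N" and N: "3 < N"
  shows "\<exists>c Z. good q [] c Z \<and> (if in_face q Z 3 then (0, 1, 2) \<noteq> Z \<and> in_face q (0, 1, 2) 3 else (0, 1, 2) = Z)"
proof -
  define s where "s = sgn (orient (q 0) (q 1) (q 2))"
  have nz: "orient (q 0) (q 1) (q 2) \<noteq> 0" using N by (intro genericD[OF gen]) auto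
  note g = good_Nil[OF nz, folded s_def]
  show ?thesis
  proof (cases "in_face q (0, 1, 2) 3")
    case True
    moreover have "in_face q (0, 2, 1) 3" using True by (simp add: inside_flip[of "q 0" "q 2"])
    ultimately show ?thesis using g(1)
      by (intro exI[of _ s] exI[of _ "(0, 2, 1)"]) auto
  next
    case False
    then show ?thesis using g(2) by (intro exI[of _ "- s"] exI[of _ "(0, 1, 2)"]) simp
  qed
qed

lemma chirotope_free_subset: "chirotope_free q E \<Longrightarrow> E' \<subseteq> E \<Longrightarrow> chirotope_free q E'"
  unfolding chirotope_free_def by blast

text \<open>The outer face is carried through the induction, since the next step is forced only
  relative to it.\<close>

lemma history_unique_aux:
  assumes "h \<in> histories m" "h' \<in> histories m" "generic q (m + 4)"
    "chirotope_free q (arcs_of h)" "chirotope_free q (arcs_of h')"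
  shows "h = h' \<and> (\<exists>c Z. good q h c Z)"
  using assms
proof (induction m arbitrary: h h')
  case 0
  have h: "h = [(0, 1, 2)]" "h' = [(0, 1, 2)]" using 0 by simp_all
  obtain c Z where g: "good q [] c Z"
    and d: "if in_face q Z 3 then (0, 1, 2) \<noteq> Z \<and> in_face q (0, 1, 2) 3 else (0, 1, 2) = Z"
    using good_base[OF 0(3)] by auto
  have "\<exists>Z'. good q [(0, 1, 2)] c Z'"
  proof (rule good_step[OF build_Nil g 0(3)])
    show "chirotope_free q (arcs_of [(0, 1, 2)])" using 0(4) by (simp only: h)
    show "if in_face q Z (length ([] :: face list) + 3) then (0, 1, 2) \<noteq> Z \<and> in_face q (0, 1, 2) (length ([] :: face list) + 3)
        else (0, 1, 2) = Z" using d by (simp only: list.size add_0)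
  qed simp_all
  then show ?case using h by blast
next
  case (Suc m)
  obtain h0 F h1 G where h: "h = F # h0" "h0 \<in> histories m" "F \<in> faces h0"
    and h': "h' = G # h1" "h1 \<in> histories m" "G \<in> faces h1"
    using Suc.prems(1,2) by auto
  have gen: "generic q (m + 4)" using Suc.prems(3) by (rule generic_mono) simp
  have "h0 = h1 \<and> (\<exists>c Z. good q h0 c Z)"
  proof (rule Suc.IH[OF h(2) h'(2) gen])
    show "chirotope_free q (arcs_of h0)" by (rule chirotope_free_subset[OF Suc.prems(4)]) (auto simp: h(1))
    show "chirotope_free q (arcs_of h1)" by (rule chirotope_free_subset[OF Suc.prems(5)]) (auto simp: h'(1))
  qed
  then obtain c Z where e: "h1 = h0" and g: "good q h0 c Z" by blast
  have b: "build h0" "h0 \<noteq> []" and len: "length h0 + 3 = m + 4" using histories_build[OF h(2)] by auto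
  have N: "length h0 + 3 < Suc m + 4" using len by simp
  have dF: "if in_face q Z (length h0 + 3) then F \<noteq> Z \<and> in_face q F (length h0 + 3) else F = Z"
    by (rule forced_face[OF b g Suc.prems(3) N h(3)]) (use Suc.prems(4) h in simp)
  have dG: "if in_face q Z (length h0 + 3) then G \<noteq> Z \<and> in_face q G (length h0 + 3) else G = Z"
    by (rule forced_face[OF b g Suc.prems(3) N]) (use Suc.prems(5) h' e in simp_all)
  have "F = G"
  proof (cases "in_face q Z (length h0 + 3)")
    case True
    then show ?thesis using dF dG h(3) h'(3) e
      by (intro good_inside_iff(2)[OF b(1) g Suc.prems(3) _ N]) auto
  qed (use dF dG in simp)
  moreover have "\<exists>Z'. good q (F # h0) c Z'"
    by (rule good_step[OF b(1) g Suc.prems(3) N h(3) _ dF]) (use Suc.prems(4) h in simp)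
  ultimately show ?case using h h' e by blast
qed

lemma history_unique:
  assumes "h \<in> histories m" "h' \<in> histories m" "generic q (m + 4)"
    "chirotope_free q (arcs_of h)" "chirotope_free q (arcs_of h')"
  shows "h = h'"
  using history_unique_aux[OF assms] by blast

section \<open>Straight-line drawings\<close>

lemma orient_affine: "orient a b ((1 - t) *\<^sub>R p + t *\<^sub>R r) = (1 - t) * orient a b p + t * orient a b r"
  by (simp add: orient_def algebra_simps)

lemma orient_closed_segment: "p \<in> closed_segment a b \<Longrightarrow> orient a b p = 0"
  by (auto simp: in_segment orient_affine)

text \<open>Cramer's rule for barycentric coordinates, kept free of division.\<close>

lemma orient_barycentric:
  "orient a b c *\<^sub>R p = orient b c p *\<^sub>R a + orient c a p *\<^sub>R b + orient a b p *\<^sub>R c"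
  by (simp add: vec_eq_iff forall_2 orient_def algebra_simps)

lemma finite_quadratic_zeros:
  fixes A B C :: real
  assumes "B \<noteq> 0 \<or> C \<noteq> 0"
  shows "finite {t. A + B * t + C * t\<^sup>2 = 0}"
proof -
  have "[:A, B, C:] \<noteq> 0" using assms by auto
  then have "finite {t. poly [:A, B, C:] t = 0}" by (rule poly_roots_finite)
  then show ?thesis by (simp add: algebra_simps power2_eq_square)
qed

text \<open>A parabola through a point of \<open>U\<close> meets every line in at most two points,
  so finitely many lines exclude only finitely many of its parameters.\<close>

lemma generic_point_exists:
  fixes U :: "(real^2) set"
  assumes U: "open U" "U \<noteq> {}" and L: "finite L" "\<And>a b. (a, b) \<in> L \<Longrightarrow> a \<noteq> b"
  shows "\<exists>p\<in>U. \<forall>(a, b)\<in>L. orient a b p \<noteq> 0"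
proof -
  obtain p0 where p0: "p0 \<in> U" using U(2) by blast
  define \<gamma> :: "real \<Rightarrow> real^2" where "\<gamma> t = p0 + t *\<^sub>R axis 1 1 + t\<^sup>2 *\<^sub>R axis 2 1" for t
  have "continuous_on UNIV \<gamma>" unfolding \<gamma>_def by (intro continuous_intros)
  then have "open (\<gamma> -` U)" using U(1) by (simp add: open_vimage)
  moreover have "0 \<in> \<gamma> -` U" using p0 by (simp add: \<gamma>_def)
  ultimately have "infinite (\<gamma> -` U)" using finite_imp_not_open by blast
  moreover have "finite {t. orient a b (\<gamma> t) = 0}" if "(a, b) \<in> L" for a b
  proof -
    have "a $ 1 \<noteq> b $ 1 \<or> a $ 2 \<noteq> b $ 2" using L(2)[OF that] by (auto simp: vec_eq_iff forall_2)
    then have "finite {t. orient a b p0 + - (b$2 - a$2) * t + (b$1 - a$1) * t\<^sup>2 = 0}"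
      by (intro finite_quadratic_zeros) auto
    moreover have "orient a b (\<gamma> t) = orient a b p0 + - (b$2 - a$2) * t + (b$1 - a$1) * t\<^sup>2" for t
      by (simp add: \<gamma>_def orient_def axis_def algebra_simps)
    ultimately show ?thesis by simp
  qed
  then have "finite (\<Union>(a, b)\<in>L. {t. orient a b (\<gamma> t) = 0})" using L(1) by auto
  ultimately obtain t where "t \<in> \<gamma> -` U" "t \<notin> (\<Union>(a, b)\<in>L. {t. orient a b (\<gamma> t) = 0})"
    by (meson finite_subset subsetI)
  then show ?thesis by (intro bexI[of _ "\<gamma> t"]) auto
qed

lemma continuous_on_orient [continuous_intros]:
  "continuous_on S f \<Longrightarrow> continuous_on S g \<Longrightarrow> continuous_on S h \<Longrightarrow>
    continuous_on S (\<lambda>x. orient (f x) (g x) (h x))"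
  unfolding orient_def by (intro continuous_intros)

definition segment_free :: "(nat \<Rightarrow> real^2) \<Rightarrow> (nat \<times> nat) set \<Rightarrow> bool" where
  "segment_free q E \<longleftrightarrow> (\<forall>(u, w)\<in>E. \<forall>(x, y)\<in>E. distinct [u, w, x, y] \<longrightarrow>
     closed_segment (q u) (q w) \<inter> closed_segment (q x) (q y) = {})"

lemma segment_freeI:
  assumes "\<And>u w x y. (u, w) \<in> E \<Longrightarrow> (x, y) \<in> E \<Longrightarrow> distinct [u, w, x, y] \<Longrightarrow>
    closed_segment (q u) (q w) \<inter> closed_segment (q x) (q y) = {}"
  shows "segment_free q E"
  unfolding segment_free_def using assms by blast

lemma segment_freeD:
  "segment_free q E \<Longrightarrow> (u, w) \<in> E \<Longrightarrow> (x, y) \<in> E \<Longrightarrow> distinct [u, w, x, y] \<Longrightarrow>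
    closed_segment (q u) (q w) \<inter> closed_segment (q x) (q y) = {}"
  unfolding segment_free_def by blast

section \<open>Straight-line drawings of all stacked triangulations, which give their
  planarity\<close>

lemma good_cong:
  assumes b: "build h" and e: "\<And>u. u < length h + 3 \<Longrightarrow> q u = q' u" and g: "good q h c Z"
  shows "good q' h c Z"
proof -
  have f: "face_orient q' F = face_orient q F" "u < length h + 3 \<Longrightarrow> in_face q' F u = in_face q F u"
    if "F \<in> faces h" for F u
  proof -
    obtain x y z where F: "F = (x, y, z)" by (cases F) auto
    have "q x = q' x" "q y = q' y" "q z = q' z"
      using build_face_verts[OF b, of x y z] that e by (auto simp: F)
    then show "face_orient q' F = face_orient q F" "u < length h + 3 \<Longrightarrow> in_face q' F u = in_face q F u"
      using e by (simp_all add: F)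
  qed
  have "Z \<in> faces h" using g by (simp add: good_def)
  then show ?thesis using g by (simp add: good_def f)
qed

lemma generic_inj:
  assumes gen: "generic q n" and n: "3 \<le> n" and ab: "a < n" "b < n" "a \<noteq> b"
  shows "q a \<noteq> q b"
proof
  assume e: "q a = q b"
  have "card {a, b} < card {..<n}" using ab n by simp
  then have "\<not> {..<n} \<subseteq> {a, b}" using card_mono[of "{a, b}" "{..<n}"] by auto
  then obtain d where "d < n" "d \<noteq> a" "d \<noteq> b" by auto
  then have "orient (q a) (q b) (q d) \<noteq> 0" using ab by (intro genericD[OF gen]) auto
  then show False by (simp add: e)
qed

lemma generic_insert:
  assumes "generic q v" "\<And>a b. a < v \<Longrightarrow> b < v \<Longrightarrow> a \<noteq> b \<Longrightarrow> orient (q a) (q b) p \<noteq> 0"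
  shows "generic (q(v := p)) (Suc v)"
  unfolding generic_def
proof (intro allI impI)
  fix a b c assume l: "a < Suc v" "b < Suc v" "c < Suc v" and d: "a \<noteq> b" "b \<noteq> c" "c \<noteq> a"
  consider "a < v" "b < v" "c < v" | "a = v" "b < v" "c < v" | "b = v" "a < v" "c < v" | "c = v" "a < v" "b < v"
    using l d by linarith
  then show "orient ((q(v := p)) a) ((q(v := p)) b) ((q(v := p)) c) \<noteq> 0"
  proof cases
    case 1
    then show ?thesis using genericD[OF assms(1)] d by auto
  next
    case 2
    then show ?thesis using assms(2)[of b c] d by (auto simp: orient_rotate[of p "q b" "q c"])
  next
    case 3
    moreover have "orient (q a) p (q c) = orient (q c) (q a) p" by (simp add: orient_def algebra_simps)
    ultimately show ?thesis using assms(2)[of c a] d by auto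
  next
    case 4
    then show ?thesis using assms(2)[of a b] d by auto
  qed
qed

text \<open>The least of the three signed orientations is positive at \<open>r\<close> and not
  positive at \<open>y\<close>, so it vanishes in between; there the other two are nonnegative, and
  the point is on a side. \<open>r\<close> will be an arbitrary point of an edge, so no general
  position is available for it.\<close>

lemma triangle_exit:
  fixes a b c r y :: "real^2"
  defines "s \<equiv> sgn (orient a b c)"
  assumes nz: "orient a b c \<noteq> 0"
    and r: "s * orient a b r > 0" "s * orient b c r > 0" "s * orient c a r > 0"
    and y: "\<not> in_triangle a b c y"
  obtains \<tau> e f where "0 \<le> \<tau>" "\<tau> \<le> 1" "(e, f) \<in> {(a, b), (b, c), (c, a)}"
    "(1 - \<tau>) *\<^sub>R r + \<tau> *\<^sub>R y \<in> closed_segment e f"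
proof -
  define p where "p \<tau> = (1 - \<tau>) *\<^sub>R r + \<tau> *\<^sub>R y" for \<tau>
  define m where "m \<tau> = min (s * orient a b (p \<tau>)) (min (s * orient b c (p \<tau>)) (s * orient c a (p \<tau>)))" for \<tau>
  have cont: "continuous_on {0..1} m" unfolding m_def p_def by (intro continuous_intros)
  have m0: "m 0 \<ge> 0" using r by (simp add: m_def p_def)
  have so: "s * t > 0 \<longleftrightarrow> t * orient a b c > 0" for t
    using nz by (auto simp: s_def sgn_if zero_less_mult_iff)
  have m1: "m 1 \<le> 0"
    using y unfolding in_triangle_def so[symmetric] m_def p_def by (auto simp: not_less min_le_iff_disj)
  obtain \<tau> where \<tau>: "0 \<le> \<tau>" "\<tau> \<le> 1" "m \<tau> = 0"
    using IVT2'[of m 1 0 0] m0 m1 cont by auto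
  have ge: "s * orient a b (p \<tau>) \<ge> 0" "s * orient b c (p \<tau>) \<ge> 0" "s * orient c a (p \<tau>) \<ge> 0"
    and zero: "orient a b (p \<tau>) = 0 \<or> orient b c (p \<tau>) = 0 \<or> orient c a (p \<tau>) = 0"
    using \<tau>(3) nz unfolding m_def by (auto simp: min_def s_def sgn_if split: if_splits)
  have seg: "w \<in> closed_segment e f"
    if "orient e f w = 0" "s * orient f g w \<ge> 0" "s * orient g e w \<ge> 0" "orient e f g = orient a b c" for w e f g
  proof -
    define D where "D = s * orient a b c"
    have D: "D > 0" using nz by (auto simp: D_def s_def sgn_if)
    have sum: "s * orient f g w + s * orient g e w = D"
      using orient_split[of e f g w] that by (simp add: D_def algebra_simps)
    have "D *\<^sub>R w = s *\<^sub>R (orient e f g *\<^sub>R w)" using that(4) by (simp add: D_def)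
    also have "\<dots> = (s * orient f g w) *\<^sub>R e + (s * orient g e w) *\<^sub>R f"
      unfolding orient_barycentric[of e f g w] using that(1) by (simp add: scaleR_right_distrib)
    finally have "(1 / D) *\<^sub>R (D *\<^sub>R w) = (1 / D) *\<^sub>R ((s * orient f g w) *\<^sub>R e + (s * orient g e w) *\<^sub>R f)" by simp
    then have w: "w = (s * orient f g w / D) *\<^sub>R e + (s * orient g e w / D) *\<^sub>R f"
      using D by (simp add: scaleR_right_distrib)
    have e1: "1 - s * orient g e w / D = s * orient f g w / D" using sum D by (simp add: field_simps)
    have "s * orient g e w / D \<le> 1" using sum D that(2) by simp
    moreover have "0 \<le> s * orient g e w / D" using that(3) D by simp
    moreover have "w = (1 - s * orient g e w / D) *\<^sub>R e + (s * orient g e w / D) *\<^sub>R f"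
      unfolding e1 by (rule w)
    ultimately show ?thesis unfolding in_segment by blast
  qed
  have rot: "orient b c a = orient a b c" "orient c a b = orient a b c"
    by (simp_all add: orient_def algebra_simps)
  from zero consider "orient a b (p \<tau>) = 0" | "orient b c (p \<tau>) = 0" | "orient c a (p \<tau>) = 0" by blast
  then show ?thesis
  proof cases
    case 1
    show ?thesis by (rule that[OF \<tau>(1,2), of a b]) (use seg[OF 1 ge(2,3)] in \<open>auto simp: p_def\<close>)
  next
    case 2
    show ?thesis by (rule that[OF \<tau>(1,2), of b c]) (use seg[OF 2 ge(3,1)] rot in \<open>auto simp: p_def\<close>)
  next
    case 3
    show ?thesis by (rule that[OF \<tau>(1,2), of c a]) (use seg[OF 3 ge(1,2)] rot in \<open>auto simp: p_def\<close>)
  qed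
qed

text \<open>An edge through an interior point \<open>r\<close> of an inner face has both ends among
  the vertices of the face, since on the way to any other end it would meet a side that it must not
  meet. Hence it is a side itself, on which one orientation vanishes.\<close>

lemma no_edge_inside_face:
  assumes b: "build h" and g: "good q h c Z" and gen: "generic q (length h + 3)"
    and free: "segment_free q (arcs_of h)" and F: "F \<in> faces h - {Z}" and xy: "(x, y) \<in> arcs_of h"
    and Fabc: "F = (i, j, k)" and r: "r \<in> closed_segment (q x) (q y)"
  shows "\<not> (c * orient (q i) (q j) r > 0 \<and> c * orient (q j) (q k) r > 0 \<and> c * orient (q k) (q i) r > 0)"
proof
  assume pos: "c * orient (q i) (q j) r > 0 \<and> c * orient (q j) (q k) r > 0 \<and> c * orient (q k) (q i) r > 0"
  define v where "v = length h + 3"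
  have xyv: "x \<noteq> y" "x < v" "y < v" "(y, x) \<in> arcs_of h" using build_arcs[OF b xy] by (auto simp: v_def)
  have ijk: "i \<noteq> j" "j \<noteq> k" "k \<noteq> i" "i < v" "j < v" "k < v"
    using build_face_verts[OF b, of i j k] F Fabc by (auto simp: v_def)
  have "\<forall>F\<in>faces h - {Z}. sgn (face_orient q F) = c" using g by (simp add: good_def)
  from bspec[OF this F] have s: "sgn (orient (q i) (q j) (q k)) = c" by (simp add: Fabc)
  have c1: "c = 1 \<or> c = -1" using g by (simp add: good_def)
  have nz: "orient (q i) (q j) (q k) \<noteq> 0" using ijk by (intro genericD[OF gen]) (auto simp: v_def)
  have edge_arc: "(e, f) \<in> arcs_of h" if "(e, f) \<in> {(i, j), (j, k), (k, i)}" for e f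
    using that ijk F by (intro build_face_arcs[OF b, of F]) (auto simp: Fabc)
  have edge_pos: "c * orient (q e) (q f) r > 0" if "(e, f) \<in> {(i, j), (j, k), (k, i)}" for e f
    using that pos by auto
  have inF: "y \<in> fverts F" if arc: "(x, y) \<in> arcs_of h" and seg: "r \<in> closed_segment (q x) (q y)"
    and v: "x \<noteq> y" "x < v" "y < v" for x y
  proof (rule ccontr)
    assume y: "y \<notin> fverts F"
    have "\<not> in_face q F y" using g F v by (auto simp: good_def v_def)
    then have "\<not> in_triangle (q i) (q j) (q k) (q y)" by (simp add: Fabc)
    then obtain \<tau> e' f' where t: "0 \<le> \<tau>" "\<tau> \<le> 1"
      and ef': "(e', f') \<in> {(q i, q j), (q j, q k), (q k, q i)}"
      and mem': "(1 - \<tau>) *\<^sub>R r + \<tau> *\<^sub>R q y \<in> closed_segment e' f'"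
      using triangle_exit[OF nz, of r "q y"] pos s by metis
    then obtain e f where ef: "(e, f) \<in> {(i, j), (j, k), (k, i)}" "e' = q e" "f' = q f" by auto
    define r' where "r' = (1 - \<tau>) *\<^sub>R r + \<tau> *\<^sub>R q y"
    have mem: "r' \<in> closed_segment (q e) (q f)" using mem' ef by (simp add: r'_def)
    have "r' \<in> closed_segment (q x) (q y)"
      unfolding r'_def using seg t convex_closed_segment[of "q x" "q y"] unfolding convex_alt by auto
    then have "\<not> distinct [x, y, e, f]"
      using segment_freeD[OF free arc edge_arc[OF ef(1)]] mem by blast
    moreover have "y \<noteq> e" "y \<noteq> f" "e \<noteq> f" using y ef ijk by (auto simp: Fabc)
    \<comment> \<open>The only remaining possibility is a side incident with \<open>x\<close>. The
      orientation relative to it vanishes at \<open>x\<close> and is positive at \<open>r\<close>,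
      hence positive on the rest of the way to \<open>y\<close>, against the exit point
      \<open>r'\<close> on that side.\<close>
    ultimately have xef: "x = e \<or> x = f" using v by auto
    have Lx: "orient (q e) (q f) (q x) = 0" using xef by auto
    obtain \<beta> where \<beta>: "0 \<le> \<beta>" "\<beta> \<le> 1" "r = (1 - \<beta>) *\<^sub>R q x + \<beta> *\<^sub>R q y" using seg by (auto simp: in_segment)
    have "orient (q e) (q f) r = \<beta> * orient (q e) (q f) (q y)"
      unfolding \<beta>(3) orient_affine by (simp add: Lx)
    then have "\<beta> * (c * orient (q e) (q f) (q y)) > 0" using edge_pos[OF ef(1)] by (simp add: mult.left_commute)
    then have Ly: "c * orient (q e) (q f) (q y) > 0" using \<beta>(1) by (simp add: zero_less_mult_iff)
    have "c * orient (q e) (q f) r' = (1 - \<tau>) * (c * orient (q e) (q f) r) + \<tau> * (c * orient (q e) (q f) (q y))"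
      unfolding r'_def orient_affine by (simp add: algebra_simps)
    moreover have "c * orient (q e) (q f) r' = 0" using orient_closed_segment[OF mem] by simp
    moreover have "(1 - \<tau>) * (c * orient (q e) (q f) r) \<ge> 0" "\<tau> * (c * orient (q e) (q f) (q y)) \<ge> 0"
      using t Ly edge_pos[OF ef(1)] by (auto intro!: mult_nonneg_nonneg)
    ultimately have "(1 - \<tau>) * (c * orient (q e) (q f) r) = 0" "\<tau> * (c * orient (q e) (q f) (q y)) = 0"
      by linarith+
    then show False using Ly edge_pos[OF ef(1)] by auto
  qed
  have "y \<in> fverts F" "x \<in> fverts F"
    using inF[OF xy r] inF[OF xyv(4)] r xyv by (auto simp: closed_segment_commute)
  then obtain e f where ef: "(e, f) \<in> {(i, j), (j, k), (k, i)}" "(x = e \<and> y = f) \<or> (x = f \<and> y = e)"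
    using xyv(1) by (auto simp: Fabc)
  then have "r \<in> closed_segment (q e) (q f)" using r by (auto simp: closed_segment_commute)
  then have "orient (q e) (q f) r = 0" by (rule orient_closed_segment)
  then show False using edge_pos[OF ef(1)] by simp
qed

lemma straight_drawing_step:
  assumes b: "build h" and F: "F \<in> faces h" and g: "good q h c Z" and gen: "generic q (length h + 3)"
    and free: "segment_free q (arcs_of h)"
  shows "\<exists>q' c' Z'. generic q' (length (F # h) + 3) \<and> segment_free q' (arcs_of (F # h)) \<and> good q' (F # h) c' Z'"
proof -
  define v where "v = length h + 3"
  obtain i j k where Fijk: "F = (i, j, k)" by (cases F) auto
  have ijk: "i \<noteq> j" "j \<noteq> k" "k \<noteq> i" "i < v" "j < v" "k < v"
    using build_face_verts[OF b, of i j k] F Fijk by (auto simp: v_def)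
  define D where "D = orient (q i) (q j) (q k)"
  have D: "D \<noteq> 0" using ijk unfolding D_def by (intro genericD[OF gen]) (auto simp: v_def)
  have rot: "orient (q j) (q k) (q i) = D" "orient (q k) (q i) (q j) = D"
    by (simp_all add: D_def orient_def algebra_simps)
  have c1: "c = 1 \<or> c = -1" using g by (simp add: good_def)
  let ?lines = "{(a, b) \<in> (q ` {..<v}) \<times> (q ` {..<v}). a \<noteq> b}"
  have finL: "finite ?lines" by (rule finite_subset[of _ "(q ` {..<v}) \<times> (q ` {..<v})"]) auto
  have qinj: "q a \<noteq> q b" if "a < v" "b < v" "a \<noteq> b" for a b
    by (rule generic_inj[OF gen]) (use that in \<open>simp_all add: v_def\<close>)
  have place: "\<exists>p\<in>U. generic (q(v := p)) (Suc v)" if U: "open U" "U \<noteq> {}" for U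
  proof -
    obtain p where p: "p \<in> U" "\<forall>(a, b)\<in>?lines. orient a b p \<noteq> 0"
      using generic_point_exists[OF U finL] by auto
    have "generic (q(v := p)) (Suc v)"
      using gen p(2) qinj by (intro generic_insert) (auto simp: v_def)
    then show ?thesis using p(1) by blast
  qed
  have len: "length (F # h) + 3 = Suc v" by (simp add: v_def)
  have goodp: "good (q(v := p)) h c Z" for p
    by (rule good_cong[OF b _ g]) (simp add: v_def)
  have not_vertex: "q l \<notin> closed_segment (q x) (q y)"
    if xy: "(x, y) \<in> arcs_of h" and l: "l < v" "l \<noteq> x" "l \<noteq> y" for x y l
  proof
    assume "q l \<in> closed_segment (q x) (q y)"
    then have "orient (q x) (q y) (q l) = 0" by (rule orient_closed_segment)
    moreover have "orient (q x) (q y) (q l) \<noteq> 0"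
      using build_arcs[OF b xy] l by (intro genericD[OF gen]) (auto simp: v_def)
    ultimately show False by blast
  qed
  have free_step: "segment_free (q(v := p)) (arcs_of (F # h))"
    if new: "\<And>l x y. l \<in> {i, j, k} \<Longrightarrow> (x, y) \<in> arcs_of h \<Longrightarrow> l \<noteq> x \<Longrightarrow> l \<noteq> y \<Longrightarrow>
      closed_segment p (q l) \<inter> closed_segment (q x) (q y) = {}" for p
  proof (rule segment_freeI)
    fix u w x y assume 1: "(u, w) \<in> arcs_of (F # h)" and 2: "(x, y) \<in> arcs_of (F # h)"
      and "distinct [u, w, x, y]"
    then have d: "u \<noteq> w" "u \<noteq> x" "u \<noteq> y" "w \<noteq> x" "w \<noteq> y" "x \<noteq> y" by auto
    let ?q = "q(v := p)"
    have old: "?q a = q a" if "(a, b') \<in> arcs_of h \<or> (b', a) \<in> arcs_of h" for a b'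
      using that build_arcs[OF b, of a b'] build_arcs[OF b, of b' a] by (auto simp: v_def)
    have lt: "?q l = q l" if "l \<in> {i, j, k}" for l using that ijk by auto
    have arc: "(a, b') \<in> arcs_of h \<or> (a = v \<and> b' \<in> {i, j, k}) \<or> (b' = v \<and> a \<in> {i, j, k})"
      if "(a, b') \<in> arcs_of (F # h)" for a b' using that by (auto simp: Fijk v_def)
    have mixed: "closed_segment (?q u) (?q w) \<inter> closed_segment (?q x) (?q y) = {}"
      if nw: "(u = v \<and> w \<in> {i, j, k}) \<or> (w = v \<and> u \<in> {i, j, k})" and od: "(x, y) \<in> arcs_of h"
        and d: "u \<noteq> x" "u \<noteq> y" "w \<noteq> x" "w \<noteq> y" for u w x y
    proof -
      obtain l where l: "l \<in> {i, j, k}" "l \<noteq> x" "l \<noteq> y"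
        and eq: "closed_segment (?q u) (?q w) = closed_segment p (q l)"
        using nw d lt by (elim disjE conjE) (metis closed_segment_commute fun_upd_same)+
      moreover have "?q x = q x" "?q y = q y" using old[of x y] old[of y x] od by blast+
      ultimately show ?thesis using new[OF l(1) od l(2,3)] by (simp only: eq)
    qed
    from arc[OF 1] arc[OF 2] d consider "(u, w) \<in> arcs_of h" "(x, y) \<in> arcs_of h"
      | "(u = v \<and> w \<in> {i, j, k}) \<or> (w = v \<and> u \<in> {i, j, k})" "(x, y) \<in> arcs_of h"
      | "(u, w) \<in> arcs_of h" "(x = v \<and> y \<in> {i, j, k}) \<or> (y = v \<and> x \<in> {i, j, k})"
      by blast
    then show "closed_segment (?q u) (?q w) \<inter> closed_segment (?q x) (?q y) = {}"
    proof cases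
      case 1
      then show ?thesis
        using segment_freeD[OF free 1] d old[of u w] old[of w u] old[of x y] old[of y x] by simp
    next
      case 2
      then show ?thesis using mixed[OF 2] d by blast
    next
      case 3
      then show ?thesis using mixed[OF 3(2,1)] d by blast
    qed
  qed
  show ?thesis
  proof (cases "F = Z")
    case False
    then have FZ: "F \<in> faces h - {Z}" using F by simp
    have "\<forall>F\<in>faces h - {Z}. sgn (face_orient q F) = c" using g by (simp add: good_def)
    from bspec[OF this FZ] have sD: "sgn D = c" by (simp add: Fijk D_def)
    have cD: "c * D > 0" using sD D by (auto simp: sgn_if split: if_splits)
    define U where "U = {p. c * orient (q i) (q j) p > 0} \<inter> {p. c * orient (q j) (q k) p > 0} \<inter>
      {p. c * orient (q k) (q i) p > 0}"
    have "open U" unfolding U_def by (intro open_Int open_Collect_less continuous_intros)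
    moreover have "U \<noteq> {}"
    proof -
      define p where "p = (1/3) *\<^sub>R (q i + q j + q k)"
      have e: "orient (q i) (q j) p = D / 3" "orient (q j) (q k) p = D / 3" "orient (q k) (q i) p = D / 3"
        by (simp_all add: D_def p_def orient_def field_simps)
      have "p \<in> U" using cD by (simp add: U_def e)
      then show ?thesis by blast
    qed
    ultimately obtain p where p: "p \<in> U" and gp: "generic (q(v := p)) (Suc v)" using place by blast
    have pU: "c * orient (q i) (q j) p > 0" "c * orient (q j) (q k) p > 0" "c * orient (q k) (q i) p > 0"
      using p by (simp_all add: U_def)
    have so: "t * D > 0" if "c * t > 0" for t
    proof -
      have "c * c = 1" using c1 by auto
      then have "t * D = (c * t) * (c * D)" by (simp add: mult.assoc mult.left_commute)
      then show ?thesis using that cD by (metis mult_pos_pos)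
    qed
    have "in_face (q(v := p)) F v"
      using so[OF pU(1)] so[OF pU(2)] so[OF pU(3)] ijk by (simp add: Fijk in_triangle_def D_def)
    then have "good (q(v := p)) (F # h) c Z"
      by (intro good_inner[OF b goodp gp]) (use F False in \<open>simp_all add: v_def\<close>)
    moreover have "segment_free (q(v := p)) (arcs_of (F # h))"
    proof (rule free_step)
      fix l x y assume l: "l \<in> {i, j, k}" and xy: "(x, y) \<in> arcs_of h" and d: "l \<noteq> x" "l \<noteq> y"
      have lv: "l < v" using l ijk by auto
      show "closed_segment p (q l) \<inter> closed_segment (q x) (q y) = {}"
      proof (rule ccontr)
        assume "\<not> ?thesis"
        then obtain r where r: "r \<in> closed_segment p (q l)" "r \<in> closed_segment (q x) (q y)" by blast
        then obtain t where t: "0 \<le> t" "t \<le> 1" "r = (1 - t) *\<^sub>R p + t *\<^sub>R q l" by (auto simp: in_segment)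
        have "t \<noteq> 1" using not_vertex[OF xy lv d] r t by auto
        then have t1: "1 - t > 0" using t by simp
        have ge: "c * orient (q i) (q j) (q l) \<ge> 0" "c * orient (q j) (q k) (q l) \<ge> 0" "c * orient (q k) (q i) (q l) \<ge> 0"
          using l cD rot by (auto simp: D_def)
        have pos: "c * orient a b' r > 0" if "c * orient a b' p > 0" "c * orient a b' (q l) \<ge> 0" for a b'
        proof -
          have "c * orient a b' r = (1 - t) * (c * orient a b' p) + t * (c * orient a b' (q l))"
            unfolding t(3) orient_affine by (simp add: algebra_simps)
          moreover have "(1 - t) * (c * orient a b' p) > 0" using t1 that by simp
          moreover have "t * (c * orient a b' (q l)) \<ge> 0" using t that by simp
          ultimately show ?thesis by linarith
        qed
        show False
          using no_edge_inside_face[OF b g gen free FZ xy Fijk r(2)] pos[OF pU(1) ge(1)] pos[OF pU(2) ge(2)]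
            pos[OF pU(3) ge(3)] by blast
      qed
    qed
    ultimately show ?thesis using gp unfolding len by blast
  next
    case True
    have Zijk: "Z = (i, j, k)" using True Fijk by simp
    have sD: "sgn D = - c" using g by (simp add: good_def Zijk D_def)
    have cD: "c * D < 0" using sD D by (auto simp: sgn_if split: if_splits)
    \<comment> \<open>The cone behind \<open>q i\<close>: beyond the lines \<open>i j\<close> and
      \<open>k i\<close>, on the inner side of \<open>j k\<close>. No old point is strictly beyond
      the first two lines, which therefore separate the new edges from the old ones.\<close>
    define U where "U = {p. c * orient (q i) (q j) p > 0} \<inter> {p. c * orient (q j) (q k) p < 0} \<inter>
      {p. c * orient (q k) (q i) p > 0}"
    have "open U" unfolding U_def by (intro open_Int open_Collect_less continuous_intros)
    moreover have "U \<noteq> {}"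
    proof -
      \<comment> \<open>The point with barycentric coordinates 3, -1, -1.\<close>
      define p where "p = 3 *\<^sub>R q i - q j - q k"
      have e: "orient (q i) (q j) p = - D" "orient (q j) (q k) p = 3 * D" "orient (q k) (q i) p = - D"
        by (simp_all add: D_def p_def orient_def algebra_simps)
      have "p \<in> U" using cD cD[unfolded mult.commute[of c D]] by (simp add: U_def e mult.left_commute)
      then show ?thesis by blast
    qed
    ultimately obtain p where p: "p \<in> U" and gp: "generic (q(v := p)) (Suc v)" using place by blast
    have pU: "c * orient (q i) (q j) p > 0" "c * orient (q j) (q k) p < 0" "c * orient (q k) (q i) p > 0"
      using p by (simp_all add: U_def)
    have sg: "sgn t = c" if "c * t > 0" for t using that c1 by (auto simp: sgn_if)
    have sg': "sgn t = - c" if "c * t < 0" for t using that c1 by (auto simp: sgn_if)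
    have "good (q(v := p)) (Z # h) c (j, k, v)"
      by (rule good_outer[OF b goodp gp _ v_def, where x = i])
        (use ijk sg[OF pU(1)] sg'[OF pU(2)] sg[OF pU(3)] True in \<open>simp_all add: v_def Fijk\<close>)
    moreover have "segment_free (q(v := p)) (arcs_of (F # h))"
    proof (rule free_step)
      fix l x y assume l: "l \<in> {i, j, k}" and xy: "(x, y) \<in> arcs_of h" and d: "l \<noteq> x" "l \<noteq> y"
      have lv: "l < v" using l ijk by auto
      have below: "c * orient (q i) (q j) (q u) \<le> 0 \<and> c * orient (q k) (q i) (q u) \<le> 0" if u: "u < v" for u
      proof (cases "u \<in> fverts F")
        case True
        then show ?thesis using cD rot by (auto simp: Fijk D_def)
      next
        case False
        then have "in_face q Z u" using g u \<open>F = Z\<close> by (auto simp: good_def v_def)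
        then have "orient (q i) (q j) (q u) * D > 0" "orient (q k) (q i) (q u) * D > 0"
          by (simp_all add: Zijk in_triangle_def D_def)
        then show ?thesis using cD c1 by (auto simp: zero_less_mult_iff)
      qed
      have xyv: "x < v" "y < v" using build_arcs[OF b xy] by (auto simp: v_def)
      \<comment> \<open>The old edge stays on the nonpositive side of the line through
        \<open>q a\<close> and \<open>q b'\<close>; the new edge is strictly positive except at its
        end \<open>q l\<close>, which is not on the old edge.\<close>
      have sep: False if e: "c * orient (q a) (q b') p > 0" "orient (q a) (q b') (q l) = 0"
        "c * orient (q a) (q b') (q x) \<le> 0" "c * orient (q a) (q b') (q y) \<le> 0"
        and r: "r \<in> closed_segment p (q l)" "r \<in> closed_segment (q x) (q y)" for a b' r
      proof -
        obtain t where t: "0 \<le> t" "t \<le> 1" "r = (1 - t) *\<^sub>R p + t *\<^sub>R q l" using r by (auto simp: in_segment)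
        obtain s where s: "0 \<le> s" "s \<le> 1" "r = (1 - s) *\<^sub>R q x + s *\<^sub>R q y" using r by (auto simp: in_segment)
        have "t \<noteq> 1" using not_vertex[OF xy lv d] r t by auto
        then have "(1 - t) * (c * orient (q a) (q b') p) > 0" using t e(1) by simp
        moreover have "c * orient (q a) (q b') r = (1 - t) * (c * orient (q a) (q b') p)"
          unfolding t(3) orient_affine using e(2) by (simp add: algebra_simps)
        moreover have "c * orient (q a) (q b') r = (1 - s) * (c * orient (q a) (q b') (q x)) + s * (c * orient (q a) (q b') (q y))"
          unfolding s(3) orient_affine by (simp add: algebra_simps)
        moreover have "(1 - s) * (c * orient (q a) (q b') (q x)) \<le> 0" "s * (c * orient (q a) (q b') (q y)) \<le> 0"
          using s e by (simp_all add: mult_nonneg_nonpos)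
        ultimately show False by linarith
      qed
      show "closed_segment p (q l) \<inter> closed_segment (q x) (q y) = {}"
      proof (cases "l = k")
        case True
        then show ?thesis
          using sep[OF pU(3)] below[OF xyv(1)] below[OF xyv(2)] by auto
      next
        case False
        then have "l = i \<or> l = j" using l by auto
        then have "orient (q i) (q j) (q l) = 0" by auto
        then show ?thesis
          using sep[OF pU(1)] below[OF xyv(1)] below[OF xyv(2)] by blast
      qed
    qed
    ultimately show ?thesis using gp True unfolding len by blast
  qed
qed

lemma straight_drawing_exists:
  assumes "build h"
  shows "\<exists>q c Z. generic q (length h + 3) \<and> segment_free q (arcs_of h) \<and> good q h c Z"
  using assms
proof (induction rule: build.induct)
  case build_Nil
  define q :: "nat \<Rightarrow> real^2" where "q i = (if i = 0 then 0 else if i = 1 then axis 1 1 else axis 2 1)" for i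
  have gen: "generic q 3"
    unfolding generic_def
  proof (intro allI impI)
    fix a b c :: nat assume l: "a < 3" "b < 3" "c < 3" and ne: "a \<noteq> b" "b \<noteq> c" "c \<noteq> a"
    have three: "x = 0 \<or> x = 1 \<or> x = 2" if "x < 3" for x :: nat using that by linarith
    from three[OF l(1)] three[OF l(2)] three[OF l(3)] ne have "(a, b, c) \<in> {(0, 1, 2), (1, 2, 0), (2, 0, 1), (0, 2, 1), (2, 1, 0), (1, 0, 2)}"
      by (elim disjE) simp_all
    moreover have "orient (q 0) (q 1) (q 2) \<noteq> 0" by (simp add: q_def orient_def axis_def)
    moreover have "orient (q 1) (q 2) (q 0) = orient (q 0) (q 1) (q 2)" "orient (q 2) (q 0) (q 1) = orient (q 0) (q 1) (q 2)"
      "orient (q 0) (q 2) (q 1) = - orient (q 0) (q 1) (q 2)" "orient (q 2) (q 1) (q 0) = - orient (q 0) (q 1) (q 2)"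
      "orient (q 1) (q 0) (q 2) = - orient (q 0) (q 1) (q 2)"
      by (simp_all add: orient_def algebra_simps)
    ultimately show "orient (q a) (q b) (q c) \<noteq> 0"
      by (elim insertE emptyE) (simp_all only: prod.inject neg_equal_0_iff_equal, simp_all)
  qed
  have "segment_free q (arcs_of [])"
  proof (rule segment_freeI)
    fix u w x y assume "(u, w) \<in> arcs_of []" "(x, y) \<in> arcs_of []" "distinct [u, w, x, y]"
    then have "u < 3" "w < 3" "x < 3" "y < 3" "u \<noteq> w" "u \<noteq> x" "u \<noteq> y" "w \<noteq> x" "w \<noteq> y" "x \<noteq> y" by auto
    then have False by linarith
    then show "closed_segment (q u) (q w) \<inter> closed_segment (q x) (q y) = {}" ..
  qed
  moreover have "orient (q 0) (q 1) (q 2) \<noteq> 0" by (rule genericD[OF gen]) simp_all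
  then obtain c Z where "good q [] c Z" using good_Nil[of q] by blast
  moreover have "generic q (length ([] :: face list) + 3)" using gen by simp
  ultimately show ?case by blast
next
  case (build_Cons h F)
  then show ?case using straight_drawing_step by blast
qed

section \<open>Perturbation of drawings into general position\<close>

lemma cross_meet:
  assumes "cross a b c d"
  shows "closed_segment a b \<inter> closed_segment c d \<noteq> {}"
proof -
  have lin: "\<exists>t. 0 \<le> t \<and> t \<le> 1 \<and> p - r \<noteq> 0 \<and> t = p / (p - r)" if pr: "p * r < 0" for p r :: real
  proof -
    have "0 \<le> p / (p - r) \<and> p / (p - r) \<le> 1 \<and> p - r \<noteq> 0"
    proof (cases "p > 0")
      case True
      then have "r < 0" using pr by (simp add: mult_less_0_iff)
      then show ?thesis using True by simp
    next
      case False
      then have "r > 0" "p < 0" using pr by (auto simp: mult_less_0_iff)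
      then show ?thesis by (simp add: divide_nonpos_neg divide_le_eq_1)
    qed
    then show ?thesis by blast
  qed
  define p r where "p = orient c d a" "r = orient c d b"
  define p' r' where "p' = orient a b c" "r' = orient a b d"
  obtain t where t: "0 \<le> t" "t \<le> 1" "p - r \<noteq> 0" "t = p / (p - r)"
    using lin[of p r] assms by (auto simp: cross_def p_r_def)
  obtain s where s: "0 \<le> s" "s \<le> 1" "p' - r' \<noteq> 0" "s = p' / (p' - r')"
    using lin[of p' r'] assms by (auto simp: cross_def p'_r'_def)
  have e: "p' - r' = - (p - r)" by (simp add: p_r_def p'_r'_def orient_def algebra_simps)
  \<comment> \<open>Both sides are \<open>p - r\<close> times the intersection point, once as a
    combination of \<open>a\<close> and \<open>b\<close>, once of \<open>c\<close> and
    \<open>d\<close>.\<close>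
  have id: "- r *\<^sub>R a + p *\<^sub>R b = r' *\<^sub>R c - p' *\<^sub>R d"
    by (simp add: p_r_def p'_r'_def vec_eq_iff forall_2 orient_def algebra_simps)
  have "(p - r) *\<^sub>R ((1 - t) *\<^sub>R a + t *\<^sub>R b) = ((p - r) - p) *\<^sub>R a + p *\<^sub>R b"
    using t(3,4) by (simp add: scaleR_right_distrib right_diff_distrib)
  also have "\<dots> = r' *\<^sub>R c - p' *\<^sub>R d" using id by simp
  also have "\<dots> = (p - r) *\<^sub>R ((1 - s) *\<^sub>R c + s *\<^sub>R d)"
  proof -
    have "(p - r) * s = - p'" using s(3,4) e by (simp add: field_simps)
    moreover have "(p - r) * (1 - s) = r'" using s(3,4) e by (simp add: field_simps)
    ultimately show ?thesis by (simp add: scaleR_right_distrib)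
  qed
  finally have "(1 - t) *\<^sub>R a + t *\<^sub>R b = (1 - s) *\<^sub>R c + s *\<^sub>R d" using t(3) by simp
  moreover have "(1 - t) *\<^sub>R a + t *\<^sub>R b \<in> closed_segment a b" using t by (auto simp: in_segment)
  moreover have "(1 - s) *\<^sub>R c + s *\<^sub>R d \<in> closed_segment c d" using s by (auto simp: in_segment)
  ultimately show ?thesis by auto
qed

text \<open>Disjoint segments have a positive distance \<open>e\<close>, and moving each end by less
  than \<open>e / 2\<close> cannot make them meet. Mere absence of a crossing would not do, as
  touching segments may cross after a perturbation.\<close>

lemma not_cross_near:
  assumes "closed_segment a b \<inter> closed_segment c d = {}"
  shows "\<exists>\<delta>>0. \<forall>a' b' c' d'. dist a a' < \<delta> \<longrightarrow> dist b b' < \<delta> \<longrightarrow> dist c c' < \<delta> \<longrightarrow> dist d d' < \<delta> \<longrightarrow>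
    \<not> cross a' b' c' d'"
proof -
  obtain e where e: "e > 0" "\<And>x y. x \<in> closed_segment a b \<Longrightarrow> y \<in> closed_segment c d \<Longrightarrow> e \<le> dist x y"
    using separate_compact_closed[OF compact_segment(1) closed_segment assms] by auto
  have near: "\<exists>y\<in>closed_segment u w. dist x y < \<delta>"
    if x: "x \<in> closed_segment u' w'" and d: "dist u u' < \<delta>" "dist w w' < \<delta>" for x u w u' w' :: "real^2" and \<delta>
  proof -
    obtain t where t: "0 \<le> t" "t \<le> 1" "x = (1 - t) *\<^sub>R u' + t *\<^sub>R w'" using x by (auto simp: in_segment)
    define y where "y = (1 - t) *\<^sub>R u + t *\<^sub>R w"
    have "x - y = (1 - t) *\<^sub>R (u' - u) + t *\<^sub>R (w' - w)" by (simp add: t y_def algebra_simps)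
    then have "dist x y \<le> (1 - t) * dist u u' + t * dist w w'"
      using t norm_triangle_ineq[of "(1 - t) *\<^sub>R (u' - u)" "t *\<^sub>R (w' - w)"]
      by (simp add: dist_norm norm_minus_commute)
    also have "\<dots> < \<delta>"
    proof (cases "t = 0")
      case False
      then have "t * dist w w' < t * \<delta>" using t d by simp
      moreover have "(1 - t) * dist u u' \<le> (1 - t) * \<delta>" using t d by (intro mult_left_mono) auto
      ultimately show ?thesis by (simp add: algebra_simps)
    qed (use d in simp)
    finally show ?thesis using t by (intro bexI[of _ y]) (auto simp: y_def in_segment)
  qed
  show ?thesis
  proof (intro exI[of _ "e / 2"] conjI allI impI notI)
    fix a' b' c' d' assume d: "dist a a' < e / 2" "dist b b' < e / 2" "dist c c' < e / 2" "dist d d' < e / 2"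
      and "cross a' b' c' d'"
    then obtain x where x: "x \<in> closed_segment a' b'" "x \<in> closed_segment c' d'" using cross_meet by blast
    obtain y z where "y \<in> closed_segment a b" "dist x y < e / 2" "z \<in> closed_segment c d" "dist x z < e / 2"
      using near[OF x(1) d(1,2)] near[OF x(2) d(3,4)] by blast
    then show False using e(2)[of y z] dist_triangle3[of y z x] by (simp add: dist_commute)
  qed (use e in simp)
qed

text \<open>Point \<open>i\<close> moves in the direction of a point \<open>mo i\<close> on a
  parabola. Orientations become quadratic polynomials in \<open>t\<close> whose leading coefficient
  is a Vandermonde determinant, so only finitely many \<open>t\<close> are bad, and a small good
  \<open>t\<close> creates no crossing.\<close>

lemma generic_perturbation:
  fixes q0 :: "nat \<Rightarrow> real^2"
  assumes fin: "finite D" and D: "\<And>u w x y. (u, w, x, y) \<in> D \<Longrightarrow> u < n \<and> w < n \<and> x < n \<and> y < n \<and>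
    closed_segment (q0 u) (q0 w) \<inter> closed_segment (q0 x) (q0 y) = {}"
  shows "\<exists>q. generic q n \<and> (\<forall>(u, w, x, y)\<in>D. \<not> cross (q u) (q w) (q x) (q y))"
proof -
  define near where "near \<delta> e \<longleftrightarrow> (\<forall>q. (\<forall>i<n. dist (q0 i) (q i) < \<delta>) \<longrightarrow>
    (case e of (u, w, x, y) \<Rightarrow> \<not> cross (q u) (q w) (q x) (q y)))" for \<delta> e
  have "\<exists>\<delta>>0. near \<delta> e" if "e \<in> D" for e
  proof -
    obtain u w x y where e: "e = (u, w, x, y)" by (cases e) auto
    show ?thesis using not_cross_near[of "q0 u" "q0 w" "q0 x" "q0 y"] D[of u w x y] that
      unfolding near_def e by (auto; meson)
  qed
  then obtain \<delta>f where \<delta>f: "\<And>e. e \<in> D \<Longrightarrow> \<delta>f e > 0" "\<And>e. e \<in> D \<Longrightarrow> near (\<delta>f e) e" by metis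
  define \<delta> where "\<delta> = Min (insert 1 (\<delta>f ` D))"
  have \<delta>: "\<delta> > 0" unfolding \<delta>_def using fin \<delta>f(1) by (subst Min_gr_iff) auto
  have \<delta>le: "\<delta> \<le> \<delta>f e" if "e \<in> D" for e unfolding \<delta>_def using fin that by (intro Min_le) auto
  define mo :: "nat \<Rightarrow> real^2" where "mo i = real i *\<^sub>R axis 1 1 + (real i)\<^sup>2 *\<^sub>R axis 2 1" for i
  define q where "q t i = q0 i + t *\<^sub>R mo i" for t i
  define B where "B = 1 + (\<Sum>i<n. norm (mo i))"
  have B: "B > 0" unfolding B_def by (intro add_pos_nonneg sum_nonneg) auto
  have moB: "norm (mo i) < B" if "i < n" for i
    using member_le_sum[of i "{..<n}" "\<lambda>i. norm (mo i)"] that by (auto simp: B_def)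
  let ?tri = "{(a, b, c) \<in> {..<n} \<times> {..<n} \<times> {..<n}. a \<noteq> b \<and> b \<noteq> c \<and> c \<noteq> a}"
  have finT: "finite ?tri" by (rule finite_subset[of _ "{..<n} \<times> {..<n} \<times> {..<n}"]) auto
  have zeros: "finite {t. orient (q t a) (q t b) (q t c) = 0}" if d: "a \<noteq> b" "b \<noteq> c" "c \<noteq> a" for a b c
  proof -
    define M where "M = ((q0 b)$1 - (q0 a)$1) * ((mo c)$2 - (mo a)$2) + ((mo b)$1 - (mo a)$1) * ((q0 c)$2 - (q0 a)$2)
      - ((q0 b)$2 - (q0 a)$2) * ((mo c)$1 - (mo a)$1) - ((mo b)$2 - (mo a)$2) * ((q0 c)$1 - (q0 a)$1)"
    have "orient (mo a) (mo b) (mo c) = (real b - real a) * (real c - real a) * (real c - real b)"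
      by (simp add: mo_def orient_def axis_def power2_eq_square algebra_simps)
    then have nz: "orient (mo a) (mo b) (mo c) \<noteq> 0" using d by simp
    have "orient (q t a) (q t b) (q t c) = orient (q0 a) (q0 b) (q0 c) + M * t + orient (mo a) (mo b) (mo c) * t\<^sup>2" for t
      by (simp add: q_def M_def orient_def power2_eq_square algebra_simps)
    then show ?thesis using finite_quadratic_zeros[of M "orient (mo a) (mo b) (mo c)"] nz by simp
  qed
  have "finite (\<Union>(a, b, c)\<in>?tri. {t. orient (q t a) (q t b) (q t c) = 0})"
    using finT zeros by (intro finite_UN_I) auto
  moreover have "infinite {0<..<\<delta> / B}" using \<delta> B by (simp add: infinite_Ioo)
  ultimately obtain t where t: "t \<in> {0<..<\<delta> / B}" "t \<notin> (\<Union>(a, b, c)\<in>?tri. {t. orient (q t a) (q t b) (q t c) = 0})"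
    by (meson finite_subset subsetI)
  have "generic (q t) n" unfolding generic_def using t(2) by auto
  moreover have "\<not> cross (q t u) (q t w) (q t x) (q t y)" if "(u, w, x, y) \<in> D" for u w x y
  proof -
    have "dist (q0 i) (q t i) < \<delta>f (u, w, x, y)" if "i < n" for i
    proof -
      have "dist (q0 i) (q t i) = t * norm (mo i)" using t(1) by (simp add: q_def dist_norm)
      also have "\<dots> \<le> t * B" using moB[OF that] t(1) by (intro mult_left_mono) auto
      also have "\<dots> < \<delta>" using t(1) B by (simp add: pos_less_divide_eq)
      finally show ?thesis using \<delta>le[OF \<open>(u, w, x, y) \<in> D\<close>] by linarith
    qed
    then show ?thesis using \<delta>f(2)[OF that] unfolding near_def by auto
  qed
  ultimately show ?thesis by auto
qed

section \<open>Counting order types and tuples\<close>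

definition realizes :: "nat \<Rightarrow> nat \<Rightarrow> (nat \<Rightarrow> face list) \<Rightarrow> (nat \<Rightarrow> real^2) \<Rightarrow> (nat \<Rightarrow> nat \<Rightarrow> nat) \<Rightarrow> bool" where
  "realizes n K T q \<pi> \<longleftrightarrow> generic q n \<and> \<pi> 0 = id \<and> (\<forall>i<K. \<pi> i permutes {..<n}) \<and>
     (\<forall>i<K. chirotope_free (q \<circ> \<pi> i) (arcs_of (T i)))"

definition triples :: "nat \<Rightarrow> (nat \<times> nat \<times> nat) set" where
  "triples n = {(a, b, c). a < b \<and> b < c \<and> c < n}"

lemma triples_finite: "finite (triples n)"
  by (rule finite_subset[of _ "{..<n} \<times> {..<n} \<times> {..<n}"]) (auto simp: triples_def)

lemma card_triples: "card (triples n) \<le> n choose 3"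
proof -
  have "inj_on (\<lambda>(a, b, c). {a, b, c}) (triples n)"
  proof (rule inj_onI)
    fix s t assume "s \<in> triples n" "t \<in> triples n"
      and st: "(case s of (a, b, c) \<Rightarrow> {a, b, c}) = (case t of (a, b, c) \<Rightarrow> {a, b, c})"
    then obtain a b c a' b' c' where s: "s = (a, b, c)" "a < b" "b < c" and t: "t = (a', b', c')" "a' < b'" "b' < c'"
      by (auto simp: triples_def)
    have *: "Min {a, b, c} = a" "Max {a, b, c} = c" "{a, b, c} - {a, c} = {b}"
      "Min {a', b', c'} = a'" "Max {a', b', c'} = c'" "{a', b', c'} - {a', c'} = {b'}"
      using s t by auto
    have e: "{a, b, c} = {a', b', c'}" using st by (simp add: s t)
    have "a = a'" "c = c'" using * e by metis+
    moreover from this have "{b} = {b'}" using * e by metis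
    ultimately show "s = t" by (simp add: s t)
  qed
  moreover have "(\<lambda>(a, b, c). {a, b, c}) ` triples n \<subseteq> {S. S \<subseteq> {..<n} \<and> card S = 3}"
    by (auto simp: triples_def)
  ultimately have "card (triples n) \<le> card {S. S \<subseteq> {..<n} \<and> card S = 3}"
    by (intro card_inj_on_le) auto
  then show ?thesis by (simp add: n_subsets)
qed

text \<open>Translating point \<open>0\<close> to the origin saves two variables.\<close>

definition configuration :: "(nat \<Rightarrow> real) \<Rightarrow> nat \<Rightarrow> real^2" where
  "configuration x v = (if v = 0 then 0 else x (2 * v - 2) *\<^sub>R axis 1 1 + x (2 * v - 1) *\<^sub>R axis 2 1)"

definition triple_orient :: "(nat \<Rightarrow> real^2) \<Rightarrow> nat \<times> nat \<times> nat \<Rightarrow> real" where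
  "triple_orient q = (\<lambda>(a, b, c). orient (q a) (q b) (q c))"

text \<open>The positive increasing triples determine all orientation signs: genericity excludes
  zeros, and permuting a triple changes the sign in a known way.\<close>

definition order_types :: "nat \<Rightarrow> (nat \<times> nat \<times> nat) set set" where
  "order_types n = {{i \<in> triples n. triple_orient q i > 0} | q. generic q n}"

lemma triple_orient_poly:
  assumes "i \<in> triples n"
  shows "polyf (2 * n - 2) 2 (\<lambda>x. triple_orient (configuration x) i)"
proof -
  obtain a b c where i: "i = (a, b, c)" by (cases i) auto
  have l: "a < n" "b < n" "c < n" using assms by (auto simp: triples_def i)
  have p: "polyf (2 * n - 2) 1 (\<lambda>x. configuration x v $ k)" if v: "v < n" for v and k :: 2
  proof (cases "v = 0")
    case True
    then show ?thesis by (simp add: configuration_def polyf_const)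
  next
    case False
    then have "2 * v - 2 < 2 * n - 2" "2 * v - 1 < 2 * n - 2" using v by linarith+
    then have "polyf (2 * n - 2) 1 (\<lambda>x. x (2 * v - 2) :: real)" "polyf (2 * n - 2) 1 (\<lambda>x. x (2 * v - 1) :: real)"
      using polyf_coord[of _ _ 0] by auto
    then show ?thesis using False exhaust_2[of k] by (auto simp: configuration_def axis_def)
  qed
  have "polyf (2 * n - 2) (1 + 1) (\<lambda>x. triple_orient (configuration x) i)"
    unfolding i triple_orient_def orient_def prod.case
    by (intro polyf_diff polyf_mult p l)
  then show ?thesis by (simp add: numeral_2_eq_2)
qed

lemma order_types_bound:
  assumes "n \<ge> 1"
  shows "finite (order_types n)"
    and "card (order_types n) \<le> (\<Sum>s\<le>2 * n - 2. (Suc (n choose 3) choose s) * 2 ^ s) * 4 ^ (2 * n - 2)"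
proof -
  let ?l = "2 * n - 2"
  let ?f = "\<lambda>i x. triple_orient (configuration x) i"
  let ?A = "(\<lambda>x. {i \<in> triples n. ?f i x > 0}) ` {x. (\<forall>j\<ge>?l. x j = 0) \<and> (\<forall>i\<in>triples n. ?f i x \<noteq> 0)}"
  have "order_types n \<subseteq> ?A"
  proof
    fix \<sigma> assume "\<sigma> \<in> order_types n"
    then obtain q where q: "generic q n" "\<sigma> = {i \<in> triples n. triple_orient q i > 0}"
      by (auto simp: order_types_def)
    define x where "x j = (if j < ?l then (q (Suc (j div 2)) - q 0) $ (if even j then 1 else 2) else 0)" for j
    have conf: "configuration x v = q v - q 0" if v: "v < n" for v
    proof (cases v)
      case 0
      then show ?thesis by (simp add: configuration_def)
    next
      case (Suc k)
      have "2 * k < ?l" "2 * k + 1 < ?l" using v Suc by linarith+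
      then show ?thesis by (simp add: Suc configuration_def x_def vec_eq_iff forall_2 axis_def)
    qed
    have "?f i x = triple_orient q i" if "i \<in> triples n" for i
      using that conf by (auto simp: triple_orient_def triples_def orient_def)
    moreover have "triple_orient q i \<noteq> 0" if "i \<in> triples n" for i
      using that genericD[OF q(1)] by (auto simp: triple_orient_def triples_def)
    moreover have "\<forall>j\<ge>?l. x j = 0" by (simp add: x_def)
    ultimately show "\<sigma> \<in> ?A" unfolding q(2) by (intro image_eqI[of _ _ x]) auto
  qed
  moreover have finA: "finite ?A"
    by (rule finite_subset[of _ "Pow (triples n)"]) (use triples_finite in auto)
  ultimately show "finite (order_types n)" by (rule finite_subset)
  have "card (order_types n) \<le> card ?A" using \<open>order_types n \<subseteq> ?A\<close> finA by (rule card_mono[rotated])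
  also have "\<dots> \<le> (\<Sum>s\<le>?l. (Suc (card (triples n)) choose s) * 2 ^ s) * 4 ^ ?l"
    by (rule sign_patterns_bound[OF triples_finite triple_orient_poly])
  also have "\<dots> \<le> (\<Sum>s\<le>?l. (Suc (n choose 3) choose s) * 2 ^ s) * 4 ^ ?l"
    using card_triples by (intro mult_right_mono sum_mono binomial_right_mono Suc_le_mono[THEN iffD2]) auto
  finally show "card (order_types n) \<le> (\<Sum>s\<le>?l. (Suc (n choose 3) choose s) * 2 ^ s) * 4 ^ ?l" .
qed

lemma order_type_determines_signs:
  assumes g: "generic q n" "generic q' n"
    and e: "{i \<in> triples n. triple_orient q i > 0} = {i \<in> triples n. triple_orient q' i > 0}"
    and l: "a < n" "b < n" "c < n"
  shows "sgn (orient (q a) (q b) (q c)) = sgn (orient (q' a) (q' b) (q' c))"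
proof -
  have s: "sgn (orient (q a) (q b) (q c)) = sgn (orient (q' a) (q' b) (q' c))"
    if "a < b" "b < c" "c < n" for a b c
  proof -
    have "(a, b, c) \<in> triples n" using that by (simp add: triples_def)
    then have "orient (q a) (q b) (q c) > 0 \<longleftrightarrow> orient (q' a) (q' b) (q' c) > 0"
      using e by (auto simp: triple_orient_def set_eq_iff)
    moreover have "orient (q a) (q b) (q c) \<noteq> 0" "orient (q' a) (q' b) (q' c) \<noteq> 0"
      by (rule genericD[OF g(1)] genericD[OF g(2)]; use that in simp)+
    ultimately show ?thesis by (auto simp: sgn_if)
  qed
  have r: "orient (p b) (p c) (p a) = orient (p a) (p b) (p c)" "orient (p c) (p a) (p b) = orient (p a) (p b) (p c)"
    "orient (p a) (p c) (p b) = - orient (p a) (p b) (p c)" "orient (p b) (p a) (p c) = - orient (p a) (p b) (p c)"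
    "orient (p c) (p b) (p a) = - orient (p a) (p b) (p c)" for p :: "nat \<Rightarrow> real^2"
    by (simp_all add: orient_def algebra_simps)
  consider "a = b \<or> b = c \<or> c = a" | "a < b" "b < c" | "b < c" "c < a" | "c < a" "a < b"
    | "a < c" "c < b" | "b < a" "a < c" | "c < b" "b < a" by linarith
  then show ?thesis
  proof cases
    case 1
    then show ?thesis by auto
  next
    case 2
    then show ?thesis using s l by blast
  next
    case 3
    then show ?thesis using s[OF 3 l(1)] by (simp only: r(1)[of q] r(1)[of q'])
  next
    case 4
    then show ?thesis using s[OF 4 l(2)] by (simp only: r(2)[of q] r(2)[of q'])
  next
    case 5
    then show ?thesis using s[OF 5 l(2)] by (simp only: r(3)[of q] r(3)[of q'] sgn_minus neg_equal_iff_equal)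
  next
    case 6
    then show ?thesis using s[OF 6 l(3)] by (simp only: r(4)[of q] r(4)[of q'] sgn_minus neg_equal_iff_equal)
  next
    case 7
    then show ?thesis using s[OF 7 l(1)] by (simp only: r(5)[of q] r(5)[of q'] sgn_minus neg_equal_iff_equal)
  qed
qed

lemma chirotope_free_transfer:
  assumes "\<And>a b c. a < n \<Longrightarrow> b < n \<Longrightarrow> c < n \<Longrightarrow>
      sgn (orient (q a) (q b) (q c)) = sgn (orient (q' a) (q' b) (q' c))"
    and "\<And>u w. (u, w) \<in> E \<Longrightarrow> u < n \<and> w < n" and "chirotope_free q E"
  shows "chirotope_free q' E"
proof -
  have m: "cross a b c d \<longleftrightarrow> sgn (orient a b c) * sgn (orient a b d) < 0 \<and>
      sgn (orient c d a) * sgn (orient c d b) < 0" for a b c d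
    by (simp add: cross_def sgn_mult[symmetric])
  have "cross (q' u) (q' w) (q' x) (q' y) \<longleftrightarrow> cross (q u) (q w) (q x) (q y)"
    if "u < n" "w < n" "x < n" "y < n" for u w x y
    using that assms(1) unfolding m by simp
  then show ?thesis
    using assms(2) chirotope_freeD[OF assms(3)] by (intro chirotope_freeI) blast
qed

text \<open>\<open>T' i\<close> is free of crossings also on the points
  \<open>q \<circ> \<pi> i\<close>, because only orientation signs matter; uniqueness of histories
  on that labelled set applies. For \<open>i = 0\<close> both permutations are the identity.\<close>

lemma realizes_inj:
  assumes T: "\<And>i. i < K \<Longrightarrow> T i \<in> histories m" "\<And>i. i < K \<Longrightarrow> T' i \<in> histories m"
    and r: "realizes (m + 4) K T q \<pi>" "realizes (m + 4) K T' q' \<pi>'"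
    and e: "{i \<in> triples (m + 4). triple_orient q i > 0} = {i \<in> triples (m + 4). triple_orient q' i > 0}"
    and p: "\<And>i. 1 \<le> i \<Longrightarrow> i < K \<Longrightarrow> \<pi> i = \<pi>' i" and i: "i < K"
  shows "T i = T' i"
proof -
  let ?n = "m + 4"
  have \<pi>: "\<pi>' i = \<pi> i" using p[of i] r i by (cases i) (auto simp: realizes_def)
  have perm: "\<pi> i permutes {..<?n}" using r(1) i by (simp add: realizes_def)
  have lt: "\<pi> i a < ?n" if "a < ?n" for a using permutes_in_image[OF perm, of a] that by simp
  have g: "generic q ?n" "generic q' ?n" using r by (simp_all add: realizes_def)
  have gen: "generic (q \<circ> \<pi> i) ?n"
    unfolding generic_def comp_def
    by (intro allI impI genericD[OF g(1) lt lt lt]) (simp_all add: inj_eq[OF permutes_inj[OF perm]])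
  have "chirotope_free (q \<circ> \<pi> i) (arcs_of (T' i))"
  proof (rule chirotope_free_transfer[of ?n])
    have "chirotope_free (q' \<circ> \<pi>' i) (arcs_of (T' i))" using r(2) i unfolding realizes_def by blast
    then show "chirotope_free (q' \<circ> \<pi> i) (arcs_of (T' i))" by (simp only: \<pi>)
    show "u < ?n \<and> w < ?n" if "(u, w) \<in> arcs_of (T' i)" for u w
      using histories_build[OF T(2)[OF i]] build_arcs[of "T' i" u w] that by auto
    show "sgn (orient ((q' \<circ> \<pi> i) a) ((q' \<circ> \<pi> i) b) ((q' \<circ> \<pi> i) c)) =
        sgn (orient ((q \<circ> \<pi> i) a) ((q \<circ> \<pi> i) b) ((q \<circ> \<pi> i) c))"
      if "a < ?n" "b < ?n" "c < ?n" for a b c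
      using order_type_determines_signs[OF g e lt lt lt] that by simp
  qed
  moreover have "chirotope_free (q \<circ> \<pi> i) (arcs_of (T i))" using r(1) i by (simp add: realizes_def)
  ultimately show ?thesis using history_unique[OF T(1)[OF i] T(2)[OF i] gen] by blast
qed

lemma realizable_tuples_bound:
  assumes all: "\<And>T. T \<in> PiE {..<K} (\<lambda>_. histories m) \<Longrightarrow> \<exists>q \<pi>. realizes (m + 4) K T q \<pi>" and K: "K \<ge> 1"
  shows "card (histories m) ^ K \<le> card (order_types (m + 4)) * fact (m + 4) ^ (K - 1)"
proof -
  let ?n = "m + 4"
  let ?\<T> = "PiE {..<K} (\<lambda>_. histories m)"
  have "\<forall>T\<in>?\<T>. \<exists>d. realizes ?n K T (fst d) (snd d)" using all by force
  then obtain d where d: "\<forall>T\<in>?\<T>. realizes ?n K T (fst (d T)) (snd (d T))" by (rule exE[OF bchoice])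
  define q \<pi> where "q T = fst (d T)" and "\<pi> T = snd (d T)" for T
  have r: "realizes ?n K T (q T) (\<pi> T)" if "T \<in> ?\<T>" for T using d that by (simp add: q_def \<pi>_def)
  let ?P = "{p. p permutes {..<?n}}"
  define code where "code T = ({i \<in> triples ?n. triple_orient (q T) i > 0}, \<lambda>i\<in>{1..<K}. \<pi> T i)" for T
  have "inj_on code ?\<T>"
  proof (rule inj_onI)
    fix T T' assume T: "T \<in> ?\<T>" "T' \<in> ?\<T>" and e: "code T = code T'"
    have "\<pi> T i = \<pi> T' i" if "1 \<le> i" "i < K" for i
    proof -
      have "(\<lambda>i\<in>{1..<K}. \<pi> T i) i = (\<lambda>i\<in>{1..<K}. \<pi> T' i) i" using e by (simp only: code_def prod.inject)
      then show ?thesis using that by simp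
    qed
    then have "T i = T' i" if "i < K" for i
      using T e that by (intro realizes_inj[OF _ _ r[OF T(1)] r[OF T(2)]]) (auto simp: code_def)
    then show "T = T'" using T by (intro PiE_ext[OF T]) auto
  qed
  moreover have "code ` ?\<T> \<subseteq> order_types ?n \<times> PiE {1..<K} (\<lambda>_. ?P)"
    using r by (auto simp: code_def order_types_def realizes_def)
  moreover have "finite (order_types ?n \<times> PiE {1..<K} (\<lambda>_. ?P))"
    using order_types_bound(1)[of ?n] by (intro finite_cartesian_product finite_PiE finite_permutations) auto
  ultimately have "card ?\<T> \<le> card (order_types ?n \<times> PiE {1..<K} (\<lambda>_. ?P))" by (rule card_inj_on_le)
  moreover have "card ?P = fact ?n" using card_permutations[of "{..<?n}" ?n] by simp
  ultimately show ?thesis by (simp add: card_cartesian_product card_PiE)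
qed

section \<open>The numerical inequality\<close>

text \<open>The estimates \<open>(2 * M) ^ s / fact s\<close> of the terms at least double from each
  \<open>s\<close> to the next up to \<open>M\<close>, so the sum is at most twice the last
  one.\<close>

lemma weighted_binomial_sum_le:
  assumes "l \<le> M"
  shows "fact l * (\<Sum>s\<le>l. (M choose s) * 2 ^ s) \<le> 2 * (2 * M) ^ l"
  using assms
proof (induction l)
  case (Suc l)
  have "fact (Suc l) * (M choose Suc l) \<le> M ^ Suc l"
    using binomial_fact_pow[of M "Suc l"] by (simp only: mult.commute)
  then have "fact (Suc l) * ((M choose Suc l) * 2 ^ Suc l) \<le> (2 * M) ^ Suc l"
    by (simp add: power_mult_distrib mult.left_commute del: fact_Suc binomial_Suc_Suc)
  moreover have "fact (Suc l) * (\<Sum>s\<le>l. (M choose s) * 2 ^ s) \<le> Suc l * (2 * (2 * M) ^ l)"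
  proof -
    have "fact (Suc l) * (\<Sum>s\<le>l. (M choose s) * 2 ^ s) = Suc l * (fact l * (\<Sum>s\<le>l. (M choose s) * 2 ^ s))"
      by (simp only: fact_Suc of_nat_id mult.assoc)
    also have "\<dots> \<le> Suc l * (2 * (2 * M) ^ l)" using Suc by (intro mult_left_mono) auto
    finally show ?thesis .
  qed
  moreover have "(2 * Suc l) * (2 * M) ^ l \<le> (2 * M) * (2 * M) ^ l" using Suc.prems by (intro mult_right_mono) auto
  then have "Suc l * (2 * (2 * M) ^ l) \<le> (2 * M) ^ Suc l" by (simp only: power_Suc mult_ac)
  ultimately show ?case unfolding sum.atMost_Suc distrib_left by linarith
qed simp

text \<open>A single term of the exponential series; it stands in for Stirling's lower bound on
  factorials.\<close>

lemma power_div_fact_le_exp: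
  assumes "x \<ge> 0"
  shows "x ^ m / fact m \<le> exp (x :: real)"
proof -
  have "sum (\<lambda>n. x ^ n /\<^sub>R fact n) {m} \<le> (\<Sum>n. x ^ n /\<^sub>R fact n)"
    using assms by (intro sum_le_suminf summable_exp_generic) auto
  then show ?thesis by (simp add: exp_def field_simps)
qed

lemma ln_2_bounds: "ln (2::real) \<ge> (693 / 1000)"
  and ln_3_bounds: "ln (3::real) \<ge> (549 / 500)" "ln (3::real) \<le> (1099 / 1000)"
proof -
  show "ln (2::real) \<ge> (693 / 1000)" using ln_approx_bounds[of 2 3] by (simp add: eval_nat_numeral)
  show "ln (3::real) \<ge> (549 / 500)" "ln (3::real) \<le> (1099 / 1000)"
    using ln_approx_bounds[of 3 5] by (simp_all add: eval_nat_numeral)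
qed

lemma ln_le_tangent: "x > 0 \<Longrightarrow> a > 0 \<Longrightarrow> ln x \<le> ln a + x / a - (1 :: real)"
  using ln_le_minus_one[of "x / a"] by (simp add: ln_div)

text \<open>The logarithm of the final estimate, with \<open>x = n - 1\<close>. The concave
  \<open>ln x\<close> is bounded by its tangents at 128 and 192, numbers whose logarithms are
  combinations of \<open>ln 2\<close> and \<open>ln 3\<close>; this leaves a quadratic inequality on
  each side of 150.\<close>

lemma exponent_inequality:
  fixes x :: real
  assumes "106 \<le> x" "x \<le> 192"
  shows "ln 2 + 2 * x * (ln 2 - ln 3 + 2 * ln x) + 3 * x + 89 * ln x < x * ln x + 30 * (x - 3) * ln 2"
proof -
  define u w z y where "u = x * ln 2" "w = x * ln 3" "z = x * ln x" "y = x * x"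
  note u_def = this(1) and w_def = this(2) and z_def = this(3) and y_def = this(4)
  have goal: "ln 2 + 2 * x * (ln 2 - ln 3 + 2 * ln x) + 3 * x + 89 * ln x < x * ln x + 30 * (x - 3) * ln 2 \<longleftrightarrow>
      ln 2 + 2 * u - 2 * w + 4 * z + 3 * x + 89 * ln x < z + 30 * u - 90 * ln 2"
    by (simp add: u_def w_def z_def algebra_simps)
  have w1: "x * (549 / 500) \<le> w" and w2: "w \<le> x * (1099 / 1000)"
    unfolding w_def using assms ln_3_bounds by (auto intro!: mult_left_mono)
  show ?thesis
proof (cases "x \<le> 150")
  case True
  have "ln (128 :: real) = 7 * ln 2" using ln_realpow[of 2 7] by simp
  then have "ln x \<le> 7 * ln 2 + x / 128 - 1" using ln_le_tangent[of x 128] assms by simp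
  then have 1: "(3 * x + 89) * ln x \<le> (3 * x + 89) * (7 * ln 2 + x / 128 - 1)"
    using assms by (intro mult_left_mono) auto
  \<comment> \<open>\<open>7 * x - 714\<close> is the net coefficient of \<open>ln 2\<close> after
    the tangent bound. It is nonnegative from 102 on, so a lower bound on \<open>ln 2\<close>
    suffices.\<close>
  have 2: "(7 * x - 714) * (693 / 1000) \<le> (7 * x - 714) * ln 2"
    using assms ln_2_bounds by (intro mult_left_mono) auto
  \<comment> \<open>Chord bound for the square of \<open>x\<close> on the interval, which makes the
    remaining claim linear.\<close>
  have 4: "(x - 106) * (150 - x) \<ge> 0" using assms True by simp
  have "3 * z + 89 * ln x \<le> 21 * u + 3 / 128 * y - 3 * x + 623 * ln 2 + 89 / 128 * x - 89"
    using 1 by (simp add: u_def z_def y_def algebra_simps)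
  moreover have "(4851 / 1000) * x - (494802 / 1000) \<le> 7 * u - 714 * ln 2"
  proof -
    have "(7 * x - 714) * (693 / 1000) = (4851 / 1000) * x - (494802 / 1000)" "(7 * x - 714) * ln 2 = 7 * u - 714 * ln 2"
      by (simp_all add: u_def field_simps)
    then show ?thesis using 2 by simp
  qed
  moreover have "256 * x - y - 15900 \<ge> 0" using 4 by (simp add: y_def algebra_simps)
  ultimately show ?thesis unfolding goal using w1 assms by linarith
next
  case False
  have "ln (192 :: real) = ln 3 + 6 * ln 2" using ln_mult[of 3 "2 ^ 6"] ln_realpow[of 2 6] by simp
  then have "ln x \<le> ln 3 + 6 * ln 2 + x / 192 - 1" using ln_le_tangent[of x 192] assms by simp
  then have 1: "(3 * x + 89) * ln x \<le> (3 * x + 89) * (ln 3 + 6 * ln 2 + x / 192 - 1)"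
    using assms by (intro mult_left_mono) auto
  have 2: "(10 * x - 625) * (693 / 1000) \<le> (10 * x - 625) * ln 2"
    using assms ln_2_bounds by (intro mult_left_mono) auto
  have 4: "(x - 150) * (192 - x) \<ge> 0" using assms False by simp
  have "3 * z + 89 * ln x \<le> 3 * w + 18 * u + 3 / 192 * y - 3 * x + 89 * ln 3 + 534 * ln 2 + 89 / 192 * x - 89"
    using 1 by (simp add: u_def w_def z_def y_def algebra_simps)
  moreover have "(693 / 100) * x - (433125 / 1000) \<le> 10 * u - 625 * ln 2"
  proof -
    have "(10 * x - 625) * (693 / 1000) = (693 / 100) * x - (433125 / 1000)" "(10 * x - 625) * ln 2 = 10 * u - 625 * ln 2"
      by (simp_all add: u_def field_simps)
    then show ?thesis using 2 by simp
  qed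
  moreover have "342 * x - y - 28800 \<ge> 0" using 4 by (simp add: y_def algebra_simps)
  ultimately show ?thesis unfolding goal using w2 assms ln_3_bounds by linarith
qed
qed

text \<open>\<open>6 * (Suc k choose 3)\<close> equals \<open>k ^ 3 - k\<close>, and
  \<open>k \<ge> 6\<close> pays for the additional polynomial counted by the outer
  \<open>Suc\<close>.\<close>

lemma choose_3_bound:
  assumes "k \<ge> 6"
  shows "6 * Suc (Suc k choose 3) \<le> k ^ 3"
proof -
  obtain j where k: "k = Suc j" using assms by (cases k) auto
  have a: "3 * (Suc k choose 3) = Suc k * (k choose 2)"
    using Suc_times_binomial[of 2 k] by (simp only: eval_nat_numeral)
  have b: "2 * (k choose 2) = k * j" by (simp add: choose_two k)
  have "6 * c = 2 * (3 * c)" for c :: nat by simp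
  then have "6 * (Suc k choose 3) = 2 * (3 * (Suc k choose 3))" .
  also have "\<dots> = Suc k * (2 * (k choose 2))" by (simp only: a mult.left_commute)
  finally have "6 * (Suc k choose 3) = Suc k * k * j" by (simp only: b mult.assoc)
  then show ?thesis using assms by (simp add: k power3_eq_cube algebra_simps)
qed

lemma prod_even_numbers: "(\<Prod>j<m. 2 * j + 4) = 2 ^ m * fact (Suc m)" for m :: nat
  by (induction m) (simp_all add: algebra_simps)

text \<open>With \<open>x = k = n - 1\<close>, bounding \<open>fact (2 * k)\<close> from below
  leaves at most \<open>2 * exp (2 * x) * (2 * x ^ 2 / 3) ^ (2 * k)\<close> for the order types. On
  the right, 29 of the 30 factors \<open>fact (n - 3)\<close> absorb the factors
  \<open>fact n\<close> at a cost of \<open>x ^ 3\<close> each, and the last is at least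
  \<open>x ^ k / (exp x * x ^ 2)\<close>. The exponent 89 is 87 + 2.\<close>

lemma tuple_count_inequality:
  assumes "107 \<le> n" "n \<le> 193"
  shows "(\<Sum>s\<le>2 * n - 2. (Suc (n choose 3) choose s) * 2 ^ s) * 4 ^ (2 * n - 2) * fact n ^ 29
    < (2 ^ (n - 4) * fact (n - 3)) ^ 30"
proof -
  define k where "k = n - 1"
  have k: "106 \<le> k" "k \<le> 192" "n = Suc k" using assms by (auto simp: k_def)
  define M where "M = Suc (n choose 3)"
  define A where "A = (\<Sum>s\<le>2 * k. (M choose s) * 2 ^ s) * 4 ^ (2 * k)"
  define x where "x = real k"
  have x: "106 \<le> x" "x \<le> 192" using k by (auto simp: x_def)
  have M: "6 * M \<le> k ^ 3" using choose_3_bound[of k] k by (simp add: M_def)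
  have lM: "2 * k \<le> M"
  proof -
    have "n choose 2 \<le> n choose 3" using k by (intro binomial_mono) auto
    moreover have "n choose 2 = n * (n - 1) div 2" by (rule choose_two)
    moreover have "2 * k * 2 \<le> n * (n - 1)" using k by simp
    ultimately show ?thesis by (simp add: M_def)
  qed
  have "fact (2 * k) * A = (fact (2 * k) * (\<Sum>s\<le>2 * k. (M choose s) * 2 ^ s)) * 4 ^ (2 * k)"
    by (simp add: A_def)
  also have "\<dots> \<le> 2 * (2 * M) ^ (2 * k) * 4 ^ (2 * k)"
    by (intro mult_right_mono weighted_binomial_sum_le lM) simp
  also have "\<dots> = 2 * (8 * M) ^ (2 * k)"
  proof -
    have e: "8 * M = 2 * M * 4" by simp
    show ?thesis by (simp only: e power_mult_distrib mult.assoc)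
  qed
  finally have "real (fact (2 * k) * A) \<le> real (2 * (8 * M) ^ (2 * k))" by (simp only: of_nat_le_iff)
  also have "\<dots> = 2 * (8 * real M) ^ (2 * k)" by simp
  also have "\<dots> \<le> 2 * (4 * x ^ 3 / 3) ^ (2 * k)"
  proof -
    have "real (6 * M) \<le> real (k ^ 3)" using M by (simp only: of_nat_le_iff)
    then have "8 * real M \<le> 4 * x ^ 3 / 3" by (simp add: x_def)
    then show ?thesis by (intro mult_left_mono power_mono) auto
  qed
  finally have A1: "fact (2 * k) * real A \<le> 2 * (4 * x ^ 3 / 3) ^ (2 * k)" by simp
  have "(2 * x) ^ (2 * k) / fact (2 * k) \<le> exp (2 * x)" using x by (intro power_div_fact_le_exp) auto
  then have f2: "(2 * x) ^ (2 * k) \<le> exp (2 * x) * fact (2 * k)" by (simp add: field_simps)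
  have "fact (2 * k) * ((2 * x) ^ (2 * k) * real A) \<le> (2 * x) ^ (2 * k) * (2 * (4 * x ^ 3 / 3) ^ (2 * k))"
    using mult_left_mono[OF A1, of "(2 * x) ^ (2 * k)"] x by (simp add: mult_ac)
  also have "\<dots> = (2 * x) ^ (2 * k) * ((2 * x) ^ (2 * k) * (2 * (2 * x\<^sup>2 / 3) ^ (2 * k)))"
  proof -
    have "4 * x ^ 3 / 3 = (2 * x) * (2 * x\<^sup>2 / 3)" by (simp add: power2_eq_square power3_eq_cube)
    then show ?thesis by (simp only: power_mult_distrib mult_ac)
  qed
  also have "\<dots> \<le> (exp (2 * x) * fact (2 * k)) * ((2 * x) ^ (2 * k) * (2 * (2 * x\<^sup>2 / 3) ^ (2 * k)))"
    using f2 x by (intro mult_right_mono) auto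
  also have "\<dots> = fact (2 * k) * ((2 * x) ^ (2 * k) * (exp (2 * x) * (2 * (2 * x\<^sup>2 / 3) ^ (2 * k))))"
    by (simp only: mult_ac)
  finally have A2: "real A \<le> exp (2 * x) * (2 * (2 * x\<^sup>2 / 3) ^ (2 * k))"
    using x by simp
  define g where "g = real (fact (n - 3))"
  have g0: "g > 0" by (simp add: g_def)
  define j where "j = k - 2"
  have j: "k = Suc (Suc j)" using k(1) by (simp add: j_def)
  have gj: "g = fact j" using k j by (simp add: g_def)
  have "x ^ k / fact k \<le> exp x" using x by (intro power_div_fact_le_exp) auto
  then have "x ^ k \<le> exp x * fact k" by (simp add: field_simps)
  also have "fact k = x * (x - 1) * g" by (simp add: x_def j gj)
  also have "exp x * (x * (x - 1) * g) \<le> exp x * (x\<^sup>2 * g)"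
    using x g0 by (intro mult_left_mono mult_right_mono) (auto simp: power2_eq_square)
  finally have gx: "x ^ k \<le> exp x * (x\<^sup>2 * g)" .
  have "real (fact n) = (x + 1) * x * (x - 1) * g" by (simp add: k(3) x_def j gj algebra_simps)
  also have "\<dots> \<le> x ^ 3 * g"
    using x g0 by (intro mult_right_mono) (auto simp: power3_eq_cube algebra_simps)
  finally have fn: "real (fact n) \<le> x ^ 3 * g" .
  have "ln (2 * (2 * x\<^sup>2 / 3) ^ (2 * k) * exp (3 * x) * x ^ 89) =
      ln 2 + 2 * x * (ln 2 - ln 3 + 2 * ln x) + 3 * x + 89 * ln x"
    using x by (simp add: ln_mult ln_div ln_realpow x_def)
  also have "\<dots> < x * ln x + 30 * (x - 3) * ln 2" by (rule exponent_inequality[OF x])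
  also have "\<dots> = ln (x ^ k * 2 ^ (30 * (k - 3)))"
    using x k by (simp add: ln_mult ln_realpow x_def of_nat_diff)
  finally have main: "2 * (2 * x\<^sup>2 / 3) ^ (2 * k) * exp (3 * x) * x ^ 89 < x ^ k * 2 ^ (30 * (k - 3))"
    using x by (subst (asm) ln_less_cancel_iff) auto
  have "exp x * x\<^sup>2 * (real A * x ^ 87) \<le> exp x * x\<^sup>2 * (exp (2 * x) * (2 * (2 * x\<^sup>2 / 3) ^ (2 * k)) * x ^ 87)"
    using A2 x by (intro mult_left_mono mult_right_mono) auto
  also have "\<dots> = 2 * (2 * x\<^sup>2 / 3) ^ (2 * k) * exp (3 * x) * x ^ 89"
  proof -
    have "exp (3 * x) = exp x * exp (2 * x)" by (simp flip: exp_add)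
    moreover have "x ^ 89 = x\<^sup>2 * x ^ 87" by (simp flip: power_add)
    ultimately show ?thesis by (simp only: mult_ac)
  qed
  also have "\<dots> < x ^ k * 2 ^ (30 * (k - 3))" by (rule main)
  also have "\<dots> \<le> exp x * (x\<^sup>2 * g) * 2 ^ (30 * (k - 3))" using gx by (intro mult_right_mono) auto
  also have "\<dots> = exp x * x\<^sup>2 * (g * 2 ^ (30 * (k - 3)))" by (simp only: mult_ac)
  finally have fin: "real A * x ^ 87 < g * 2 ^ (30 * (k - 3))" using x by simp
  have "real A * real (fact n) ^ 29 \<le> real A * (x ^ 3 * g) ^ 29"
    using fn by (intro mult_left_mono power_mono) auto
  also have "\<dots> = (real A * x ^ 87) * g ^ 29" by (simp add: power_mult_distrib flip: power_mult)
  also have "\<dots> < (g * 2 ^ (30 * (k - 3))) * g ^ 29" using fin g0 by (intro mult_strict_right_mono) auto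
  also have "\<dots> = (2 ^ (n - 4) * g) ^ 30"
  proof -
    have "n - 4 = k - 3" using k by simp
    moreover have "g ^ 30 = g * g ^ 29" by (simp flip: power_Suc)
    moreover have "(2::real) ^ (30 * (k - 3)) = (2 ^ (k - 3)) ^ 30" by (simp add: mult.commute flip: power_mult)
    ultimately show ?thesis by (simp only: power_mult_distrib mult_ac)
  qed
  finally have "real (A * fact n ^ 29) < real ((2 ^ (n - 4) * fact (n - 3)) ^ 30)" by (simp add: g_def)
  then have "A * fact n ^ 29 < (2 ^ (n - 4) * fact (n - 3)) ^ 30" by (simp only: of_nat_less_iff)
  moreover have "2 * n - 2 = 2 * k" using k by simp
  ultimately show ?thesis by (simp only: A_def M_def)
qed

section \<open>Conflict collections\<close>

definition history_graph :: "nat \<Rightarrow> face list \<Rightarrow> nat pair_pre_digraph" where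
  "history_graph n h = \<lparr>pverts = {..<n}, parcs = arcs_of h\<rparr>"

lemma history_graph_simps [simp]:
  "pverts (history_graph n h) = {..<n}" "parcs (history_graph n h) = arcs_of h"
  by (simp_all add: history_graph_def)

lemma history_graph_pair_graph:
  assumes "build h" "length h + 3 = n"
  shows "pair_graph (history_graph n h)"
proof -
  have fin: "finite (arcs_of h)"
    by (rule finite_subset[of _ "{..<n} \<times> {..<n}"]) (use build_arcs[OF assms(1)] assms(2) in auto)
  show ?thesis
  proof unfold_locales
    show "symmetric (with_proj (history_graph n h))"
      using build_arcs[OF assms(1)]
      by (auto simp: symmetric_def sym_def arcs_ends_def arc_to_ends_def)
  qed (use build_arcs[OF assms(1)] assms(2) fin in force)+
qed

lemma segments_share_endpoint:
  assumes "orient a b c \<noteq> 0"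
  shows "closed_segment a b \<inter> closed_segment a c = {a}"
proof -
  have "p = a" if p: "p \<in> closed_segment a b" "p \<in> closed_segment a c" for p
  proof -
    obtain t where t: "p = (1 - t) *\<^sub>R a + t *\<^sub>R c" using p(2) by (auto simp: in_segment)
    have "orient a b p = 0" by (rule orient_closed_segment[OF p(1)])
    then have "t = 0" using assms by (simp add: t orient_affine)
    then show ?thesis by (simp add: t)
  qed
  then show ?thesis by auto
qed

lemma generic_segment_free_drawing:
  assumes gen: "generic q n" and n: "3 \<le> n" and free: "segment_free q E"
    and E: "\<And>u w. (u, w) \<in> E \<Longrightarrow> u \<noteq> w \<and> u < n \<and> w < n"
  shows "crossing_free_drawing \<lparr>pverts = {..<n}, parcs = E\<rparr> q (\<lambda>u w. closed_segment (q u) (q w))"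
proof -
  have inj: "inj_on q {..<n}" using generic_inj[OF gen n] by (auto simp: inj_on_def)
  have off: "q x \<notin> closed_segment (q u) (q w)" if "(u, w) \<in> E" "x < n" "x \<noteq> u" "x \<noteq> w" for u w x
  proof
    assume "q x \<in> closed_segment (q u) (q w)"
    then have "orient (q u) (q w) (q x) = 0" by (rule orient_closed_segment)
    moreover have "orient (q u) (q w) (q x) \<noteq> 0" using that E by (intro genericD[OF gen]) auto
    ultimately show False by blast
  qed
  have share: "closed_segment (q u) (q w) \<inter> closed_segment (q u) (q y) = {q u}"
    if "u < n" "w < n" "y < n" "u \<noteq> w" "w \<noteq> y" "y \<noteq> u" for u w y
    using that by (intro segments_share_endpoint genericD[OF gen])
  have pairs: "closed_segment (q u) (q w) \<inter> closed_segment (q x) (q y) = q ` ({u, w} \<inter> {x, y})"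
    if uw: "(u, w) \<in> E" and xy: "(x, y) \<in> E" and ne: "{u, w} \<noteq> {x, y}" for u w x y
  proof -
    have l: "u \<noteq> w" "u < n" "w < n" "x \<noteq> y" "x < n" "y < n" using E[OF uw] E[OF xy] by auto
    have ne': "\<not> (u = x \<and> w = y)" "\<not> (u = y \<and> w = x)" using ne by auto
    consider "distinct [u, w, x, y]" | "u = x" | "u = y" | "w = x" | "w = y" using l(1,4) by auto
    then consider "distinct [u, w, x, y]" | "u = x" "w \<noteq> y" | "u = y" "w \<noteq> x" | "w = x" "u \<noteq> y" | "w = y" "u \<noteq> x"
      using ne' by metis
    then show ?thesis
    proof cases
      case 1
      then show ?thesis using segment_freeD[OF free uw xy 1] by auto
    next
      case 2
      have s: "{u, w} \<inter> {x, y} = {u}" using 2 l by auto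
      have g: "closed_segment (q u) (q w) \<inter> closed_segment (q u) (q y) = {q u}"
        by (rule share) (use 2 l in simp_all)
      show ?thesis unfolding s using g 2(1) by simp
    next
      case 3
      have s: "{u, w} \<inter> {x, y} = {u}" using 3 l by auto
      have g: "closed_segment (q u) (q w) \<inter> closed_segment (q u) (q x) = {q u}"
        by (rule share) (use 3 l in simp_all)
      show ?thesis unfolding s closed_segment_commute[of "q x" "q y"] using g 3(1) by simp
    next
      case 4
      have s: "{u, w} \<inter> {x, y} = {w}" using 4 l by auto
      have g: "closed_segment (q w) (q u) \<inter> closed_segment (q w) (q y) = {q w}"
        by (rule share) (use 4 l in simp_all)
      show ?thesis unfolding s closed_segment_commute[of "q u" "q w"] using g 4(1) by simp
    next
      case 5
      have s: "{u, w} \<inter> {x, y} = {w}" using 5 l by auto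
      have g: "closed_segment (q w) (q u) \<inter> closed_segment (q w) (q x) = {q w}"
        by (rule share) (use 5 l in simp_all)
      show ?thesis
        unfolding s closed_segment_commute[of "q u" "q w"] closed_segment_commute[of "q x" "q y"]
        using g 5(1) by simp
    qed
  qed
  show ?thesis unfolding crossing_free_drawing_def
  proof (intro conjI ballI, goal_cases)
    case 1
    then show ?case using inj by simp
  next
    case (2 e)
    obtain u w where e: "e = (u, w)" by force
    have uw: "(u, w) \<in> E" using 2 e by simp
    have "closed_segment (q u) (q w) \<inter> q ` {..<n} = {q u, q w}"
      using off[OF uw] E[OF uw] by auto
    then show ?case by (simp add: e closed_segment_commute)
  next
    case (3 e)
    obtain u w where e: "e = (u, w)" by force
    have uw: "(u, w) \<in> E" using 3 e by simp
    show ?case using pairs[OF uw] by (auto simp: e)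
  qed
qed

lemma history_graph_planar:
  assumes b: "build h" and n: "length h + 3 = n"
  shows "planar_graph (history_graph n h)"
proof -
  obtain q c Z where q: "generic q n" "segment_free q (arcs_of h)"
    using straight_drawing_exists[OF b] n by auto
  have arcs: "u \<noteq> w \<and> u < n \<and> w < n" if "(u, w) \<in> arcs_of h" for u w
    using build_arcs[OF b that] n by auto
  have "crossing_free_drawing (history_graph n h) q (\<lambda>u w. path_image (linepath (q u) (q w)))"
    unfolding path_image_linepath history_graph_def
    by (rule generic_segment_free_drawing[OF q(1) _ q(2) arcs]) (use n in auto)
  moreover have "arc (linepath (q u) (q w))" if "(u, w) \<in> arcs_of h" for u w
    using generic_inj[OF q(1), of u w] arcs[OF that] n by (intro arc_linepath) auto
  ultimately show ?thesis
    unfolding planar_graph_def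
    by (intro conjI history_graph_pair_graph[OF assms] exI[of _ q] exI[of _ "\<lambda>u w. linepath (q u) (q w)"]) auto
qed

text \<open>\<open>P\<close> has as many points as the graphs have vertices, so each drawing uses
  all of \<open>P\<close> and arises from drawing 0 by permuting labels. \<open>P\<close> may
  contain collinear points; a perturbation removes these and keeps disjoint edges from
  crossing.\<close>

lemma embeddable_realizes:
  assumes emb: "simultaneously_embeddable (m + 4) (history_graph (m + 4) ` T ` {..<K})"
    and K: "K \<ge> 1" and T: "\<And>i. i < K \<Longrightarrow> T i \<in> histories m"
  shows "\<exists>q \<pi>. realizes (m + 4) K T q \<pi>"
proof -
  let ?n = "m + 4"
  obtain P :: "(real^2) set" where P: "finite P" "card P = ?n"
    and ex: "\<forall>G\<in>history_graph ?n ` T ` {..<K}. \<exists>f. straight_line_embedding G P f"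
    using emb unfolding simultaneously_embeddable_def by blast
  have "\<forall>i\<in>{..<K}. \<exists>f. straight_line_embedding (history_graph ?n (T i)) P f" using ex by simp
  then obtain f where "\<forall>i\<in>{..<K}. straight_line_embedding (history_graph ?n (T i)) P (f i)"
    by (rule exE[OF bchoice])
  then have f: "f i ` {..<?n} \<subseteq> P" "inj_on (f i) {..<?n}"
    "crossing_free_drawing (history_graph ?n (T i)) (f i) (\<lambda>u w. closed_segment (f i u) (f i w))" if "i < K" for i
    using that by (auto simp: straight_line_embedding_def crossing_free_drawing_def)
  have img: "f i ` {..<?n} = P" if "i < K" for i
    using f[OF that] P by (intro card_subset_eq) (auto simp: card_image)
  have arcs: "u \<noteq> w \<and> u < ?n \<and> w < ?n" if "i < K" "(u, w) \<in> arcs_of (T i)" for i u w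
    using histories_build[OF T[OF that(1)]] build_arcs[of "T i" u w] that by auto
  have disj: "closed_segment (f i u) (f i w) \<inter> closed_segment (f i x) (f i y) = {}"
    if "i < K" "(u, w) \<in> arcs_of (T i)" "(x, y) \<in> arcs_of (T i)" "distinct [u, w, x, y]" for i u w x y
  proof -
    have "{u, w} \<noteq> {x, y}" "{u, w} \<inter> {x, y} = {}" using that(4) by auto
    moreover have "\<forall>(u, w)\<in>arcs_of (T i). \<forall>(x, y)\<in>arcs_of (T i). {u, w} \<noteq> {x, y} \<longrightarrow>
        closed_segment (f i u) (f i w) \<inter> closed_segment (f i x) (f i y) = f i ` ({u, w} \<inter> {x, y})"
      using f(3)[OF that(1)] unfolding crossing_free_drawing_def history_graph_simps by (elim conjE)
    ultimately show ?thesis using that(2,3) by force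
  qed
  have K0: "0 < K" using K by simp
  define \<pi> where "\<pi> i u = (if u < ?n then inv_into {..<?n} (f 0) (f i u) else u)" for i u
  have f\<pi>: "f 0 (\<pi> i u) = f i u" "\<pi> i u < ?n" if "i < K" "u < ?n" for i u
  proof -
    have "f i u \<in> f 0 ` {..<?n}" using img[OF that(1)] img[OF K0] that(2) by blast
    then show "f 0 (\<pi> i u) = f i u" "\<pi> i u < ?n"
      using that(2) f_inv_into_f[of "f i u" "f 0" "{..<?n}"] inv_into_into[of "f i u" "f 0" "{..<?n}"]
      by (simp_all add: \<pi>_def)
  qed
  have \<pi>inj: "u = w" if "i < K" "u < ?n" "w < ?n" "\<pi> i u = \<pi> i w" for i u w
    using f\<pi>(1)[OF that(1,2)] f\<pi>(1)[OF that(1,3)] that f(2)[OF that(1)] by (auto dest: inj_onD)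
  have \<pi>0: "\<pi> 0 = id"
    using inv_into_f_f[OF f(2)[OF K0]] by (auto simp: \<pi>_def fun_eq_iff)
  have \<pi>perm: "\<pi> i permutes {..<?n}" if "i < K" for i
  proof (rule bij_imp_permutes)
    have "inj_on (\<pi> i) {..<?n}" using \<pi>inj[OF that] by (auto simp: inj_on_def)
    moreover have "\<pi> i ` {..<?n} \<subseteq> {..<?n}" using f\<pi>(2)[OF that] by auto
    ultimately show "bij_betw (\<pi> i) {..<?n} {..<?n}"
      by (simp add: bij_betw_def endo_inj_surj)
  qed (simp add: \<pi>_def)
  \<comment> \<open>All pairs of disjoint edges of all drawings in the labels of drawing 0, since
    one perturbation has to serve them all.\<close>
  define D where "D = {(\<pi> i u, \<pi> i w, \<pi> i x, \<pi> i y) | i u w x y.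
    i < K \<and> (u, w) \<in> arcs_of (T i) \<and> (x, y) \<in> arcs_of (T i) \<and> distinct [u, w, x, y]}"
  have "\<exists>q. generic q ?n \<and> (\<forall>(u, w, x, y)\<in>D. \<not> cross (q u) (q w) (q x) (q y))"
  proof (rule generic_perturbation[of D ?n "f 0"])
    show bounds: "a < ?n \<and> b < ?n \<and> c < ?n \<and> d < ?n \<and>
        closed_segment (f 0 a) (f 0 b) \<inter> closed_segment (f 0 c) (f 0 d) = {}" if D: "(a, b, c, d) \<in> D" for a b c d
    proof -
      obtain i u w x y where i: "i < K" "(u, w) \<in> arcs_of (T i)" "(x, y) \<in> arcs_of (T i)" "distinct [u, w, x, y]"
        and e: "a = \<pi> i u" "b = \<pi> i w" "c = \<pi> i x" "d = \<pi> i y" using D unfolding D_def by blast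
      have l: "u < ?n" "w < ?n" "x < ?n" "y < ?n" using arcs[OF i(1,2)] arcs[OF i(1,3)] by auto
      show ?thesis using disj[OF i] f\<pi>[OF i(1)] l by (simp add: e)
    qed
    show "finite D"
      by (rule finite_subset[of _ "{..<?n} \<times> {..<?n} \<times> {..<?n} \<times> {..<?n}"]) (use bounds in auto)
  qed
  then obtain q where q: "generic q ?n" and nc: "\<forall>(u, w, x, y)\<in>D. \<not> cross (q u) (q w) (q x) (q y)" by blast
  have "chirotope_free (q \<circ> \<pi> i) (arcs_of (T i))" if "i < K" for i
  proof (rule chirotope_freeI)
    fix u w x y assume "(u, w) \<in> arcs_of (T i)" "(x, y) \<in> arcs_of (T i)" "distinct [u, w, x, y]"
    then have "(\<pi> i u, \<pi> i w, \<pi> i x, \<pi> i y) \<in> D" using that unfolding D_def by blast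
    then show "\<not> cross ((q \<circ> \<pi> i) u) ((q \<circ> \<pi> i) w) ((q \<circ> \<pi> i) x) ((q \<circ> \<pi> i) y)"
      using nc by auto
  qed
  then have "realizes ?n K T q \<pi>" using q \<pi>0 \<pi>perm by (simp add: realizes_def)
  then show ?thesis by blast
qed

text \<open>A tuple may repeat a history, so the collection obtained from it has at most 30
  members.\<close>

lemma small_conflict_collection:
  assumes n: "107 \<le> n" "n \<le> 193"
  shows "\<exists>\<G> :: nat pair_pre_digraph set. conflict_collection n \<G> \<and> finite \<G> \<and> card \<G> \<le> 30"
proof -
  define m where "m = n - 4"
  have m: "n = m + 4" using n by (simp add: m_def)
  define tuples where "tuples = PiE {..<30 :: nat} (\<lambda>_. histories m)"
  define collection where "collection T = history_graph n ` T ` {..<30 :: nat}" for T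
  have "\<exists>T\<in>tuples. \<not> simultaneously_embeddable n (collection T)"
  proof (rule ccontr)
    assume "\<not> ?thesis"
    then have all: "simultaneously_embeddable n (collection T)" if "T \<in> tuples" for T using that by blast
    have "\<exists>q \<pi>. realizes (m + 4) 30 T q \<pi>" if T: "T \<in> PiE {..<30 :: nat} (\<lambda>_. histories m)" for T
    proof (rule embeddable_realizes)
      show "simultaneously_embeddable (m + 4) (history_graph (m + 4) ` T ` {..<30})"
        using all[of T] T by (simp only: tuples_def collection_def m)
      show "T i \<in> histories m" if "i < 30" for i using PiE_mem[OF T] that by simp
    qed simp
    moreover have "1 \<le> (30 :: nat)" by simp
    ultimately have "card (histories m) ^ 30 \<le> card (order_types n) * fact n ^ (30 - 1)"
      unfolding m by (rule realizable_tuples_bound)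
    also have "\<dots> \<le> (\<Sum>s\<le>2 * n - 2. (Suc (n choose 3) choose s) * 2 ^ s) * 4 ^ (2 * n - 2) * fact n ^ 29"
    proof -
      have e: "30 - 1 = (29 :: nat)" and "1 \<le> n" using n by simp_all
      then show ?thesis
        unfolding e by (intro mult_right_mono order_types_bound(2) zero_le)
    qed
    also have "\<dots> < (2 ^ (n - 4) * fact (n - 3)) ^ 30" by (rule tuple_count_inequality[OF n])
    also have "2 ^ (n - 4) * fact (n - 3) = card (histories m)"
      by (simp add: card_histories prod_even_numbers m)
    finally show False by simp
  qed
  then obtain T where T: "T \<in> tuples" and ne: "\<not> simultaneously_embeddable n (collection T)" by blast
  let ?\<G> = "collection T"
  have "planar_graph G \<and> card (pverts G) = n" if "G \<in> ?\<G>" for G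
  proof -
    obtain i where i: "i < 30" "G = history_graph n (T i)" using \<open>G \<in> ?\<G>\<close> by (auto simp: collection_def)
    have "T i \<in> histories m" using PiE_mem[OF T[unfolded tuples_def], of i] i(1) by simp
    then have "build (T i)" "length (T i) + 3 = n" using histories_build m by auto
    then show ?thesis using history_graph_planar i(2) by simp
  qed
  moreover have "card ?\<G> \<le> 30"
    using card_image_le[of "T ` {..<30}" "history_graph n"] card_image_le[of "{..<30::nat}" T]
    by (simp add: collection_def)
  moreover have "finite ?\<G>" by (simp add: collection_def)
  ultimately show ?thesis
    using ne unfolding conflict_collection_def by (intro exI[of _ ?\<G>]) simp
qed

section \<open>Padding to exactly thirty graphs\<close>

lemma edgeless_graph_planar: "planar_graph \<lparr>pverts = {i..<i + n}, parcs = {}\<rparr>" for i n :: nat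
proof -
  have "pair_graph \<lparr>pverts = {i..<i + n}, parcs = {}\<rparr>"
    by unfold_locales (auto simp: symmetric_def sym_def arcs_ends_def)
  moreover have "inj_on (\<lambda>v. real v *\<^sub>R axis 1 1 :: real^2) {i..<i + n}"
    by (auto simp: inj_on_def)
  ultimately show ?thesis
    unfolding planar_graph_def crossing_free_drawing_def
    by (intro conjI exI[of _ "\<lambda>v. real v *\<^sub>R axis 1 1"]) auto
qed

text \<open>Adding planar graphs of the same order keeps a collection in conflict. Edgeless graphs
  on shifted intervals provide infinitely many candidates; for \<open>n \<ge> 1\<close> different
  shifts give different graphs.\<close>

lemma conflict_collection_extend:
  fixes \<G> :: "nat pair_pre_digraph set"
  assumes c: "conflict_collection n \<G>" and fin: "finite \<G>" and k: "card \<G> \<le> k" and n: "n \<ge> 1"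
  shows "\<exists>\<H> :: nat pair_pre_digraph set. conflict_collection n \<H> \<and> card \<H> = k"
proof -
  define E :: "nat \<Rightarrow> nat pair_pre_digraph" where "E i = \<lparr>pverts = {i..<i + n}, parcs = {}\<rparr>" for i
  have "inj E"
  proof (rule injI)
    fix i j assume "E i = E j"
    then have "{i..<i + n} = {j..<j + n}" by (simp add: E_def)
    then show "i = j" using atLeastLessThan_eq_iff[of i "i + n" j "j + n"] n by simp
  qed
  then have "infinite (range E - \<G>)" using fin finite_imageD by (metis Diff_infinite_finite infinite_UNIV_nat)
  then obtain B where B: "B \<subseteq> range E - \<G>" "finite B" "card B = k - card \<G>"
    using infinite_arbitrarily_large by blast
  have "planar_graph G \<and> card (pverts G) = n" if "G \<in> B" for G
    using that B(1) edgeless_graph_planar by (auto simp: E_def)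
  then have "conflict_collection n (\<G> \<union> B)"
    using c unfolding conflict_collection_def simultaneously_embeddable_def by blast
  moreover have "card (\<G> \<union> B) = k" using B fin k by (subst card_Un_disjoint) auto
  ultimately show ?thesis by blast
qed

theorem theorem2:
  shows "(\<forall>n \<in> {107..193}. \<sigma> n \<le> 30 \<and>
            (\<exists>\<G> :: nat pair_pre_digraph set.
               conflict_collection n \<G> \<and> finite \<G> \<and> card \<G> \<le> 30)) \<and>
         (\<exists>n. \<exists>\<G> :: nat pair_pre_digraph set.
            conflict_collection n \<G> \<and> card \<G> = 30)"
proof (intro conjI ballI)
  fix n :: nat assume "n \<in> {107..193}"
  then obtain \<G> :: "nat pair_pre_digraph set" where \<G>: "conflict_collection n \<G>" "finite \<G>" "card \<G> \<le> 30"
    using small_conflict_collection by auto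
  then show "\<exists>\<G> :: nat pair_pre_digraph set. conflict_collection n \<G> \<and> finite \<G> \<and> card \<G> \<le> 30" by blast
  have "\<sigma> n \<le> enat (card \<G>)" unfolding \<sigma>_def using \<G> by (intro Inf_lower) blast
  also have "\<dots> \<le> 30" using \<G>(3) by (metis enat_ord_simps(1) numeral_eq_enat)
  finally show "\<sigma> n \<le> 30" .
next
  obtain \<G> :: "nat pair_pre_digraph set" where \<G>: "conflict_collection 107 \<G>" "finite \<G>" "card \<G> \<le> 30"
    using small_conflict_collection[of 107] by auto
  show "\<exists>n. \<exists>\<G> :: nat pair_pre_digraph set. conflict_collection n \<G> \<and> card \<G> = 30"
    using conflict_collection_extend[OF \<G>] by auto
qed

end
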